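(* Consider chains of $N\times N$ matrices $\mathbb A,(B_1,C_1),\dots,(B_j,C_j)$ with the Poisson brackets of type (ii): $$\{\overset{1}{\mathbb A},\overset{2}{\mathbb A}\}=r_{12}\overset{1}{\mathbb A}\overset{2}{\mathbb A}-\overset{1}{\mathbb A}\overset{2}{\mathbb A}r_{12}+\overset{1}{\mathbb A}r_{12}^{t_1}\overset{2}{\mathbb A}-\overset{2}{\mathbb A}r_{12}^{t_1}\overset{1}{\mathbb A},$$ $$\{\overset{1}{B_1},\overset{2}{\mathbb A}\}=-\overset{1}{B_1}r_{12}^{t_2}\overset{2}{\mathbb A}-\overset{1}{B_1}\overset{2}{\mathbb A}r_{12},\qquad \{\overset{1}{C_1},\overset{2}{\mathbb A}\}=-\overset{1}{C_1}r_{12}^{t_2}\overset{2}{\mathbb A}-\overset{1}{C_1}\overset{2}{\mathbb A}r_{12};$$ for $1\le k\le j$, $$\{\overset{1}{B_k},\overset{2}{B_k}\}=r_{12}\overset{1}{B_k}\overset{2}{B_k}-\overset{1}{B_k}\overset{2}{B_k}r_{12},\quad \{\overset{1}{C_k},\overset{2}{C_k}\}=r_{12}\overset{1}{C_k}\overset{2}{C_k}-\overset{1}{C_k}\overset{2}{C_k}r_{12},\quad \{\overset{1}{C_k},\overset{2}{B_k}\}=r_{12}\overset{1}{C_k}\overset{2}{B_k}-\overset{1}{C_k}\overset{2}{B_k}r_{12};$$ for $1\le k\le j-1$ and all choices $X\in\{B,C\}$, $Y\in\{B,C\}$, $\{\overset{1}{X_{k+1}},\overset{2}{Y_k}\}=-\overset{1}{X_{k+1}}r_{12}^{t_2}\overset{2}{Y_k}$;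 and all other brackets equal to zero. The following are algebraically independent Casimir functions of these brackets: $\bullet$ for all $j$, the $\left[\frac N2\right]$ coefficients $Y_p$ of the $\lambda$-expansion $$\frac{\det(\lambda\mathbb A+\lambda^{-1}\mathbb A^{\mathrm T})}{\det\mathbb A}=(\lambda^N+\lambda^{-N})+\sum_{p=1}^{[N/2]}(\lambda^{N-2p}+\lambda^{2p-N})Y_p;$$ $\bullet$ for all $j$, the $N\cdot j$ coefficients $Z_p^{(k)}$ of the $\lambda$-expansions $$\frac{\det(B_k+\lambda C_k)}{\det B_k}=1+\sum_{p=1}^N\lambda^pZ_p^{(k)},\qquad k=1,\dots,j;$$ $\bullet$ for even $j$, the $\left[\frac{N+1}2\right]$ functions $$X_p=\frac{M_S^p\prod_{k=1}^jM_{C_k}^p}{M_S^{N-p}\prod_{k=1}^jM_{C_k}^{N-p}},\qquad p=0,1,\dots,\left[\tfrac{N+1}2\right]-1,$$ where $M_{C_k}^q$ are the $(q\times q)$ upper-right minors of $C_k$ and $M_S^q$ are the $(q\times q)$ upper-right minors of $S=\mathbb A^{\mathrm T}B_1^{-1}B_2^{\mathrm T}\cdots B_{j-1}^{-1}B_j^{\mathrm T}$; $\bullet$ for odd $j=2r+1$, the $\left[\frac N2\right]$ functions $$X_p:=\frac{M_S^pM_S^{N-p}\prod_{k=1}^r\left(M_{C_{2k}}^pM_{C_{2k}}^{N-p}\right)}{\prod_{k=1}^{r+1}\left(M_{C_{2k-1}}^pM_{C_{2k-1}}^{N-p}\right)}\cdot\frac{\prod_{k=1}^{r+1}[\det B_{2k-1}\det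 C_{2k-1}]}{\det\mathbb A\prod_{k=1}^r[\det B_{2k}\det C_{2k}]},\qquad p=1,\dots,[N/2],$$ where $M_S^q$ are now the $(q\times q)$ principal (situated at the upper-left corner) minors of $S=\mathbb A^{\mathrm T}B_1^{-1}B_2^{\mathrm T}\cdots B_{j-1}^{\mathrm T}B_j^{-1}$ and $M_{C_k}^q$ are the $(q\times q)$ upper-right minors of $C_k$. We therefore have $[\frac N2]+[\frac{N+1}2]+Nj=N(j+1)$ Casimir functions for even $j$ and $2[\frac N2]+Nj$ Casimir functions for odd $j$.
   Context: $\mathbb A$ is an $N\times N$ complex matrix (generic, in particular $\det\mathbb A\neq0$), $B_k,C_k\in GL_N(\mathbb C)$. $E_{i,j}$ are the $N\times N$ matrix units. For an $N\times N$ matrix $X$ write $\overset{1}{X}=X\otimes I$, $\overset{2}{X}=I\otimes X$. For $T\in \mathrm{Mat}_N\otimes\mathrm{Mat}_N$, $T^{t_1}$ and $T^{t_2}$ denote transposition in the first, respectively second, tensor factor. $\{\overset{1}{X},\overset{2}{Y}\}=\sum_{i,j,k,l}\{x_{i,j},y_{k,l}\}E_{i,j}\otimes E_{k,l}$. The classical $r$-matrix is $r_{12}=\sum_i E_{i,i}\otimes E_{i,i}+2\sum_{i>j}E_{i,j}\otimes E_{j,i}$. $[x]$ is the integer part of $x$. Casimir functions are (rational) functions that Poisson commute with all entries of all the matrices of the chain. The upper-right $(q\times q)$-minor uses rows $1,\dots,q$ and columns $N-q+1,\dots,N$; minors of size $0$ equal $1$. *)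

theory Defs
  imports
    "HOL-Library.Poly_Mapping"
    "HOL-Library.Countable"
    "HOL-Computational_Algebra.Normalized_Fraction"
    "HOL-Computational_Algebra.Formal_Laurent_Series"
    "Jordan_Normal_Form.Determinant"
    "Jordan_Normal_Form.Gauss_Jordan_Elimination"
begin

section \<open>Rational functions of the entries of the chain\<close>

datatype site = A_site | B_site nat | C_site nat

instance site :: countable by countable_datatype

datatype entry = Entry site nat nat

instance entry :: countable by countable_datatype

text \<open>
  The polynomial ring over \<open>entry\<close> is an integral domain in \<^theory>\<open>HOL-Library.Poly_Mapping\<close>
  only when the variables are linearly ordered. The order chosen is irrelevant.
\<close>

instantiation entry :: linorder
begin

definition less_eq_entry :: "entry \<Rightarrow> entry \<Rightarrow> bool"
  where "(x :: entry) \<le> y \<longleftrightarrow> to_nat x \<le> to_nat y"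

definition less_entry :: "entry \<Rightarrow> entry \<Rightarrow> bool"
  where "(x :: entry) < y \<longleftrightarrow> to_nat x < to_nat y"

instance
  by standard (auto simp: less_eq_entry_def less_entry_def)

end

type_synonym 'v cpoly = "('v \<Rightarrow>\<^sub>0 nat) \<Rightarrow>\<^sub>0 complex"

type_synonym ratfun = "entry cpoly fract"

definition indets :: "'v cpoly \<Rightarrow> 'v set"
  where "indets p = (\<Union>m\<in>Poly_Mapping.keys p. Poly_Mapping.keys m)"

definition rconst :: "complex \<Rightarrow> ratfun"
  where "rconst c = to_fract (Poly_Mapping.single 0 c)"

definition coord :: "entry \<Rightarrow> ratfun"
  where "coord v = to_fract (Poly_Mapping.single (Poly_Mapping.single v 1) 1)"

text \<open>
  All matrix indices are 0-based. The matrices of the chain are generic: their entries are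
  independent variables. In particular their determinants are nonzero elements of the field
  of rational functions.
\<close>

definition generic_mat :: "nat \<Rightarrow> site \<Rightarrow> ratfun mat"
  where "generic_mat N s = mat N N (\<lambda>(a, b). coord (Entry s a b))"

abbreviation mat_A :: "nat \<Rightarrow> ratfun mat"
  where "mat_A N \<equiv> generic_mat N A_site"

abbreviation mat_B :: "nat \<Rightarrow> nat \<Rightarrow> ratfun mat"
  where "mat_B N k \<equiv> generic_mat N (B_site k)"

abbreviation mat_C :: "nat \<Rightarrow> nat \<Rightarrow> ratfun mat"
  where "mat_C N k \<equiv> generic_mat N (C_site k)"

definition chain_sites :: "nat \<Rightarrow> site set"
  where "chain_sites j = {A_site} \<union> B_site ` {1..j} \<union> C_site ` {1..j}"

definition chain_entries :: "nat \<Rightarrow> nat \<Rightarrow> entry set"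
  where "chain_entries N j = {Entry s a b | s a b. s \<in> chain_sites j \<and> a < N \<and> b < N}"

text \<open>The field \<open>\<complex>(x | x \<in> chain_entries N j)\<close>.\<close>

definition chain_functions :: "nat \<Rightarrow> nat \<Rightarrow> ratfun set"
  where "chain_functions N j =
    {Fract p q | p q. q \<noteq> 0 \<and> indets p \<subseteq> chain_entries N j \<and> indets q \<subseteq> chain_entries N j}"


section \<open>Poisson brackets\<close>

definition poisson_bracket_on :: "ratfun set \<Rightarrow> (ratfun \<Rightarrow> ratfun \<Rightarrow> ratfun) \<Rightarrow> bool"
  where "poisson_bracket_on F br \<longleftrightarrow>
    (\<forall>f\<in>F. \<forall>g\<in>F. br f g \<in> F) \<and>
    (\<forall>f\<in>F. \<forall>g\<in>F. br f g = - br g f) \<and>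
    (\<forall>f\<in>F. \<forall>g\<in>F. \<forall>h\<in>F. br (f + g) h = br f h + br g h) \<and>
    (\<forall>c. \<forall>f\<in>F. \<forall>g\<in>F. br (rconst c * f) g = rconst c * br f g) \<and>
    (\<forall>f\<in>F. \<forall>g\<in>F. \<forall>h\<in>F. br (f * g) h = f * br g h + br f h * g) \<and>
    (\<forall>f\<in>F. \<forall>g\<in>F. \<forall>h\<in>F. br f (br g h) + br g (br h f) + br h (br f g) = 0)"

definition casimir_function ::
    "nat \<Rightarrow> nat \<Rightarrow> (ratfun \<Rightarrow> ratfun \<Rightarrow> ratfun) \<Rightarrow> ratfun \<Rightarrow> bool"
  where "casimir_function N j br f \<longleftrightarrow>
    f \<in> chain_functions N j \<and> (\<forall>v\<in>chain_entries N j. br f (coord v) = 0)"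

text \<open>
  \<open>Mat\<^sub>N \<otimes> Mat\<^sub>N\<close> is identified with the \<open>N\<^sup>2 \<times> N\<^sup>2\<close> matrices: the coefficient of
  \<open>E\<^bsub>i,j\<^esub> \<otimes> E\<^bsub>k,l\<^esub>\<close> is the entry in row \<open>i * N + k\<close> and column \<open>j * N + l\<close>. Thus
  \<open>tensor_by f X Y\<close> is the sum of \<open>f x\<^bsub>i,j\<^esub> y\<^bsub>k,l\<^esub>\<close> times \<open>E\<^bsub>i,j\<^esub> \<otimes> E\<^bsub>k,l\<^esub>\<close>; for multiplication it
  is the Kronecker product, for a Poisson bracket it is the matrix of brackets.
\<close>

definition tensor_by :: "('a \<Rightarrow> 'a \<Rightarrow> 'a) \<Rightarrow> 'a mat \<Rightarrow> 'a mat \<Rightarrow> 'a mat"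
  where "tensor_by f X Y = mat (dim_row X * dim_row Y) (dim_col X * dim_col Y)
    (\<lambda>(a, b). f (X $$ (a div dim_row Y, b div dim_col Y)) (Y $$ (a mod dim_row Y, b mod dim_col Y)))"

abbreviation kronecker :: "'a::times mat \<Rightarrow> 'a mat \<Rightarrow> 'a mat"
  where "kronecker \<equiv> tensor_by (*)"

definition in_first :: "nat \<Rightarrow> ratfun mat \<Rightarrow> ratfun mat"
  where "in_first N X = kronecker X (1\<^sub>m N)"

definition in_second :: "nat \<Rightarrow> ratfun mat \<Rightarrow> ratfun mat"
  where "in_second N X = kronecker (1\<^sub>m N) X"

definition transpose_first :: "nat \<Rightarrow> 'a mat \<Rightarrow> 'a mat"
  where "transpose_first N T = mat (N * N) (N * N)
    (\<lambda>(a, b). T $$ ((b div N) * N + a mod N, (a div N) * N + b mod N))"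

definition transpose_second :: "nat \<Rightarrow> 'a mat \<Rightarrow> 'a mat"
  where "transpose_second N T = mat (N * N) (N * N)
    (\<lambda>(a, b). T $$ ((a div N) * N + b mod N, (b div N) * N + a mod N))"

definition unit_matrix :: "nat \<Rightarrow> nat \<Rightarrow> nat \<Rightarrow> ratfun mat"
  where "unit_matrix N i j = mat N N (\<lambda>(a, b). if a = i \<and> b = j then 1 else 0)"

definition r_matrix :: "nat \<Rightarrow> ratfun mat"
  where "r_matrix N = mat (N * N) (N * N) (\<lambda>(a, b).
    (\<Sum>i<N. kronecker (unit_matrix N i i) (unit_matrix N i i) $$ (a, b)) +
    2 * (\<Sum>i<N. \<Sum>j<i. kronecker (unit_matrix N i j) (unit_matrix N j i) $$ (a, b)))"

text \<open>
  Every unordered pair of sites is covered below in one of its two orders; the brackets in the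
  opposite order follow from skew-symmetry of the Poisson bracket.
\<close>

definition type_ii_relations :: "nat \<Rightarrow> nat \<Rightarrow> (ratfun \<Rightarrow> ratfun \<Rightarrow> ratfun) \<Rightarrow> bool"
  where "type_ii_relations N j br \<longleftrightarrow>
    (let r = r_matrix N; r1 = transpose_first N r; r2 = transpose_second N r;
         L = (\<lambda>s. in_first N (generic_mat N s));
         R = (\<lambda>s. in_second N (generic_mat N s));
         PB = (\<lambda>s t. tensor_by br (generic_mat N s) (generic_mat N t))
     in
       PB A_site A_site =
         r * L A_site * R A_site - L A_site * R A_site * r
         + L A_site * r1 * R A_site - R A_site * r1 * L A_site \<and>
       (1 \<le> j \<longrightarrow> (\<forall>X\<in>{B_site, C_site}.
         PB (X 1) A_site = - (L (X 1) * r2 * R A_site) - L (X 1) * R A_site * r)) \<and>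
       (\<forall>k\<in>{1..j}.
         PB (B_site k) (B_site k) =
           r * L (B_site k) * R (B_site k) - L (B_site k) * R (B_site k) * r \<and>
         PB (C_site k) (C_site k) =
           r * L (C_site k) * R (C_site k) - L (C_site k) * R (C_site k) * r \<and>
         PB (C_site k) (B_site k) =
           r * L (C_site k) * R (B_site k) - L (C_site k) * R (B_site k) * r) \<and>
       (\<forall>k. 1 \<le> k \<and> k + 1 \<le> j \<longrightarrow> (\<forall>X\<in>{B_site, C_site}. \<forall>Y\<in>{B_site, C_site}.
         PB (X (k + 1)) (Y k) = - (L (X (k + 1)) * r2 * R (Y k)))) \<and>
       (\<forall>k\<in>{2..j}. \<forall>X\<in>{B_site, C_site}. PB (X k) A_site = 0\<^sub>m (N * N) (N * N)) \<and>
       (\<forall>k\<in>{1..j}. \<forall>l\<in>{1..j}. l + 2 \<le> k \<longrightarrow> (\<forall>X\<in>{B_site, C_site}. \<forall>Y\<in>{B_site, C_site}.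
         PB (X k) (Y l) = 0\<^sub>m (N * N) (N * N))))"


section \<open>The functions \<open>Y\<close>, \<open>Z\<close> and \<open>X\<close>\<close>

text \<open>\<open>det (\<lambda> A + \<lambda>\<^sup>-\<^sup>1 A\<^sup>T) / det A\<close>, with \<open>\<lambda>\<close> the variable of the Laurent series.\<close>

definition pencil_A :: "nat \<Rightarrow> ratfun fls"
  where "pencil_A N =
    det (fls_X \<cdot>\<^sub>m map_mat fls_const (mat_A N)
         + fls_X_inv \<cdot>\<^sub>m map_mat fls_const (transpose_mat (mat_A N)))
    / fls_const (det (mat_A N))"

text \<open>
  In the expansion of the theorem \<open>Y\<^sub>p\<close> is multiplied by \<open>\<lambda>\<^bsup>N-2p\<^esup> + \<lambda>\<^bsup>2p-N\<^esup>\<close>, which is 2 if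
  \<open>N = 2p\<close>.
\<close>

definition Y_fun :: "nat \<Rightarrow> nat \<Rightarrow> ratfun"
  where "Y_fun N p = fls_nth (pencil_A N) (int N - 2 * int p) / (if N = 2 * p then 2 else 1)"

text \<open>\<open>det (B\<^sub>k + \<lambda> C\<^sub>k) / det B\<^sub>k\<close>, with \<open>\<lambda>\<close> the polynomial variable.\<close>

definition pencil_BC :: "nat \<Rightarrow> nat \<Rightarrow> ratfun poly"
  where "pencil_BC N k =
    Polynomial.smult (1 / det (mat_B N k))
      (det (map_mat (\<lambda>x. [:x:]) (mat_B N k) + [:0, 1:] \<cdot>\<^sub>m map_mat (\<lambda>x. [:x:]) (mat_C N k)))"

definition Z_fun :: "nat \<Rightarrow> nat \<Rightarrow> nat \<Rightarrow> ratfun"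
  where "Z_fun N k p = poly.coeff (pencil_BC N k) p"

text \<open>\<open>S = A\<^sup>T B\<^sub>1\<^sup>-\<^sup>1 B\<^sub>2\<^sup>T B\<^sub>3\<^sup>-\<^sup>1 B\<^sub>4\<^sup>T \<dots>\<close> with \<open>j\<close> factors after \<open>A\<^sup>T\<close>.\<close>

fun S_mat :: "nat \<Rightarrow> nat \<Rightarrow> ratfun mat"
  where
    "S_mat N 0 = transpose_mat (mat_A N)"
  | "S_mat N (Suc k) = S_mat N k *
      (if odd (Suc k) then the (mat_inverse (mat_B N (Suc k))) else transpose_mat (mat_B N (Suc k)))"

definition upper_right_minor :: "'a::comm_ring_1 mat \<Rightarrow> nat \<Rightarrow> 'a"
  where "upper_right_minor M q = det (mat q q (\<lambda>(a, b). M $$ (a, dim_col M - q + b)))"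

definition upper_left_minor :: "'a::comm_ring_1 mat \<Rightarrow> nat \<Rightarrow> 'a"
  where "upper_left_minor M q = det (mat q q (\<lambda>(a, b). M $$ (a, b)))"

definition X_even :: "nat \<Rightarrow> nat \<Rightarrow> nat \<Rightarrow> ratfun"
  where "X_even N j p =
    (upper_right_minor (S_mat N j) p * (\<Prod>k=1..j. upper_right_minor (mat_C N k) p)) /
    (upper_right_minor (S_mat N j) (N - p) * (\<Prod>k=1..j. upper_right_minor (mat_C N k) (N - p)))"

text \<open>Here \<open>j = 2 r + 1\<close>.\<close>

definition X_odd :: "nat \<Rightarrow> nat \<Rightarrow> nat \<Rightarrow> ratfun"
  where "X_odd N r p =
    (let MS = upper_left_minor (S_mat N (2 * r + 1));
         MC = (\<lambda>k. upper_right_minor (mat_C N k))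
     in (MS p * MS (N - p) * (\<Prod>k=1..r. MC (2 * k) p * MC (2 * k) (N - p)))
        / (\<Prod>k=1..r+1. MC (2 * k - 1) p * MC (2 * k - 1) (N - p))
        * ((\<Prod>k=1..r+1. det (mat_B N (2 * k - 1)) * det (mat_C N (2 * k - 1)))
           / (det (mat_A N) * (\<Prod>k=1..r. det (mat_B N (2 * k)) * det (mat_C N (2 * k))))))"

datatype casimir_label = Y_label nat | Z_label nat nat | X_label nat

definition casimir_labels :: "nat \<Rightarrow> nat \<Rightarrow> casimir_label set"
  where "casimir_labels N j =
    Y_label ` {1..N div 2} \<union>
    {Z_label k p | k p. k \<in> {1..j} \<and> p \<in> {1..N}} \<union>
    X_label ` (if even j then {0..<(N + 1) div 2} else {1..N div 2})"

fun chain_casimir :: "nat \<Rightarrow> nat \<Rightarrow> casimir_label \<Rightarrow> ratfun"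
  where
    "chain_casimir N j (Y_label p) = Y_fun N p"
  | "chain_casimir N j (Z_label k p) = Z_fun N k p"
  | "chain_casimir N j (X_label p) = (if even j then X_even N j p else X_odd N (j div 2) p)"

definition eval_cpoly :: "('i \<Rightarrow> ratfun) \<Rightarrow> 'i cpoly \<Rightarrow> ratfun"
  where "eval_cpoly f P = (\<Sum>m\<in>Poly_Mapping.keys P.
    rconst (Poly_Mapping.lookup P m) *
    (\<Prod>i\<in>Poly_Mapping.keys m. f i ^ Poly_Mapping.lookup m i))"

text \<open>Algebraic independence over \<open>\<complex>\<close> of the family \<open>(f i | i \<in> I)\<close>.\<close>

definition algebraically_independent :: "'i set \<Rightarrow> ('i \<Rightarrow> ratfun) \<Rightarrow> bool"
  where "algebraically_independent I f \<longleftrightarrow>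
    (\<forall>P :: 'i cpoly. indets P \<subseteq> I \<and> eval_cpoly f P = 0 \<longrightarrow> P = 0)"

end

theory Submission
  imports Defs "Jordan_Normal_Form.Char_Poly"
begin

text \<open>
  Fix a coordinate \<open>y\<close> of the chain and consider the derivation \<open>D = {\<cdot>, y}\<close>. It acts on every
  matrix of the chain by \<open>D X = P X + X Q\<close>. Here \<open>P\<close> and \<open>Q\<close> can be chosen triangular for \<open>C\<^sub>k\<close>, or
  else the same for \<open>B\<^sub>k\<close> and \<open>C\<^sub>k\<close>, and with \<open>Q = P\<^sup>T\<close> for \<open>A\<close>. Hence the coefficients of the
  two pencils are eigenvectors of \<open>D\<close> with the same eigenvalue as \<open>det A\<close> and \<open>det B\<^sub>k\<close>. The pairs of
  neighbouring factors of \<open>S\<close> are such that all inner contributions to \<open>D S\<close> cancel, and what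
  remains is a triangular action on the left and on the right. So all minors in \<open>X\<^sub>p\<close> are
  eigenvectors, and their eigenvalues add up to 0.

  The torus \<open>A \<mapsto> T A T\<close>, \<open>B\<^sub>1 \<mapsto> B\<^sub>1 T\<close>, \<open>C\<^sub>1 \<mapsto> C\<^sub>1 T\<close> fixes all \<open>Y\<^sub>p\<close> and \<open>Z\<^sub>p\<close> and rescales the \<open>X\<^sub>p\<close>
  independently, which reduces the independence to that of the \<open>Y\<^sub>p\<close> and \<open>Z\<^sub>p\<close>. These take all
  complex values on \<open>B\<^sub>k = 1\<close>, companion matrices \<open>C\<^sub>k\<close> and antidiagonal \<open>A\<close>: for the latter
  \<open>det (x A + A\<^sup>T) / det A\<close> is, up to a factor \<open>x + 1\<close> for odd \<open>N\<close>, the product of the polynomials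
  \<open>x\<^sup>2 + (m\<^sub>i + 1 / m\<^sub>i) x + 1\<close>, where \<open>m\<^sub>i\<close> are quotients of entries of \<open>A\<close>.
\<close>

section \<open>Derivations and homomorphisms of subrings\<close>

text \<open>One bracket has to serve three kinds of functions with different demands: minors need
  triangular actions, the pencil of \<open>B_k\<close> and \<open>C_k\<close> needs one action
  common to both matrices, and \<open>S\<close> needs actions that match between neighbours. The
  coefficients of the \<open>r\<close>-matrix satisfy
  \<open>half_step i k + half_step k i = 2\<close>, so on the matrix that contains the coordinate a
  surplus term can be traded between the left and the right action. Between \<open>B_t\<close> and
  \<open>C_t\<close> this trade is impossible, because the two surplus terms differ; hence each
  function gets the form of the action that suits it. The bracket is a derivation only on the chain
  functions, and a specialisation is a homomorphism only where denominators survive. Therefore both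
  notions are developed relative to a subring. A single substitution operation yields the special
  points as well as the torus. Only one entry of the torus is varied at a time. It is chosen such
  that it rescales the new \<open>X_p\<close> and fixes the functions treated before, so that a
  relation splits into its coefficients with respect to \<open>X_p\<close>. This dictates descending
  \<open>p\<close> for even \<open>j\<close> and ascending \<open>p\<close> for odd
  \<open>j\<close>.\<close>

lemma permutes_less: "p permutes {0..<n::nat} \<Longrightarrow> i < n \<Longrightarrow> p i < n"
  using permutes_in_image[of p "{0..<n}" i] by auto

text \<open>A bare subset instead of a type, since the rings in question,
  \<open>chain_functions N j\<close>, \<open>regular_at \<sigma>\<close> and the polynomials over
  them, depend on parameters.\<close>

locale subring_of =
  fixes R :: "'a::comm_ring_1 set"
  assumes zero_closed [simp, intro]: "0 \<in> R"
    and one_closed [simp, intro]: "1 \<in> R"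
    and add_closed [simp, intro]: "x \<in> R \<Longrightarrow> y \<in> R \<Longrightarrow> x + y \<in> R"
    and uminus_closed [simp, intro]: "x \<in> R \<Longrightarrow> - x \<in> R"
    and mult_closed [simp, intro]: "x \<in> R \<Longrightarrow> y \<in> R \<Longrightarrow> x * y \<in> R"
begin

lemma diff_closed [simp, intro]: "x \<in> R \<Longrightarrow> y \<in> R \<Longrightarrow> x - y \<in> R"
  using add_closed[of x "- y"] by simp

lemma sum_closed [intro]: "(\<And>i. i \<in> I \<Longrightarrow> f i \<in> R) \<Longrightarrow> sum f I \<in> R"
  by (induction I rule: infinite_finite_induct) auto

lemma prod_closed [intro]: "(\<And>i. i \<in> I \<Longrightarrow> f i \<in> R) \<Longrightarrow> prod f I \<in> R"
  by (induction I rule: infinite_finite_induct) auto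

lemma signof_closed [simp]: "signof p \<in> R"
  by (simp add: sign_def)

lemma det_closed:
  assumes A: "A \<in> carrier_mat n n" and AR: "\<And>i j. i < n \<Longrightarrow> j < n \<Longrightarrow> A $$ (i, j) \<in> R"
  shows "det A \<in> R"
  unfolding det_def'[OF A]
  by (intro sum_closed mult_closed prod_closed signof_closed AR) (auto simp: permutes_less)

text \<open>Pencils are matrices of polynomials, so the determinant lemmas are applied a second time
  to this subring.\<close>

lemma coeffs_subring: "subring_of {p. \<forall>n. coeff p n \<in> R}"
proof
  fix x y assume "x \<in> {p. \<forall>n. coeff p n \<in> R}" "y \<in> {p. \<forall>n. coeff p n \<in> R}"
  then show "x * y \<in> {p. \<forall>n. coeff p n \<in> R}"
    unfolding coeff_mult mem_Collect_eq by (intro allI sum_closed mult_closed) auto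
qed (auto simp: coeff_1)

end

lemma index_mult_mat_sum:
  assumes "A \<in> carrier_mat n m" "B \<in> carrier_mat m k" "i < n" "j < k"
  shows "(A * B) $$ (i, j) = (\<Sum>c<m. A $$ (i, c) * B $$ (c, j))"
  using assms by (simp add: scalar_prod_def atLeast0LessThan)

section \<open>Homomorphisms defined on a subring\<close>

locale subring_hom = subring_of R for R :: "'a::comm_ring_1 set" +
  fixes h :: "'a \<Rightarrow> 'b::comm_ring_1"
  assumes hom_one [simp]: "h 1 = 1"
    and hom_add: "x \<in> R \<Longrightarrow> y \<in> R \<Longrightarrow> h (x + y) = h x + h y"
    and hom_mult: "x \<in> R \<Longrightarrow> y \<in> R \<Longrightarrow> h (x * y) = h x * h y"
begin

lemma hom_zero [simp]: "h 0 = 0"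
  using hom_add[of 0 0] by simp

lemma hom_uminus: "x \<in> R \<Longrightarrow> h (- x) = - h x"
  using hom_add[of x "- x"] by (simp add: eq_neg_iff_add_eq_0 add.commute)

lemma hom_sum: "(\<And>i. i \<in> I \<Longrightarrow> f i \<in> R) \<Longrightarrow> h (sum f I) = (\<Sum>i\<in>I. h (f i))"
  by (induction I rule: infinite_finite_induct) (auto simp: hom_add sum_closed)

lemma hom_prod: "(\<And>i. i \<in> I \<Longrightarrow> f i \<in> R) \<Longrightarrow> h (prod f I) = (\<Prod>i\<in>I. h (f i))"
  by (induction I rule: infinite_finite_induct) (auto simp: hom_mult prod_closed)

lemma hom_signof: "h (signof p) = signof p"
  by (simp add: sign_def hom_uminus)

lemma hom_det:
  assumes A: "A \<in> carrier_mat n n" and AR: "\<And>i j. i < n \<Longrightarrow> j < n \<Longrightarrow> A $$ (i, j) \<in> R"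
  shows "h (det A) = det (map_mat h A)"
proof -
  have A': "map_mat h A \<in> carrier_mat n n" using A by simp
  have "h (det A) = (\<Sum>p\<in>{p. p permutes {0..<n}}. h (signof p * (\<Prod>i = 0..<n. A $$ (i, p i))))"
    unfolding det_def'[OF A]
    by (intro hom_sum mult_closed prod_closed signof_closed AR) (auto simp: permutes_less)
  also have "\<dots> = det (map_mat h A)"
    unfolding det_def'[OF A']
  proof (rule sum.cong, simp)
    fix p assume "p \<in> {p. p permutes {0..<n}}"
    then have p: "p permutes {0..<n}" by simp
    have "h (\<Prod>i = 0..<n. A $$ (i, p i)) = (\<Prod>i = 0..<n. h (A $$ (i, p i)))"
      by (intro hom_prod AR) (use permutes_less[OF p] in auto)
    also have "\<dots> = (\<Prod>i = 0..<n. map_mat h A $$ (i, p i))"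
      by (intro prod.cong) (use permutes_less[OF p] A in auto)
    finally show "h (signof p * (\<Prod>i = 0..<n. A $$ (i, p i))) =
        signof p * (\<Prod>i = 0..<n. map_mat h A $$ (i, p i))"
      by (subst hom_mult) (use permutes_less[OF p] in \<open>auto intro!: prod_closed AR simp: hom_signof\<close>)
  qed
  finally show ?thesis .
qed

lemma hom_mat_mult:
  assumes A: "A \<in> carrier_mat n m" and B: "B \<in> carrier_mat m k"
    and AR: "\<And>i j. i < n \<Longrightarrow> j < m \<Longrightarrow> A $$ (i, j) \<in> R"
    and BR: "\<And>i j. i < m \<Longrightarrow> j < k \<Longrightarrow> B $$ (i, j) \<in> R"
  shows "map_mat h (A * B) = map_mat h A * map_mat h B"
proof (rule eq_matI)
  fix i j assume "i < dim_row (map_mat h A * map_mat h B)" "j < dim_col (map_mat h A * map_mat h B)"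
  then have ij: "i < n" "j < k" using A B by auto
  have "h ((A * B) $$ (i, j)) = (\<Sum>c<m. h (A $$ (i, c)) * h (B $$ (c, j)))"
    unfolding index_mult_mat_sum[OF A B ij]
    by (subst hom_sum) (auto simp: hom_mult AR BR ij)
  moreover have "(map_mat h A * map_mat h B) $$ (i, j) = (\<Sum>c<m. h (A $$ (i, c)) * h (B $$ (c, j)))"
    by (subst index_mult_mat_sum[of _ n m _ k]) (use A B ij in auto)
  ultimately show "map_mat h (A * B) $$ (i, j) = (map_mat h A * map_mat h B) $$ (i, j)"
    using A B ij by simp
qed (use A B in auto)

lemma coeffs_subring_hom: "subring_hom {p. \<forall>n. coeff p n \<in> R} (map_poly h)"
proof -
  interpret P: subring_of "{p. \<forall>n. coeff p n \<in> R}" by (rule coeffs_subring)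
  show ?thesis
  proof
    show "map_poly h 1 = 1"
      by (intro poly_eqI) (simp add: coeff_map_poly coeff_1)
  next
    fix x y assume "x \<in> {p. \<forall>n. coeff p n \<in> R}" "y \<in> {p. \<forall>n. coeff p n \<in> R}"
    then have xy: "\<And>n. coeff x n \<in> R" "\<And>n. coeff y n \<in> R" by auto
    show "map_poly h (x + y) = map_poly h x + map_poly h y"
      by (intro poly_eqI) (simp add: coeff_map_poly hom_add xy)
    show "map_poly h (x * y) = map_poly h x * map_poly h y"
      by (intro poly_eqI) (simp add: coeff_map_poly coeff_mult hom_sum hom_mult xy)
  qed
qed

end

section \<open>Derivations defined on a subring, and Jacobi's formula\<close>

locale subring_der = subring_of R for R :: "'a::comm_ring_1 set" +
  fixes D :: "'a \<Rightarrow> 'a"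
  assumes der_add: "x \<in> R \<Longrightarrow> y \<in> R \<Longrightarrow> D (x + y) = D x + D y"
    and der_mult: "x \<in> R \<Longrightarrow> y \<in> R \<Longrightarrow> D (x * y) = x * D y + D x * y"
begin

lemma der_zero [simp]: "D 0 = 0"
  using der_add[of 0 0] by simp

lemma der_one [simp]: "D 1 = 0"
  using der_mult[of 1 1] by simp

lemma der_uminus: "x \<in> R \<Longrightarrow> D (- x) = - D x"
  using der_add[of x "- x"] by (simp add: eq_neg_iff_add_eq_0 add.commute)

lemma der_sum: "(\<And>i. i \<in> I \<Longrightarrow> f i \<in> R) \<Longrightarrow> D (sum f I) = (\<Sum>i\<in>I. D (f i))"
  by (induction I rule: infinite_finite_induct) (auto simp: der_add sum_closed)

lemma der_prod:
  "finite I \<Longrightarrow> (\<And>i. i \<in> I \<Longrightarrow> f i \<in> R) \<Longrightarrow> D (prod f I) = (\<Sum>i\<in>I. D (f i) * prod f (I - {i}))"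
proof (induction I rule: finite_induct)
  case (insert a I)
  have "(\<Sum>i\<in>I. D (f i) * prod f (insert a I - {i})) = (\<Sum>i\<in>I. f a * (D (f i) * prod f (I - {i})))"
  proof (rule sum.cong)
    fix i assume "i \<in> I"
    then have "insert a I - {i} = insert a (I - {i})" using insert.hyps by auto
    then show "D (f i) * prod f (insert a I - {i}) = f a * (D (f i) * prod f (I - {i}))"
      using insert.hyps by simp
  qed simp
  moreover have "insert a I - {a} = I" using insert.hyps by auto
  ultimately show ?case
    using insert by (simp add: der_mult prod_closed sum_distrib_left)
qed simp

lemma der_signof_mult: "x \<in> R \<Longrightarrow> D (signof p * x) = signof p * D x"
  by (simp add: sign_def der_uminus)

text \<open>The product rule on each Leibniz summand gives a sum over \<open>i\<close> of
  determinants in which only row \<open>i\<close> is differentiated. Laplace expansion along that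
  row produces the cofactors.\<close>

lemma der_det:
  assumes A: "A \<in> carrier_mat n n" and AR: "\<And>i j. i < n \<Longrightarrow> j < n \<Longrightarrow> A $$ (i, j) \<in> R"
  shows "D (det A) = (\<Sum>i<n. \<Sum>j<n. D (A $$ (i, j)) * cofactor A i j)"
proof -
  define row_der where "row_der i = mat n n (\<lambda>(a, b). if a = i then D (A $$ (a, b)) else A $$ (a, b))" for i
  have rc: "row_der i \<in> carrier_mat n n" for i by (simp add: row_der_def)
  have "D (det A) = (\<Sum>p\<in>{p. p permutes {0..<n}}. D (signof p * (\<Prod>i = 0..<n. A $$ (i, p i))))"
    unfolding det_def'[OF A]
    by (intro der_sum mult_closed prod_closed signof_closed AR) (auto simp: permutes_less)
  also have "\<dots> = (\<Sum>p\<in>{p. p permutes {0..<n}}. \<Sum>i<n. signof p * (\<Prod>k = 0..<n. row_der i $$ (k, p k)))"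
  proof (rule sum.cong, simp)
    fix p assume "p \<in> {p. p permutes {0..<n}}"
    then have p: "p permutes {0..<n}" by simp
    have AR': "k < n \<Longrightarrow> A $$ (k, p k) \<in> R" for k
      using permutes_less[OF p] AR by auto
    have "D (\<Prod>i = 0..<n. A $$ (i, p i)) =
        (\<Sum>i=0..<n. D (A $$ (i, p i)) * (\<Prod>k\<in>{0..<n} - {i}. A $$ (k, p k)))"
      by (rule der_prod) (auto simp: AR')
    also have "\<dots> = (\<Sum>i<n. \<Prod>k = 0..<n. row_der i $$ (k, p k))"
      unfolding atLeast0LessThan
    proof (rule sum.cong)
      fix i assume "i \<in> {..<n}"
      then have i: "i < n" by simp
      have "(\<Prod>k<n. row_der i $$ (k, p k)) =
          row_der i $$ (i, p i) * (\<Prod>k\<in>{..<n} - {i}. row_der i $$ (k, p k))"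
        using i by (intro prod.remove) auto
      also have "(\<Prod>k\<in>{..<n} - {i}. row_der i $$ (k, p k)) = (\<Prod>k\<in>{..<n} - {i}. A $$ (k, p k))"
        by (intro prod.cong) (use permutes_less[OF p] in \<open>auto simp: row_der_def\<close>)
      finally show "D (A $$ (i, p i)) * (\<Prod>k\<in>{..<n} - {i}. A $$ (k, p k)) = (\<Prod>k<n. row_der i $$ (k, p k))"
        using i permutes_less[OF p] by (simp add: row_der_def)
    qed simp
    finally show "D (signof p * (\<Prod>i = 0..<n. A $$ (i, p i))) =
        (\<Sum>i<n. signof p * (\<Prod>k = 0..<n. row_der i $$ (k, p k)))"
      by (subst der_signof_mult) (auto intro!: prod_closed AR' simp: sum_distrib_left)
  qed
  also have "\<dots> = (\<Sum>i<n. det (row_der i))"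
    unfolding det_def'[OF rc] by (rule sum.swap)
  also have "\<dots> = (\<Sum>i<n. \<Sum>j<n. D (A $$ (i, j)) * cofactor A i j)"
  proof (rule sum.cong, simp)
    fix i assume "i \<in> {..<n}"
    then have i: "i < n" by simp
    have del: "mat_delete (row_der i) i j = mat_delete A i j" if "j < n" for j
      using A i that by (intro eq_matI) (auto simp: mat_delete_def row_der_def)
    have rd: "row_der i $$ (i, j) = D (A $$ (i, j))" if "j < n" for j
      using i that by (simp add: row_der_def)
    show "det (row_der i) = (\<Sum>j<n. D (A $$ (i, j)) * cofactor A i j)"
      unfolding laplace_expansion_row[OF rc i]
      by (intro sum.cong) (auto simp: rd cofactor_def del)
  qed
  finally show ?thesis .
qed

text \<open>\<open>der_det\<close> is a trace against the adjugate, and the product of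
  \<open>A\<close> and its adjugate, in either order, is \<open>det A\<close> times the identity.
  This leaves the traces of \<open>P\<close> and \<open>Q\<close>. Nothing is divided by, so the
  lemma also holds in the polynomial rings of the pencils.\<close>

lemma der_det_two_sided:
  assumes A: "A \<in> carrier_mat n n" and AR: "\<And>i j. i < n \<Longrightarrow> j < n \<Longrightarrow> A $$ (i, j) \<in> R"
    and P: "P \<in> carrier_mat n n" and Q: "Q \<in> carrier_mat n n"
    and D: "map_mat D A = P * A + A * Q"
  shows "D (det A) = ((\<Sum>i<n. P $$ (i, i)) + (\<Sum>i<n. Q $$ (i, i))) * det A"
proof -
  note adj = adj_mat[OF A]
  have DA: "D (A $$ (i, j)) = (P * A) $$ (i, j) + (A * Q) $$ (i, j)" if "i < n" "j < n" for i j
    using arg_cong[OF D, of "\<lambda>M. M $$ (i, j)"] A P Q that by simp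
  have adjE: "adj_mat A $$ (j, i) = cofactor A i j" if "i < n" "j < n" for i j
    using A that by (simp add: adj_mat_def)
  have "(\<Sum>i<n. \<Sum>j<n. (P * A) $$ (i, j) * cofactor A i j) = (\<Sum>i<n. (P * A * adj_mat A) $$ (i, i))"
    by (intro sum.cong refl, subst index_mult_mat_sum[of _ n n _ n])
       (use A P adj in \<open>auto intro!: sum.cong simp: adjE\<close>)
  also have "P * A * adj_mat A = P * (det A \<cdot>\<^sub>m 1\<^sub>m n)"
    using A P adj by (simp add: assoc_mult_mat[of P n n A n "adj_mat A" n])
  also have "\<dots> = det A \<cdot>\<^sub>m P"
    using P by (simp add: mult_smult_distrib[of P n n "1\<^sub>m n" n])
  also have "(\<Sum>i<n. (det A \<cdot>\<^sub>m P) $$ (i, i)) = (\<Sum>i<n. P $$ (i, i)) * det A"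
    using P by (simp add: sum_distrib_left mult.commute)
  finally have 1: "(\<Sum>i<n. \<Sum>j<n. (P * A) $$ (i, j) * cofactor A i j) = (\<Sum>i<n. P $$ (i, i)) * det A" .
  have "(\<Sum>i<n. \<Sum>j<n. (A * Q) $$ (i, j) * cofactor A i j) =
      (\<Sum>j<n. \<Sum>i<n. adj_mat A $$ (j, i) * (A * Q) $$ (i, j))"
    by (subst sum.swap) (auto intro!: sum.cong simp: adjE mult.commute)
  also have "\<dots> = (\<Sum>j<n. (adj_mat A * (A * Q)) $$ (j, j))"
    by (intro sum.cong refl, subst index_mult_mat_sum[of _ n n _ n]) (use A Q adj in auto)
  also have "adj_mat A * (A * Q) = (det A \<cdot>\<^sub>m 1\<^sub>m n) * Q"
    using A Q adj by (simp add: assoc_mult_mat[of "adj_mat A" n n A n Q n, symmetric])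
  also have "\<dots> = det A \<cdot>\<^sub>m Q"
    using Q by (simp add: mult_smult_assoc_mat[of "1\<^sub>m n" n n Q n])
  also have "(\<Sum>i<n. (det A \<cdot>\<^sub>m Q) $$ (i, i)) = (\<Sum>i<n. Q $$ (i, i)) * det A"
    using Q by (simp add: sum_distrib_left mult.commute)
  finally have 2: "(\<Sum>i<n. \<Sum>j<n. (A * Q) $$ (i, j) * cofactor A i j) = (\<Sum>i<n. Q $$ (i, i)) * det A" .
  show ?thesis
    unfolding distrib_right 1[symmetric] 2[symmetric]
    by (subst der_det[OF A AR]) (auto simp: DA distrib_right sum.distrib)
qed

lemma der_mat_mult:
  assumes A: "A \<in> carrier_mat n m" and B: "B \<in> carrier_mat m k"
    and AR: "\<And>i j. i < n \<Longrightarrow> j < m \<Longrightarrow> A $$ (i, j) \<in> R"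
    and BR: "\<And>i j. i < m \<Longrightarrow> j < k \<Longrightarrow> B $$ (i, j) \<in> R"
  shows "map_mat D (A * B) = map_mat D A * B + A * map_mat D B"
proof (rule eq_matI)
  fix i j assume "i < dim_row (map_mat D A * B + A * map_mat D B)"
    "j < dim_col (map_mat D A * B + A * map_mat D B)"
  then have ij: "i < n" "j < k" using A B by auto
  have "D ((A * B) $$ (i, j)) = (\<Sum>c<m. D (A $$ (i, c)) * B $$ (c, j)) + (\<Sum>c<m. A $$ (i, c) * D (B $$ (c, j)))"
    unfolding index_mult_mat_sum[OF A B ij]
    by (subst der_sum) (auto simp: der_mult AR BR ij sum.distrib)
  moreover have "(map_mat D A * B) $$ (i, j) = (\<Sum>c<m. D (A $$ (i, c)) * B $$ (c, j))"
    by (subst index_mult_mat_sum[of _ n m _ k]) (use A B ij in auto)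
  moreover have "(A * map_mat D B) $$ (i, j) = (\<Sum>c<m. A $$ (i, c) * D (B $$ (c, j)))"
    by (subst index_mult_mat_sum[of _ n m _ k]) (use A B ij in auto)
  ultimately show "map_mat D (A * B) $$ (i, j) = (map_mat D A * B + A * map_mat D B) $$ (i, j)"
    using A B ij by simp
qed (use A B in auto)

text \<open>Acting on coefficients means that the pencil variable is a constant of the
  derivation.\<close>

lemma coeffs_subring_der: "subring_der {p. \<forall>n. coeff p n \<in> R} (map_poly D)"
proof -
  interpret P: subring_of "{p. \<forall>n. coeff p n \<in> R}" by (rule coeffs_subring)
  show ?thesis
  proof
    fix x y assume "x \<in> {p. \<forall>n. coeff p n \<in> R}" "y \<in> {p. \<forall>n. coeff p n \<in> R}"
    then have xy: "\<And>n. coeff x n \<in> R" "\<And>n. coeff y n \<in> R" by auto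
    show "map_poly D (x + y) = map_poly D x + map_poly D y"
      by (intro poly_eqI) (simp add: coeff_map_poly der_add xy)
    show "map_poly D (x * y) = x * map_poly D y + map_poly D x * y"
      by (intro poly_eqI) (simp add: coeff_map_poly coeff_mult der_sum der_mult xy sum.distrib)
  qed
qed

end

section \<open>Eigenvectors of a derivation on a subfield\<close>

locale subfield_der = subring_der R D for R :: "'a::field set" and D +
  assumes inverse_closed: "x \<in> R \<Longrightarrow> inverse x \<in> R"
begin

text \<open>The eigenvalue \<open>w\<close> may be any element of the field; for nonzero
  \<open>f\<close> it is the logarithmic derivative. Products add eigenvalues, quotients subtract
  them, and eigenvalue 0 means that \<open>f\<close> commutes with the chosen coordinate.\<close>

definition eigen :: "'a \<Rightarrow> 'a \<Rightarrow> bool"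
  where "eigen w f \<longleftrightarrow> f \<in> R \<and> D f = w * f"

lemma eigen_one: "eigen 0 1"
  by (simp add: eigen_def)

lemma eigen_mult: "eigen v f \<Longrightarrow> eigen w g \<Longrightarrow> eigen (v + w) (f * g)"
  by (simp add: eigen_def der_mult algebra_simps)

lemma eigen_inverse:
  assumes "eigen w f"
  shows "eigen (- w) (inverse f)"
\<comment> \<open>For \<open>f = 0\<close> the convention \<open>inverse 0 = 0\<close> makes the
  claim trivial.\<close>
proof (cases "f = 0")
  case False
  have "D (f * inverse f) = f * D (inverse f) + w * f * inverse f"
    using assms by (simp add: eigen_def der_mult inverse_closed)
  then have "f * (D (inverse f) + w * inverse f) = 0"
    using False by (simp add: algebra_simps)
  then show ?thesis
    using assms False by (auto simp: eigen_def inverse_closed add_eq_0_iff2)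
qed (simp add: eigen_def)

lemma eigen_divide: "eigen v f \<Longrightarrow> eigen w g \<Longrightarrow> eigen (v - w) (f / g)"
  using eigen_mult[of v f "- w" "inverse g"] eigen_inverse[of w g] by (simp add: divide_inverse)

lemma eigen_prod: "(\<And>i. i \<in> I \<Longrightarrow> eigen (w i) (f i)) \<Longrightarrow> eigen (\<Sum>i\<in>I. w i) (\<Prod>i\<in>I. f i)"
  by (induction I rule: infinite_finite_induct) (auto simp: eigen_one intro!: eigen_mult)

lemma eigen_det:
  assumes A: "A \<in> carrier_mat n n" and AR: "\<And>i j. i < n \<Longrightarrow> j < n \<Longrightarrow> A $$ (i, j) \<in> R"
    and P: "P \<in> carrier_mat n n" and Q: "Q \<in> carrier_mat n n"
    and D: "map_mat D A = P * A + A * Q"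
  shows "eigen ((\<Sum>i<n. P $$ (i, i)) + (\<Sum>i<n. Q $$ (i, i))) (det A)"
  unfolding eigen_def using det_closed[OF A AR] der_det_two_sided[OF A AR P Q D] by blast

end

section \<open>Determinants of linear pencils\<close>

text \<open>Stated for two arbitrary matrices over any commutative ring, so that the same facts
  serve \<open>B + z C\<close>, the pencil of \<open>A\<close> and its transpose, and all their
  specialisations.\<close>

definition pencil_det :: "'a::comm_ring_1 mat \<Rightarrow> 'a mat \<Rightarrow> 'a poly"
  where "pencil_det U V =
    det (map_mat (\<lambda>x. [:x:]) U + [:0, 1:] \<cdot>\<^sub>m map_mat (\<lambda>x. [:x:]) V)"

text \<open>The homomorphism \<open>f\<close> permits evaluation outside the coefficient ring; with
  \<open>f = fls_const\<close> the pencil of \<open>A\<close> is evaluated at a Laurent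
  series.\<close>

lemma poly_map_poly_pencil_det:
  assumes "comm_ring_hom (f :: 'a::comm_ring_1 \<Rightarrow> 'b::comm_ring_1)"
    and "U \<in> carrier_mat n n" "V \<in> carrier_mat n n"
  shows "poly (map_poly f (pencil_det U V)) z = det (map_mat f U + z \<cdot>\<^sub>m map_mat f V)"
proof -
  interpret f: comm_ring_hom f by fact
  interpret F: map_poly_comm_ring_hom f ..
  have G: "comm_ring_hom (\<lambda>p. poly p z)" by unfold_locales auto
  have lin: "map_poly f [:a, b:] = [:f a, f b:]" for a b
    by (intro poly_eqI) (simp add: coeff_map_poly coeff_pCons split: nat.splits)
  have "map_mat (\<lambda>p. poly p z)
      (map_mat (map_poly f) (map_mat (\<lambda>x. [:x:]) U + [:0, 1:] \<cdot>\<^sub>m map_mat (\<lambda>x. [:x:]) V))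
    = map_mat f U + z \<cdot>\<^sub>m map_mat f V"
    using assms(2,3) by (intro eq_matI) (auto simp: lin)
  then show ?thesis
    unfolding pencil_det_def F.hom_det[symmetric] comm_ring_hom.hom_det[OF G, symmetric] by simp
qed

lemma poly_pencil_det:
  assumes "U \<in> carrier_mat n n" "V \<in> carrier_mat n n"
  shows "poly (pencil_det U V) z = det (U + z \<cdot>\<^sub>m V)"
proof -
  have "comm_ring_hom (\<lambda>x :: 'a. x)" by unfold_locales auto
  moreover have "map_mat (\<lambda>x. x) M = M" for M :: "'a mat" by (intro eq_matI) auto
  ultimately show ?thesis
    using poly_map_poly_pencil_det[of "\<lambda>x. x" U n V z] assms by simp
qed

lemma degree_pencil_det:
  assumes "U \<in> carrier_mat n n" "V \<in> carrier_mat n n"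
  shows "degree (pencil_det U V) \<le> n"
  unfolding pencil_det_def
  by (rule degree_det_le[where k = 1 and n = n, simplified]) (use assms in auto)

lemma coeff_0_pencil_det:
  assumes "U \<in> carrier_mat n n" "V \<in> carrier_mat n n"
  shows "coeff (pencil_det U V) 0 = det U"
proof -
  have "U + 0 \<cdot>\<^sub>m V = U" using assms by (intro eq_matI) auto
  then show ?thesis
    using poly_pencil_det[OF assms, of 0] by (simp add: poly_0_coeff_0)
qed

lemma pencil_det_transpose:
  assumes "U \<in> carrier_mat n n" "V \<in> carrier_mat n n"
  shows "pencil_det (transpose_mat U) (transpose_mat V) = pencil_det U V"
proof -
  have "map_mat (\<lambda>x. [:x:]) (transpose_mat U) + [:0, 1:] \<cdot>\<^sub>m map_mat (\<lambda>x. [:x:]) (transpose_mat V)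
    = transpose_mat (map_mat (\<lambda>x. [:x:]) U + [:0, 1:] \<cdot>\<^sub>m map_mat (\<lambda>x. [:x:]) V)"
    using assms by (intro eq_matI) auto
  then show ?thesis
    unfolding pencil_det_def by (simp add: det_transpose[of _ n] assms)
qed

lemma poly_eqI_nonzero:
  fixes p q :: "'a::idom poly"
  assumes "infinite (UNIV :: 'a set)" and "\<And>z. z \<noteq> 0 \<Longrightarrow> poly p z = poly q z"
  shows "p = q"
proof (rule ccontr)
  assume "p \<noteq> q"
  then have "finite {z. poly (p - q) z = 0}" by (intro poly_roots_finite) simp
  moreover have "UNIV - {0} \<subseteq> {z. poly (p - q) z = 0}" using assms(2) by auto
  ultimately show False using assms(1) by (meson finite.emptyI finite_Diff2 finite_insert finite_subset)
qed

text \<open>Since \<open>U + z V = z (V + U / z)\<close>, the two determinants are reversals of each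
  other with respect to degree \<open>n\<close>. Comparing values at all nonzero \<open>z\<close>
  suffices over an infinite field.\<close>

lemma coeff_pencil_det_swap:
  fixes U V :: "'a::field mat"
  assumes inf: "infinite (UNIV :: 'a set)"
    and UV: "U \<in> carrier_mat n n" "V \<in> carrier_mat n n" and k: "k \<le> n"
  shows "coeff (pencil_det U V) k = coeff (pencil_det V U) (n - k)"
proof -
  let ?q = "\<Sum>k\<le>n. monom (coeff (pencil_det V U) (n - k)) k"
  have "pencil_det U V = ?q"
  proof (rule poly_eqI_nonzero[OF inf])
    fix z :: 'a assume z: "z \<noteq> 0"
    have "U + z \<cdot>\<^sub>m V = z \<cdot>\<^sub>m (V + inverse z \<cdot>\<^sub>m U)"
      using UV z by (intro eq_matI) (auto simp: algebra_simps)
    then have "poly (pencil_det U V) z = z ^ n * poly (pencil_det V U) (inverse z)"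
      using UV by (simp add: poly_pencil_det[of _ n])
    also have "poly (pencil_det V U) (inverse z) = (\<Sum>i\<le>n. coeff (pencil_det V U) i * inverse z ^ i)"
      unfolding poly_altdef
      by (intro sum.mono_neutral_left) (use degree_pencil_det[OF UV(2,1)] in \<open>auto simp: coeff_eq_0\<close>)
    also have "z ^ n * \<dots> = (\<Sum>i\<le>n. coeff (pencil_det V U) i * z ^ (n - i))"
      unfolding sum_distrib_left
      by (intro sum.cong) (auto simp: power_diff z power_inverse field_simps)
    also have "\<dots> = (\<Sum>k\<le>n. coeff (pencil_det V U) (n - k) * z ^ k)"
      by (rule sum.reindex_bij_witness[of _ "\<lambda>i. n - i" "\<lambda>i. n - i"]) auto
    also have "\<dots> = poly ?q z"
      by (simp add: poly_sum poly_monom)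
    finally show "poly (pencil_det U V) z = poly ?q z" .
  qed
  then have "coeff (pencil_det U V) k = (\<Sum>i\<le>n. coeff (monom (coeff (pencil_det V U) (n - i)) i) k)"
    by (simp add: coeff_sum)
  also have "\<dots> = (\<Sum>i\<le>n. if i = k then coeff (pencil_det V U) (n - k) else 0)"
    by (intro sum.cong) auto
  finally show ?thesis using k by simp
qed

text \<open>Transposition exchanges the two matrices of the pencil without changing the determinant,
  so the pencil equals its own reversal. This is why one \<open>Y_p\<close> serves two powers of
  \<open>\<lambda>\<close>.\<close>

lemma coeff_pencil_det_palindromic:
  fixes U :: "'a::field mat"
  assumes "infinite (UNIV :: 'a set)" "U \<in> carrier_mat n n" "k \<le> n"
  shows "coeff (pencil_det (transpose_mat U) U) k = coeff (pencil_det (transpose_mat U) U) (n - k)"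
  using coeff_pencil_det_swap[OF assms(1) _ assms(2,3), of "transpose_mat U"]
    pencil_det_transpose[of "transpose_mat U" n U] assms by simp

context subring_of
begin

lemma pencil_mat_closed:
  assumes "U \<in> carrier_mat n n" "V \<in> carrier_mat n n"
    and "\<And>i j. i < n \<Longrightarrow> j < n \<Longrightarrow> U $$ (i, j) \<in> R"
    and "\<And>i j. i < n \<Longrightarrow> j < n \<Longrightarrow> V $$ (i, j) \<in> R"
    and "i < n" "j < n"
  shows "(map_mat (\<lambda>x. [:x:]) U + [:0, 1:] \<cdot>\<^sub>m map_mat (\<lambda>x. [:x:]) V) $$ (i, j)
    \<in> {p. \<forall>n. coeff p n \<in> R}"
  using assms by (auto simp: coeff_pCons split: nat.splits)

lemma coeff_pencil_det_closed:
  assumes "U \<in> carrier_mat n n" "V \<in> carrier_mat n n"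
    and "\<And>i j. i < n \<Longrightarrow> j < n \<Longrightarrow> U $$ (i, j) \<in> R"
    and "\<And>i j. i < n \<Longrightarrow> j < n \<Longrightarrow> V $$ (i, j) \<in> R"
  shows "coeff (pencil_det U V) k \<in> R"
proof -
  interpret P: subring_of "{p. \<forall>n. coeff p n \<in> R}" by (rule coeffs_subring)
  have "pencil_det U V \<in> {p. \<forall>n. coeff p n \<in> R}"
    unfolding pencil_det_def
    by (rule P.det_closed[of _ n]) (use assms pencil_mat_closed[OF assms] in auto)
  then show ?thesis by simp
qed

end

context subring_hom
begin

lemma hom_coeff_pencil_det:
  assumes "U \<in> carrier_mat n n" "V \<in> carrier_mat n n"
    and UR: "\<And>i j. i < n \<Longrightarrow> j < n \<Longrightarrow> U $$ (i, j) \<in> R"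
    and VR: "\<And>i j. i < n \<Longrightarrow> j < n \<Longrightarrow> V $$ (i, j) \<in> R"
  shows "h (coeff (pencil_det U V) k) = coeff (pencil_det (map_mat h U) (map_mat h V)) k"
proof -
  interpret P: subring_hom "{p. \<forall>n. coeff p n \<in> R}" "map_poly h" by (rule coeffs_subring_hom)
  let ?M = "\<lambda>U V. map_mat (\<lambda>x. [:x:]) U + [:0, 1:] \<cdot>\<^sub>m map_mat (\<lambda>x. [:x:]) V"
  have "map_mat (map_poly h) (?M U V) = ?M (map_mat h U) (map_mat h V)"
    using assms(1,2)
    by (intro eq_matI) (auto intro!: poly_eqI simp: coeff_map_poly coeff_pCons hom_add UR VR split: nat.splits)
  moreover have "map_poly h (det (?M U V)) = det (map_mat (map_poly h) (?M U V))"
    by (rule P.hom_det[of _ n]) (use assms pencil_mat_closed[OF assms] in auto)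
  ultimately have "map_poly h (pencil_det U V) = pencil_det (map_mat h U) (map_mat h V)"
    unfolding pencil_det_def by simp
  then show ?thesis by (metis coeff_map_poly hom_zero)
qed

end

context subring_der
begin

text \<open>As \<open>P\<close> and \<open>Q\<close> are common to \<open>U\<close> and
  \<open>V\<close> and constant in the pencil variable, the pencil itself satisfies
  \<open>D M = P M + M Q\<close>. Hence all coefficients share one eigenvalue.\<close>

lemma der_coeff_pencil_det:
  assumes "U \<in> carrier_mat n n" "V \<in> carrier_mat n n"
    and UR: "\<And>i j. i < n \<Longrightarrow> j < n \<Longrightarrow> U $$ (i, j) \<in> R"
    and VR: "\<And>i j. i < n \<Longrightarrow> j < n \<Longrightarrow> V $$ (i, j) \<in> R"
    and P: "P \<in> carrier_mat n n" and Q: "Q \<in> carrier_mat n n"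
    and DU: "map_mat D U = P * U + U * Q" and DV: "map_mat D V = P * V + V * Q"
  shows "D (coeff (pencil_det U V) k) =
    ((\<Sum>i<n. P $$ (i, i)) + (\<Sum>i<n. Q $$ (i, i))) * coeff (pencil_det U V) k"
proof -
  interpret d: subring_der "{p. \<forall>n. coeff p n \<in> R}" "map_poly D" by (rule coeffs_subring_der)
  let ?c = "map_mat (\<lambda>x. [:x:])"
  let ?M = "?c U + [:0, 1:] \<cdot>\<^sub>m ?c V"
  have c_entry: "(?c A * ?c B) $$ (i, j) = [:(A * B) $$ (i, j):]"
    if "A \<in> carrier_mat n n" "B \<in> carrier_mat n n" "i < n" "j < n" for A B i j
    using index_mult_mat_sum[of "?c A" n n "?c B" n i j] index_mult_mat_sum[of A n n B n i j] that
    by (auto intro!: poly_eqI simp: coeff_sum coeff_pCons mult.commute split: nat.splits)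
  have "map_mat (map_poly D) ?M = ?c P * ?M + ?M * ?c Q"
  proof (rule eq_matI)
    fix i j assume "i < dim_row (?c P * ?M + ?M * ?c Q)" "j < dim_col (?c P * ?M + ?M * ?c Q)"
    then have ij: "i < n" "j < n" using P Q assms(1,2) by auto
    have "?c P * ?M = ?c P * ?c U + [:0, 1:] \<cdot>\<^sub>m (?c P * ?c V)"
      using P assms(1,2) by (simp add: mult_add_distrib_mat[of _ n n _ n] mult_smult_distrib[of _ n n _ n])
    moreover have "?M * ?c Q = ?c U * ?c Q + [:0, 1:] \<cdot>\<^sub>m (?c V * ?c Q)"
      using Q assms(1,2) by (simp add: add_mult_distrib_mat[of _ n n _ _ n] mult_smult_assoc_mat[of _ n n _ n])
    ultimately have "(?c P * ?M + ?M * ?c Q) $$ (i, j) =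
      [:(P * U) $$ (i, j) + (U * Q) $$ (i, j), (P * V) $$ (i, j) + (V * Q) $$ (i, j):]"
      using ij P Q assms(1,2) c_entry[of P U i j] c_entry[of U Q i j] c_entry[of P V i j] c_entry[of V Q i j]
      by simp
    moreover have "D (U $$ (i, j)) = (P * U) $$ (i, j) + (U * Q) $$ (i, j)"
      using arg_cong[OF DU, of "\<lambda>M. M $$ (i, j)"] assms(1) P Q ij by simp
    moreover have "D (V $$ (i, j)) = (P * V) $$ (i, j) + (V * Q) $$ (i, j)"
      using arg_cong[OF DV, of "\<lambda>M. M $$ (i, j)"] assms(2) P Q ij by simp
    ultimately show "map_mat (map_poly D) ?M $$ (i, j) = (?c P * ?M + ?M * ?c Q) $$ (i, j)"
      using ij assms(1,2) by (auto intro!: poly_eqI simp: coeff_map_poly coeff_pCons split: nat.splits)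
  qed (use P Q assms(1,2) in auto)
  then have "map_poly D (det ?M) =
    ((\<Sum>i<n. ?c P $$ (i, i)) + (\<Sum>i<n. ?c Q $$ (i, i))) * det ?M"
    using assms(1,2) P Q pencil_mat_closed[OF assms(1,2) UR VR]
    by (intro d.der_det_two_sided[of _ n]) auto
  also have "(\<Sum>i<n. ?c P $$ (i, i)) + (\<Sum>i<n. ?c Q $$ (i, i)) =
      [:(\<Sum>i<n. P $$ (i, i)) + (\<Sum>i<n. Q $$ (i, i)):]"
    using P Q by (intro poly_eqI) (auto simp: coeff_sum coeff_pCons split: nat.splits)
  finally have "coeff (map_poly D (det ?M)) k =
      coeff ([:(\<Sum>i<n. P $$ (i, i)) + (\<Sum>i<n. Q $$ (i, i)):] * det ?M) k"
    by (rule arg_cong)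
  then show ?thesis
    unfolding pencil_det_def by (simp only: coeff_map_poly[of D, OF der_zero] mult_pCons_left
      mult_zero_left pCons_0_0 add_0_right coeff_smult)
qed

end

section \<open>Evaluation of polynomials and rational functions\<close>

lemma rconst_0 [simp]: "rconst 0 = 0"
  and rconst_1 [simp]: "rconst 1 = 1"
  and rconst_add: "rconst (a + b) = rconst a + rconst b"
  and rconst_mult: "rconst (a * b) = rconst a * rconst b"
  and rconst_uminus: "rconst (- a) = - rconst a"
  and rconst_eq_iff [simp]: "rconst a = rconst b \<longleftrightarrow> a = b"
proof -
  show "rconst a = rconst b \<longleftrightarrow> a = b"
    unfolding rconst_def to_fract_eq_iff by (metis lookup_single_eq)
qed (simp_all add: rconst_def single_add single_uminus mult_single
    flip: to_fract_add to_fract_mult to_fract_uminus)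

lemma rconst_eq_0_iff [simp]: "rconst a = 0 \<longleftrightarrow> a = 0"
  using rconst_eq_iff[of a 0] by simp

lemma rconst_eq_1_iff [simp]: "rconst a = 1 \<longleftrightarrow> a = 1"
  using rconst_eq_iff[of a 1] by simp

lemma rconst_hom: "comm_ring_hom rconst"
  by unfold_locales (auto simp: rconst_add rconst_mult)

lemma rconst_power: "rconst (a ^ n) = rconst a ^ n"
  by (induction n) (auto simp: rconst_mult)

lemma rconst_inverse: "rconst (inverse a) = inverse (rconst a)"
proof (cases "a = 0")
  case False
  then have "rconst a * rconst (inverse a) = 1" by (simp flip: rconst_mult)
  then show ?thesis by (metis inverse_unique)
qed simp

lemma infinite_rconst: "infinite C \<Longrightarrow> infinite (rconst ` C)"
  by (simp add: finite_image_iff inj_on_def)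

lemma infinite_ratfun: "infinite (UNIV :: ratfun set)"
  by (rule infinite_super[OF subset_UNIV infinite_rconst[OF infinite_UNIV_char_0]])

definition mon_eval :: "('i \<Rightarrow> ratfun) \<Rightarrow> ('i \<Rightarrow>\<^sub>0 nat) \<Rightarrow> ratfun"
  where "mon_eval f m = (\<Prod>i\<in>Poly_Mapping.keys m. f i ^ Poly_Mapping.lookup m i)"

lemma eval_cpoly_mon_eval:
  "eval_cpoly f P = (\<Sum>m\<in>Poly_Mapping.keys P. rconst (Poly_Mapping.lookup P m) * mon_eval f m)"
  by (simp add: eval_cpoly_def mon_eval_def)

lemma mon_eval_superset:
  assumes "finite S" "Poly_Mapping.keys m \<subseteq> S"
  shows "mon_eval f m = (\<Prod>i\<in>S. f i ^ Poly_Mapping.lookup m i)"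
  unfolding mon_eval_def
  by (rule prod.mono_neutral_left) (use assms in \<open>auto simp: in_keys_iff\<close>)

lemma mon_eval_add: "mon_eval f (m + n) = mon_eval f m * mon_eval f n"
proof -
  let ?S = "Poly_Mapping.keys m \<union> Poly_Mapping.keys n"
  have "mon_eval f (m + n) = (\<Prod>i\<in>?S. f i ^ Poly_Mapping.lookup (m + n) i)"
    by (rule mon_eval_superset) (auto dest: subsetD[OF keys_add])
  then show ?thesis
    by (simp add: mon_eval_superset[of ?S] lookup_add power_add prod.distrib)
qed

lemma mon_eval_0 [simp]: "mon_eval f 0 = 1"
  by (simp add: mon_eval_def)

lemma mon_eval_single [simp]: "mon_eval f (Poly_Mapping.single i k) = f i ^ k"
  by (cases "k = 0") (auto simp: mon_eval_def)

lemma mon_eval_mult: "mon_eval (\<lambda>i. f i * g i) m = mon_eval f m * mon_eval g m"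
  by (simp add: mon_eval_def power_mult_distrib prod.distrib)

lemma eval_cpoly_superset:
  assumes "finite S" "Poly_Mapping.keys P \<subseteq> S"
  shows "eval_cpoly f P = (\<Sum>m\<in>S. rconst (Poly_Mapping.lookup P m) * mon_eval f m)"
  unfolding eval_cpoly_mon_eval
  by (rule sum.mono_neutral_left) (use assms in \<open>auto simp: in_keys_iff\<close>)

lemma eval_cpoly_0 [simp]: "eval_cpoly f 0 = 0"
  by (simp add: eval_cpoly_def)

lemma eval_cpoly_single [simp]: "eval_cpoly f (Poly_Mapping.single m c) = rconst c * mon_eval f m"
  by (subst eval_cpoly_superset[of "{m}"]) auto

lemma eval_cpoly_1 [simp]: "eval_cpoly f 1 = 1"
  using eval_cpoly_single[of f 0 1] by simp

lemma eval_cpoly_add: "eval_cpoly f (P + Q) = eval_cpoly f P + eval_cpoly f Q"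
proof -
  let ?S = "Poly_Mapping.keys P \<union> Poly_Mapping.keys Q"
  have "eval_cpoly f (P + Q) = (\<Sum>m\<in>?S. rconst (Poly_Mapping.lookup (P + Q) m) * mon_eval f m)"
    by (rule eval_cpoly_superset) (auto dest: subsetD[OF keys_add])
  then show ?thesis
    by (simp add: eval_cpoly_superset[of ?S] lookup_add rconst_add sum.distrib distrib_right)
qed

lemma eval_cpoly_sum: "eval_cpoly f (sum P I) = (\<Sum>i\<in>I. eval_cpoly f (P i))"
  by (induction I rule: infinite_finite_induct) (auto simp: eval_cpoly_add)

lemma poly_mapping_sum_single: "P = (\<Sum>m\<in>Poly_Mapping.keys P. Poly_Mapping.single m (Poly_Mapping.lookup P m))"
proof (rule poly_mapping_eqI)
  fix k
  have "Poly_Mapping.lookup (\<Sum>m\<in>Poly_Mapping.keys P. Poly_Mapping.single m (Poly_Mapping.lookup P m)) k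
    = (\<Sum>m\<in>Poly_Mapping.keys P. if k = m then Poly_Mapping.lookup P k else 0)"
    unfolding lookup_sum by (intro sum.cong) (auto simp: lookup_single)
  also have "\<dots> = Poly_Mapping.lookup P k"
    by (auto simp: in_keys_iff)
  finally show "Poly_Mapping.lookup P k =
    Poly_Mapping.lookup (\<Sum>m\<in>Poly_Mapping.keys P. Poly_Mapping.single m (Poly_Mapping.lookup P m)) k" ..
qed

lemma eval_cpoly_mult: "eval_cpoly f (P * Q) = eval_cpoly f P * eval_cpoly f Q"
proof -
  have "P * Q = (\<Sum>m\<in>Poly_Mapping.keys P. Poly_Mapping.single m (Poly_Mapping.lookup P m)) *
      (\<Sum>n\<in>Poly_Mapping.keys Q. Poly_Mapping.single n (Poly_Mapping.lookup Q n))"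
    using poly_mapping_sum_single[of P] poly_mapping_sum_single[of Q] by simp
  also have "\<dots> = (\<Sum>m\<in>Poly_Mapping.keys P. \<Sum>n\<in>Poly_Mapping.keys Q.
      Poly_Mapping.single (m + n) (Poly_Mapping.lookup P m * Poly_Mapping.lookup Q n))"
    by (simp add: sum_product mult_single)
  finally have "eval_cpoly f (P * Q) = (\<Sum>m\<in>Poly_Mapping.keys P. \<Sum>n\<in>Poly_Mapping.keys Q.
      (rconst (Poly_Mapping.lookup P m) * mon_eval f m) *
      (rconst (Poly_Mapping.lookup Q n) * mon_eval f n))"
    by (simp add: eval_cpoly_sum rconst_mult mon_eval_add mult_ac)
  then show ?thesis
    by (simp add: eval_cpoly_mon_eval sum_product)
qed

lemma eval_cpoly_uminus: "eval_cpoly f (- P) = - eval_cpoly f P"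
  using eval_cpoly_add[of f P "- P"] by (simp add: eq_neg_iff_add_eq_0 add.commute)

lemma eval_cpoly_cong:
  assumes "\<And>i. i \<in> indets P \<Longrightarrow> f i = g i"
  shows "eval_cpoly f P = eval_cpoly g P"
  unfolding eval_cpoly_def
  by (intro sum.cong prod.cong arg_cong2[where f = "(*)"] arg_cong2[where f = "(^)"] refl assms)
    (auto simp: indets_def)

lemma eval_cpoly_coord: "eval_cpoly coord P = to_fract P"
proof -
  have mon: "mon_eval coord m = to_fract (Poly_Mapping.single m 1)" for m
  proof -
    have pow: "to_fract (Poly_Mapping.single (Poly_Mapping.single v 1) (1::complex)) ^ k =
        to_fract (Poly_Mapping.single (Poly_Mapping.single v k) 1)" for v :: entry and k
      by (induction k) (auto simp: mult_single single_add[symmetric] simp flip: to_fract_mult)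
    have "mon_eval coord m = (\<Prod>v\<in>Poly_Mapping.keys m.
        to_fract (Poly_Mapping.single (Poly_Mapping.single v (Poly_Mapping.lookup m v)) 1))"
      unfolding mon_eval_def coord_def pow ..
    also have "\<dots> = to_fract (\<Prod>v\<in>Poly_Mapping.keys m.
        Poly_Mapping.single (Poly_Mapping.single v (Poly_Mapping.lookup m v)) 1)"
      by (induction rule: finite_induct[OF finite_keys]) auto
    also have "(\<Prod>v\<in>Poly_Mapping.keys m.
        Poly_Mapping.single (Poly_Mapping.single v (Poly_Mapping.lookup m v)) (1::complex)) =
      Poly_Mapping.single (\<Sum>v\<in>Poly_Mapping.keys m. Poly_Mapping.single v (Poly_Mapping.lookup m v)) 1"
      by (induction rule: finite_induct[OF finite_keys]) (auto simp: mult_single)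
    finally show ?thesis by (simp flip: poly_mapping_sum_single)
  qed
  have "eval_cpoly coord P = (\<Sum>m\<in>Poly_Mapping.keys P. to_fract (Poly_Mapping.single m (Poly_Mapping.lookup P m)))"
    unfolding eval_cpoly_mon_eval mon rconst_def by (simp add: mult_single flip: to_fract_mult)
  also have "\<dots> = to_fract (\<Sum>m\<in>Poly_Mapping.keys P. Poly_Mapping.single m (Poly_Mapping.lookup P m))"
    by (induction rule: finite_induct[OF finite_keys]) auto
  finally show ?thesis by (simp flip: poly_mapping_sum_single)
qed

text \<open>
  Substituting \<open>\<sigma>\<close> for the coordinates is defined on the fractions whose denominator does not
  vanish there.
\<close>

definition regular_at :: "(entry \<Rightarrow> ratfun) \<Rightarrow> ratfun set"
  where "regular_at \<sigma> = {Fract p q | p q. eval_cpoly \<sigma> q \<noteq> 0}"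

definition subst_fun :: "(entry \<Rightarrow> ratfun) \<Rightarrow> ratfun \<Rightarrow> ratfun"
  where "subst_fun \<sigma> x =
    (SOME y. \<exists>p q. eval_cpoly \<sigma> q \<noteq> 0 \<and> x = Fract p q \<and> y = eval_cpoly \<sigma> p / eval_cpoly \<sigma> q)"

lemma eval_cpoly_nonzeroD: "eval_cpoly \<sigma> q \<noteq> 0 \<Longrightarrow> q \<noteq> 0"
  by auto

text \<open>The choice is harmless: equal fractions satisfy \<open>p * q' = p' * q\<close>, and
  evaluation is multiplicative.\<close>

lemma subst_fun_Fract:
  assumes q: "eval_cpoly \<sigma> q \<noteq> 0"
  shows "subst_fun \<sigma> (Fract p q) = eval_cpoly \<sigma> p / eval_cpoly \<sigma> q"
  unfolding subst_fun_def
proof (rule some_equality)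
  show "\<exists>p' q'. eval_cpoly \<sigma> q' \<noteq> 0 \<and> Fract p q = Fract p' q' \<and>
      eval_cpoly \<sigma> p / eval_cpoly \<sigma> q = eval_cpoly \<sigma> p' / eval_cpoly \<sigma> q'"
    using q by blast
  fix y assume "\<exists>p' q'. eval_cpoly \<sigma> q' \<noteq> 0 \<and> Fract p q = Fract p' q' \<and>
      y = eval_cpoly \<sigma> p' / eval_cpoly \<sigma> q'"
  then obtain p' q' where *: "eval_cpoly \<sigma> q' \<noteq> 0" "Fract p q = Fract p' q'"
    "y = eval_cpoly \<sigma> p' / eval_cpoly \<sigma> q'" by blast
  then have "p * q' = p' * q"
    using q by (auto simp: eq_fract dest!: eval_cpoly_nonzeroD)
  then have "eval_cpoly \<sigma> p * eval_cpoly \<sigma> q' = eval_cpoly \<sigma> p' * eval_cpoly \<sigma> q"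
    by (metis eval_cpoly_mult)
  then show "y = eval_cpoly \<sigma> p / eval_cpoly \<sigma> q"
    using * q by (simp add: frac_eq_eq)
qed

lemma regular_atE:
  assumes "x \<in> regular_at \<sigma>"
  obtains p q where "x = Fract p q" "eval_cpoly \<sigma> q \<noteq> 0" "q \<noteq> 0"
  using assms eval_cpoly_nonzeroD unfolding regular_at_def by blast

lemma Fract_regular_at: "eval_cpoly \<sigma> q \<noteq> 0 \<Longrightarrow> Fract p q \<in> regular_at \<sigma>"
  unfolding regular_at_def by blast

interpretation subst: subring_hom "regular_at \<sigma>" "subst_fun \<sigma>" for \<sigma>
proof
  show "0 \<in> regular_at \<sigma>" "1 \<in> regular_at \<sigma>"
    unfolding Zero_fract_def One_fract_def by (rule Fract_regular_at; simp)+
  show "subst_fun \<sigma> 1 = 1"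
    using subst_fun_Fract[of \<sigma> 1 1] by (simp add: fract_collapse)
next
  fix x y assume "x \<in> regular_at \<sigma>" "y \<in> regular_at \<sigma>"
  then obtain p q p' q' where xy: "x = Fract p q" "eval_cpoly \<sigma> q \<noteq> 0" "q \<noteq> 0"
    "y = Fract p' q'" "eval_cpoly \<sigma> q' \<noteq> 0" "q' \<noteq> 0"
    by (metis regular_atE)
  have qq: "eval_cpoly \<sigma> (q * q') \<noteq> 0" using xy by (simp add: eval_cpoly_mult)
  show "x + y \<in> regular_at \<sigma>" "x * y \<in> regular_at \<sigma>"
    using Fract_regular_at[OF qq] xy by simp_all
  show "subst_fun \<sigma> (x + y) = subst_fun \<sigma> x + subst_fun \<sigma> y"
    "subst_fun \<sigma> (x * y) = subst_fun \<sigma> x * subst_fun \<sigma> y"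
    using xy qq by (simp_all add: subst_fun_Fract eval_cpoly_add eval_cpoly_mult add_frac_eq)
next
  fix x assume "x \<in> regular_at \<sigma>"
  then show "- x \<in> regular_at \<sigma>" by (elim regular_atE) (simp add: Fract_regular_at)
qed

lemma subst_inverse:
  assumes "x \<in> regular_at \<sigma>" "subst_fun \<sigma> x \<noteq> 0"
  shows "inverse x \<in> regular_at \<sigma>" "subst_fun \<sigma> (inverse x) = inverse (subst_fun \<sigma> x)"
proof -
  obtain p q where x: "x = Fract p q" "eval_cpoly \<sigma> q \<noteq> 0" "q \<noteq> 0"
    using assms(1) by (metis regular_atE)
  with assms(2) have p: "eval_cpoly \<sigma> p \<noteq> 0" by (simp add: subst_fun_Fract)
  show "inverse x \<in> regular_at \<sigma>" "subst_fun \<sigma> (inverse x) = inverse (subst_fun \<sigma> x)"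
    using x p by (simp_all add: subst_fun_Fract Fract_regular_at)
qed

lemma subst_divide:
  assumes "x \<in> regular_at \<sigma>" "y \<in> regular_at \<sigma>" "subst_fun \<sigma> y \<noteq> 0"
  shows "x / y \<in> regular_at \<sigma>" "subst_fun \<sigma> (x / y) = subst_fun \<sigma> x / subst_fun \<sigma> y"
  using assms by (simp_all add: divide_inverse subst_inverse subst.hom_mult)

lemma subst_to_fract: "to_fract p \<in> regular_at \<sigma>" "subst_fun \<sigma> (to_fract p) = eval_cpoly \<sigma> p"
  using Fract_regular_at[of \<sigma> 1 p] subst_fun_Fract[of \<sigma> 1 p] by (simp_all add: to_fract_def)

lemma subst_coord: "coord v \<in> regular_at \<sigma>" "subst_fun \<sigma> (coord v) = \<sigma> v"
  unfolding coord_def by (simp_all add: subst_to_fract)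

lemma subst_rconst: "rconst c \<in> regular_at \<sigma>" "subst_fun \<sigma> (rconst c) = rconst c"
  by (simp_all only: rconst_def subst_to_fract eval_cpoly_single mon_eval_0 mult_1_right)

lemma subst_eval_cpoly:
  assumes "\<And>i. i \<in> indets P \<Longrightarrow> f i \<in> regular_at \<sigma>"
  shows "subst_fun \<sigma> (eval_cpoly f P) = eval_cpoly (\<lambda>i. subst_fun \<sigma> (f i)) P"
proof -
  have pow: "x \<in> regular_at \<sigma> \<Longrightarrow> x ^ k \<in> regular_at \<sigma> \<and> subst_fun \<sigma> (x ^ k) = subst_fun \<sigma> x ^ k" for x k
    by (induction k) (auto simp: subst.hom_mult)
  have mon: "mon_eval f m \<in> regular_at \<sigma>"
    "subst_fun \<sigma> (mon_eval f m) = mon_eval (\<lambda>i. subst_fun \<sigma> (f i)) m"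
    if "m \<in> Poly_Mapping.keys P" for m
    unfolding mon_eval_def using that assms pow
    by (auto simp: indets_def intro!: subst.prod_closed subst.hom_prod[THEN trans] prod.cong)
  show ?thesis
    unfolding eval_cpoly_mon_eval
    by (subst subst.hom_sum) (auto simp: mon subst_rconst subst.hom_mult)
qed

text \<open>Rescaling the variables multiplies each coefficient by the nonzero weight of its
  monomial, so a nonzero denominator stays nonzero. Thus the torus acts on the whole field and not
  only on a local ring.\<close>

lemma regular_at_scaling:
  assumes s: "\<And>v. s v \<noteq> 0" and \<sigma>: "\<And>v. \<sigma> v = rconst (s v) * coord v"
  shows "regular_at \<sigma> = UNIV"
proof -
  have "eval_cpoly \<sigma> q \<noteq> 0" if "q \<noteq> 0" for q
  proof -
    define w where "w m = (\<Prod>v\<in>Poly_Mapping.keys m. s v ^ Poly_Mapping.lookup m v)" for m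
    have w: "w m \<noteq> 0" for m using s by (simp add: w_def)
    have wr: "mon_eval (\<lambda>v. rconst (s v)) m = rconst (w m)" for m
      unfolding mon_eval_def w_def
      by (induction rule: finite_induct[OF finite_keys]) (auto simp: rconst_mult rconst_power)
    define q' where "q' = Poly_Mapping.mapp (\<lambda>m c. c * w m) q"
    have lookup_q': "Poly_Mapping.lookup q' m = Poly_Mapping.lookup q m * w m" for m
      by (simp add: q'_def lookup_mapp when_def in_keys_iff)
    then have keys_q': "Poly_Mapping.keys q' = Poly_Mapping.keys q"
      using w by (auto simp: in_keys_iff)
    have "eval_cpoly \<sigma> q = eval_cpoly coord q'"
      unfolding eval_cpoly_mon_eval keys_q' lookup_q' \<sigma>[abs_def] mon_eval_mult wr rconst_mult
      by (simp add: mult_ac)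
    also have "\<dots> \<noteq> 0"
      using keys_q' that by (metis eval_cpoly_coord keys_eq_empty to_fract_eq_0_iff)
    finally show ?thesis .
  qed
  then have "Fract p q \<in> regular_at \<sigma>" if "q \<noteq> 0" for p q
    using that by (simp add: Fract_regular_at)
  then show ?thesis
    by (metis Fract_cases UNIV_eq_I)
qed

section \<open>Algebraic independence\<close>

text \<open>The coefficient of the \<open>k\<close>-th power of the variable \<open>i\<close>, with
  \<open>P\<close> regarded as a univariate polynomial in that variable.\<close>

definition var_part :: "'i \<Rightarrow> nat \<Rightarrow> 'i cpoly \<Rightarrow> 'i cpoly"
  where "var_part i k P = (\<Sum>m\<in>{m \<in> Poly_Mapping.keys P. Poly_Mapping.lookup m i = k}.
    Poly_Mapping.single (m - Poly_Mapping.single i k) (Poly_Mapping.lookup P m))"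

lemma lookup_single_diff_add:
  fixes m :: "'i \<Rightarrow>\<^sub>0 nat"
  assumes "Poly_Mapping.lookup m i = k"
  shows "m - Poly_Mapping.single i k + Poly_Mapping.single i k = m"
  by (rule poly_mapping_eqI) (use assms in \<open>auto simp: lookup_add lookup_minus lookup_single when_def\<close>)

lemma indets_var_part: "indets (var_part i k P) \<subseteq> indets P - {i}"
proof
  fix v assume "v \<in> indets (var_part i k P)"
  then obtain m' where m': "m' \<in> Poly_Mapping.keys (var_part i k P)" "v \<in> Poly_Mapping.keys m'"
    by (auto simp: indets_def)
  have "Poly_Mapping.keys (var_part i k P) \<subseteq>
    (\<Union>m\<in>{m \<in> Poly_Mapping.keys P. Poly_Mapping.lookup m i = k}.
      Poly_Mapping.keys (Poly_Mapping.single (m - Poly_Mapping.single i k) (Poly_Mapping.lookup P m)))"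
    unfolding var_part_def by (rule keys_sum)
  with m'(1) obtain m where m: "m \<in> Poly_Mapping.keys P" "Poly_Mapping.lookup m i = k"
    "m' = m - Poly_Mapping.single i k"
    by (auto split: if_splits)
  with m'(2) have "Poly_Mapping.lookup m v \<noteq> 0" "v \<noteq> i"
    by (auto simp: in_keys_iff lookup_minus lookup_single when_def split: if_splits)
  then show "v \<in> indets P - {i}"
    using m(1) by (auto simp: indets_def in_keys_iff)
qed

lemma var_part_eq_0_imp:
  assumes "\<And>k. var_part i k P = 0"
  shows "P = 0"
proof (rule ccontr)
  assume "P \<noteq> 0"
  then have "Poly_Mapping.keys P \<noteq> {}" by simp
  then obtain m where m: "m \<in> Poly_Mapping.keys P" by blast
  define k where "k = Poly_Mapping.lookup m i"
  let ?M = "{m \<in> Poly_Mapping.keys P. Poly_Mapping.lookup m i = k}"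
  have "Poly_Mapping.lookup (var_part i k P) (m - Poly_Mapping.single i k)
    = (\<Sum>m'\<in>?M. if m' = m then Poly_Mapping.lookup P m else 0)"
    unfolding var_part_def lookup_sum
  proof (rule sum.cong)
    fix m' assume "m' \<in> ?M"
    \<comment> \<open>Subtraction of exponents is truncated. Adding the power back shows that it is
      injective on \<open>?M\<close>, so that no two terms of the part collide.\<close>
    then have "m' - Poly_Mapping.single i k + Poly_Mapping.single i k = m'"
      "m - Poly_Mapping.single i k + Poly_Mapping.single i k = m"
      by (auto intro: lookup_single_diff_add simp: k_def)
    then have "m' - Poly_Mapping.single i k = m - Poly_Mapping.single i k \<longleftrightarrow> m' = m"
      by metis
    then show "Poly_Mapping.lookup (Poly_Mapping.single (m' - Poly_Mapping.single i k) (Poly_Mapping.lookup P m'))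
        (m - Poly_Mapping.single i k) = (if m' = m then Poly_Mapping.lookup P m else 0)"
      by (auto simp: lookup_single when_def)
  qed simp
  also have "\<dots> = Poly_Mapping.lookup P m"
    using m by (simp add: k_def)
  finally show False using assms[of k] m by (simp add: in_keys_iff)
qed

text \<open>With all other values frozen, \<open>P\<close> becomes a univariate polynomial whose
  coefficients are the values of its parts; infinitely many zeros make all of them vanish.\<close>

lemma eval_cpoly_var_part_eq_0:
  assumes "infinite V" "\<And>z. z \<in> V \<Longrightarrow> eval_cpoly (f(i := z)) P = 0"
  shows "eval_cpoly f (var_part i k P) = 0"
proof -
  define I where "I = (\<lambda>m. Poly_Mapping.lookup m i) ` Poly_Mapping.keys P"
  define U where "U = (\<Sum>k\<in>I. monom (eval_cpoly f (var_part i k P)) k)"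
  have fin: "finite I" by (simp add: I_def)
  have "poly U z = eval_cpoly (f(i := z)) P" for z
  proof -
    have "eval_cpoly (f(i := z)) P = (\<Sum>k\<in>I. \<Sum>m\<in>{m \<in> Poly_Mapping.keys P. Poly_Mapping.lookup m i = k}.
      rconst (Poly_Mapping.lookup P m) * mon_eval (f(i := z)) m)"
      unfolding eval_cpoly_mon_eval
      by (rule sum.group[symmetric]) (auto simp: I_def)
    also have "\<dots> = (\<Sum>k\<in>I. eval_cpoly (f(i := z)) (var_part i k P) * z ^ k)"
    proof (rule sum.cong)
      fix k assume "k \<in> I"
      have "mon_eval (f(i := z)) m = mon_eval (f(i := z)) (m - Poly_Mapping.single i k) * z ^ k"
        if "Poly_Mapping.lookup m i = k" for m
        using mon_eval_add[of "f(i := z)" "m - Poly_Mapping.single i k" "Poly_Mapping.single i k"]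
        by (simp add: lookup_single_diff_add[OF that])
      then show "(\<Sum>m\<in>{m \<in> Poly_Mapping.keys P. Poly_Mapping.lookup m i = k}.
          rconst (Poly_Mapping.lookup P m) * mon_eval (f(i := z)) m) =
          eval_cpoly (f(i := z)) (var_part i k P) * z ^ k"
        unfolding var_part_def eval_cpoly_sum sum_distrib_right by (auto intro!: sum.cong)
    qed simp
    \<comment> \<open>The parts do not contain the variable \<open>i\<close>, so its value can be
      set back to \<open>f i\<close>.\<close>
    also have "\<dots> = (\<Sum>k\<in>I. eval_cpoly f (var_part i k P) * z ^ k)"
      by (intro sum.cong arg_cong2[where f = "(*)"] eval_cpoly_cong)
        (use indets_var_part[of i _ P] in auto)
    finally show ?thesis by (simp add: U_def poly_sum poly_monom)
  qed
  then have "V \<subseteq> {z. poly U z = 0}" using assms(2) by auto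
  then have "U = 0" using assms(1) poly_roots_finite[of U] finite_subset by blast
  show ?thesis
  proof (cases "k \<in> I")
    case True
    have "coeff U k = (\<Sum>l\<in>I. if l = k then eval_cpoly f (var_part i k P) else 0)"
      unfolding U_def coeff_sum by (intro sum.cong) auto
    then show ?thesis using True fin \<open>U = 0\<close> by simp
  next
    case False
    then have "{m \<in> Poly_Mapping.keys P. Poly_Mapping.lookup m i = k} = {}" by (auto simp: I_def)
    then show ?thesis unfolding var_part_def by (simp only: sum.empty eval_cpoly_0)
  qed
qed

text \<open>The variables are split off one by one, each ranging over the infinitely many constants.
  It yields independence of any family whose specialisations realise every tuple of complex
  numbers.\<close>

lemma eval_cpoly_constants_eq_0_imp:
  assumes "finite J" "indets P \<subseteq> J" "\<And>y. eval_cpoly (\<lambda>i. rconst (y i)) P = 0"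
  shows "P = 0"
  using assms
proof (induction J arbitrary: P rule: finite_induct)
  case empty
  then have "Poly_Mapping.keys P \<subseteq> {0}" unfolding indets_def by auto
  then have "eval_cpoly (\<lambda>_. rconst 0) P = rconst (Poly_Mapping.lookup P 0)"
    by (subst eval_cpoly_superset[of "{0}"]) auto
  with empty.prems(2)[of "\<lambda>_. 0"] have "Poly_Mapping.lookup P 0 = 0" by simp
  then have "0 \<notin> Poly_Mapping.keys P" by (simp add: in_keys_iff)
  then have "Poly_Mapping.keys P = {}"
    using \<open>Poly_Mapping.keys P \<subseteq> {0}\<close> by blast
  then show ?case by (simp only: keys_eq_empty)
next
  case (insert i J)
  show ?case
  proof (rule var_part_eq_0_imp, rule insert.IH)
    fix k
    show "indets (var_part i k P) \<subseteq> J"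
      using indets_var_part[of i k P] insert.prems(1) by auto
    fix y :: "'a \<Rightarrow> complex"
    show "eval_cpoly (\<lambda>i. rconst (y i)) (var_part i k P) = 0"
    proof (rule eval_cpoly_var_part_eq_0)
      show "infinite (rconst ` UNIV)" using infinite_rconst[OF infinite_UNIV_char_0] .
      fix z assume "z \<in> rconst ` UNIV"
      then obtain c where c: "z = rconst c" by blast
      have "(\<lambda>i. rconst (y i))(i := z) = (\<lambda>l. rconst ((y(i := c)) l))" using c by auto
      then show "eval_cpoly ((\<lambda>i. rconst (y i))(i := z)) P = 0" using insert.prems(2) by metis
    qed
  qed
qed

text \<open>Relations are assumed to survive a rescaling of \<open>f i\<close> alone. As
  \<open>f i\<close> is nonzero, this gives infinitely many values for variable \<open>i\<close>, so
  every coefficient of a relation with respect to that variable is a relation among the old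
  functions.\<close>

lemma algebraically_independent_insert:
  assumes ind: "algebraically_independent J f" and C: "infinite C" and fi: "f i \<noteq> 0"
    and hom: "\<And>c P. c \<in> C \<Longrightarrow> indets P \<subseteq> insert i J \<Longrightarrow> eval_cpoly f P = 0 \<Longrightarrow>
      eval_cpoly (f(i := rconst c * f i)) P = 0"
  shows "algebraically_independent (insert i J) f"
  unfolding algebraically_independent_def
proof (intro allI impI)
  fix P :: "'a cpoly"
  assume P: "indets P \<subseteq> insert i J \<and> eval_cpoly f P = 0"
  show "P = 0"
  proof (rule var_part_eq_0_imp)
    fix k
    have "eval_cpoly f (var_part i k P) = 0"
    proof (rule eval_cpoly_var_part_eq_0)
      show "infinite ((\<lambda>c. rconst c * f i) ` C)"
        using C fi by (subst finite_image_iff) (auto simp: inj_on_def)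
      show "eval_cpoly (f(i := z)) P = 0" if "z \<in> (\<lambda>c. rconst c * f i) ` C" for z
        using that hom P by auto
    qed
    moreover have "indets (var_part i k P) \<subseteq> J"
      using indets_var_part[of i k P] P by auto
    ultimately show "var_part i k P = 0"
      using ind unfolding algebraically_independent_def by blast
  qed
qed

text \<open>Two equal members would satisfy the relation \<open>x i - x k\<close>. This allows
  counting functions by counting labels.\<close>

lemma algebraically_independent_inj_on:
  assumes "algebraically_independent J f"
  shows "inj_on f J"
proof (rule inj_onI, rule ccontr)
  fix i k assume ik: "i \<in> J" "k \<in> J" "f i = f k" "i \<noteq> k"
  define x where "x i = Poly_Mapping.single (Poly_Mapping.single i (1::nat)) (1::complex)" for i :: 'a
  let ?P = "x i + - x k"
  have "Poly_Mapping.keys ?P \<subseteq> {Poly_Mapping.single i 1, Poly_Mapping.single k 1}"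
    using keys_add[of "x i" "- x k"] by (auto simp: x_def)
  then have "indets ?P \<subseteq> J" using ik unfolding indets_def by auto
  moreover have "eval_cpoly f (x i) = f i" for i
    by (simp add: x_def)
  then have "eval_cpoly f ?P = 0"
    unfolding eval_cpoly_add eval_cpoly_uminus using ik by simp
  ultimately have "?P = 0" using assms unfolding algebraically_independent_def by blast
  then have "x i = x k" by (metis add_uminus_conv_diff right_minus_eq)
  then have "Poly_Mapping.keys (x i) = Poly_Mapping.keys (x k)" by simp
  then show False using ik(4) by (auto simp: x_def dest: injD[OF inj_single] arg_cong[of _ _ Poly_Mapping.keys])
qed

section \<open>The field of chain functions\<close>

lemma indets_0 [simp]: "indets 0 = {}"
  and indets_1 [simp]: "indets 1 = {}"
  and indets_uminus [simp]: "indets (- (p :: 'v cpoly)) = indets p"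
  by (auto simp: indets_def in_keys_iff lookup_one when_def)

lemma indets_add: "indets (p + q) \<subseteq> indets p \<union> indets q"
  using keys_add[of p q] by (auto simp: indets_def)

lemma indets_mult: "indets (p * q) \<subseteq> indets p \<union> indets q"
proof
  fix v assume "v \<in> indets (p * q)"
  then obtain m where "m \<in> Poly_Mapping.keys (p * q)" "v \<in> Poly_Mapping.keys m"
    by (auto simp: indets_def)
  moreover from this keys_mult[of p q] obtain a b
    where "m = a + b" "a \<in> Poly_Mapping.keys p" "b \<in> Poly_Mapping.keys q" by blast
  ultimately show "v \<in> indets p \<union> indets q"
    using keys_add[of a b] by (auto simp: indets_def)
qed

lemma Fract_chain_functions:
  "q \<noteq> 0 \<Longrightarrow> indets p \<subseteq> chain_entries N j \<Longrightarrow> indets q \<subseteq> chain_entries N j \<Longrightarrow>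
    Fract p q \<in> chain_functions N j"
  unfolding chain_functions_def by blast

lemma chain_functionsE:
  assumes "x \<in> chain_functions N j"
  obtains p q where "x = Fract p q" "q \<noteq> 0" "indets p \<subseteq> chain_entries N j" "indets q \<subseteq> chain_entries N j"
  using assms unfolding chain_functions_def by blast

lemma subring_chain_functions: "subring_of (chain_functions N j)"
proof
  show "0 \<in> chain_functions N j" "1 \<in> chain_functions N j"
    unfolding Zero_fract_def One_fract_def by (auto intro!: Fract_chain_functions)
next
  fix x y assume "x \<in> chain_functions N j" "y \<in> chain_functions N j"
  then obtain p q p' q' where x: "x = Fract p q" "q \<noteq> 0" "indets p \<subseteq> chain_entries N j" "indets q \<subseteq> chain_entries N j"
    and y: "y = Fract p' q'" "q' \<noteq> 0" "indets p' \<subseteq> chain_entries N j" "indets q' \<subseteq> chain_entries N j"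
    by (metis chain_functionsE)
  have prods: "indets (a * b) \<subseteq> chain_entries N j"
    if "indets a \<subseteq> chain_entries N j" "indets b \<subseteq> chain_entries N j" for a b
    using indets_mult[of a b] that by blast
  have "indets (p * q' + p' * q) \<subseteq> chain_entries N j"
    using indets_add[of "p * q'" "p' * q"] prods x y by blast
  then show "x + y \<in> chain_functions N j"
    using x y by (simp add: Fract_chain_functions prods)
  show "x * y \<in> chain_functions N j"
    using x y by (simp add: Fract_chain_functions prods)
next
  fix x assume "x \<in> chain_functions N j"
  then show "- x \<in> chain_functions N j"
    by (elim chain_functionsE) (auto intro!: Fract_chain_functions)
qed

lemma inverse_chain_functions:
  assumes "x \<in> chain_functions N j"
  shows "inverse x \<in> chain_functions N j"
proof -
  obtain p q where x: "x = Fract p q" "q \<noteq> 0" "indets p \<subseteq> chain_entries N j" "indets q \<subseteq> chain_entries N j"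
    using assms by (metis chain_functionsE)
  interpret subring_of "chain_functions N j" by (rule subring_chain_functions)
  show ?thesis
  proof (cases "p = 0")
    case True
    then have "x = 0" using x by (simp add: Zero_fract_def eq_fract)
    then show ?thesis by simp
  qed (use x in \<open>auto intro!: Fract_chain_functions\<close>)
qed

lemma coord_chain_functions: "v \<in> chain_entries N j \<Longrightarrow> coord v \<in> chain_functions N j"
  unfolding coord_def to_fract_def
  by (intro Fract_chain_functions) (auto simp: indets_def)

section \<open>The brackets of the matrix entries\<close>

text \<open>
  In \<open>tens N f\<close> the coefficient of \<open>E\<^bsub>i,j\<^esub> \<otimes> E\<^bsub>k,l\<^esub>\<close> is \<open>f i k j l\<close>: the two row indices come first.
\<close>

definition tens :: "nat \<Rightarrow> (nat \<Rightarrow> nat \<Rightarrow> nat \<Rightarrow> nat \<Rightarrow> 'a) \<Rightarrow> 'a mat"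
  where "tens N f = mat (N * N) (N * N) (\<lambda>(a, b). f (a div N) (a mod N) (b div N) (b mod N))"

lemma pair_index_less: "i < N \<Longrightarrow> k < N \<Longrightarrow> i * N + k < N * (N::nat)"
  using mult_le_mono1[of "Suc i" N N] by simp

lemma index_less_square:
  assumes "a < N * (N::nat)"
  shows "a div N < N" "a mod N < N"
  using assms by (cases "N = 0"; simp add: less_mult_imp_div_less)+

lemma tens_eqD:
  assumes "tens N f = tens N g" "i < N" "k < N" "j < N" "l < N"
  shows "f i k j l = g i k j l"
  using arg_cong[OF assms(1), of "\<lambda>M. M $$ (i * N + k, j * N + l)"] assms(2-)
  by (simp add: tens_def pair_index_less)

lemma tens_cong:
  "(\<And>i k j l. i < N \<Longrightarrow> k < N \<Longrightarrow> j < N \<Longrightarrow> l < N \<Longrightarrow> f i k j l = g i k j l) \<Longrightarrow> tens N f = tens N g"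
  unfolding tens_def by (intro cong_mat) (auto simp: index_less_square)

lemma tens_add: "tens N f + tens N g = tens N (\<lambda>i k j l. f i k j l + g i k j l)"
  and tens_minus: "tens N f - tens N g = tens N (\<lambda>i k j l. f i k j l - g i k j l)"
  and tens_uminus: "- tens N f = tens N (\<lambda>i k j l. - f i k j l)"
  unfolding tens_def by (auto intro!: eq_matI)

lemma tens_zero: "0\<^sub>m (N * N) (N * N) = tens N (\<lambda>_ _ _ _. 0)"
  unfolding tens_def by (auto intro!: eq_matI)

lemma sum_square:
  fixes F :: "nat \<Rightarrow> nat \<Rightarrow> 'a::comm_monoid_add"
  shows "(\<Sum>c<N * N. F (c div N) (c mod N)) = (\<Sum>m<N. \<Sum>n<N. F m n)"
  unfolding sum.cartesian_product
  by (rule sum.reindex_bij_witness[of _ "\<lambda>(m, n). m * N + n" "\<lambda>c. (c div N, c mod N)"])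
    (auto simp: index_less_square pair_index_less)

lemma tens_mult:
  "tens N f * tens N g = tens N (\<lambda>i k j l. \<Sum>m<N. \<Sum>n<N. f i k m n * g m n j l :: 'a::comm_ring_1)"
proof (rule eq_matI)
  fix a b assume "a < dim_row (tens N (\<lambda>i k j l. \<Sum>m<N. \<Sum>n<N. f i k m n * g m n j l))"
    "b < dim_col (tens N (\<lambda>i k j l. \<Sum>m<N. \<Sum>n<N. f i k m n * g m n j l))"
  then have ab: "a < N * N" "b < N * N" by (auto simp: tens_def)
  have "(tens N f * tens N g) $$ (a, b) = (\<Sum>c<N * N. tens N f $$ (a, c) * tens N g $$ (c, b))"
    by (rule index_mult_mat_sum) (use ab in \<open>auto simp: tens_def\<close>)
  also have "\<dots> = (\<Sum>c<N * N. f (a div N) (a mod N) (c div N) (c mod N) * g (c div N) (c mod N) (b div N) (b mod N))"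
    using ab by (intro sum.cong) (auto simp: tens_def)
  also have "\<dots> = (\<Sum>m<N. \<Sum>n<N. f (a div N) (a mod N) m n * g m n (b div N) (b mod N))"
    by (rule sum_square)
  finally show "(tens N f * tens N g) $$ (a, b) =
      tens N (\<lambda>i k j l. \<Sum>m<N. \<Sum>n<N. f i k m n * g m n j l) $$ (a, b)"
    using ab by (simp add: tens_def)
qed (auto simp: tens_def)

lemma tensor_by_eq_tens:
  assumes "X \<in> carrier_mat N N" "Y \<in> carrier_mat N N"
  shows "tensor_by f X Y = tens N (\<lambda>i k j l. f (X $$ (i, j)) (Y $$ (k, l)))"
  using assms by (auto simp: tensor_by_def tens_def intro!: eq_matI)

lemma transpose_first_tens: "transpose_first N (tens N f) = tens N (\<lambda>i k j l. f j k i l)"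
  and transpose_second_tens: "transpose_second N (tens N f) = tens N (\<lambda>i k j l. f i l j k)"
proof -
  have d: "(b div N * N + a mod N) div N = b div N" if "a < N * N" for a b
    using index_less_square[OF that] by (simp add: div_add1_eq)
  then show "transpose_first N (tens N f) = tens N (\<lambda>i k j l. f j k i l)"
    "transpose_second N (tens N f) = tens N (\<lambda>i k j l. f i l j k)"
    by (auto simp: transpose_first_def transpose_second_def tens_def index_less_square pair_index_less d
        intro!: eq_matI simp del: div_mult_self3)
qed

lemma in_first_eq_tens:
  assumes "X \<in> carrier_mat N N"
  shows "in_first N X = tens N (\<lambda>i k j l. if k = l then X $$ (i, j) else 0)"
  unfolding in_first_def tensor_by_eq_tens[OF assms one_carrier_mat]
  by (rule tens_cong) auto

lemma in_second_eq_tens: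
  assumes "X \<in> carrier_mat N N"
  shows "in_second N X = tens N (\<lambda>i k j l. if i = j then X $$ (k, l) else 0)"
  unfolding in_second_def tensor_by_eq_tens[OF one_carrier_mat assms]
  by (rule tens_cong) auto

lemma sum_if_const: "(\<Sum>m\<in>A. if P then f m else 0) = (if P then sum f A else 0)"
  by simp

lemmas delta_sum_simps = sum_if_const if_distrib[where f = "\<lambda>x. x * _"] if_distrib[where f = "\<lambda>x. _ * x"]
  if_distrib[where f = "\<lambda>x. sum x _"] sum.delta sum.delta'

lemma
  assumes X: "X \<in> carrier_mat N N"
  shows in_first_mult_tens: "in_first N X * tens N f = tens N (\<lambda>i k j l. \<Sum>m<N. X $$ (i, m) * f m k j l)"
    and in_second_mult_tens: "in_second N X * tens N f = tens N (\<lambda>i k j l. \<Sum>n<N. X $$ (k, n) * f i n j l)"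
    and tens_mult_in_first: "tens N f * in_first N X = tens N (\<lambda>i k j l. \<Sum>m<N. f i k m l * X $$ (m, j))"
    and tens_mult_in_second: "tens N f * in_second N X = tens N (\<lambda>i k j l. \<Sum>n<N. f i k j n * X $$ (n, l))"
proof -
  show "in_first N X * tens N f = tens N (\<lambda>i k j l. \<Sum>m<N. X $$ (i, m) * f m k j l)"
    unfolding in_first_eq_tens[OF X] tens_mult
    by (rule tens_cong) (simp add: delta_sum_simps cong: if_cong)
  show "in_second N X * tens N f = tens N (\<lambda>i k j l. \<Sum>n<N. X $$ (k, n) * f i n j l)"
    unfolding in_second_eq_tens[OF X] tens_mult
    by (subst sum.swap, rule tens_cong) (simp add: delta_sum_simps cong: if_cong)
  show "tens N f * in_first N X = tens N (\<lambda>i k j l. \<Sum>m<N. f i k m l * X $$ (m, j))"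
    unfolding in_first_eq_tens[OF X] tens_mult
    by (rule tens_cong) (simp add: delta_sum_simps cong: if_cong)
  show "tens N f * in_second N X = tens N (\<lambda>i k j l. \<Sum>n<N. f i k j n * X $$ (n, l))"
    unfolding in_second_eq_tens[OF X] tens_mult
    by (subst sum.swap, rule tens_cong) (simp add: delta_sum_simps cong: if_cong)
qed

text \<open>The coefficient of \<open>E_ik\<close> \<otimes> \<open>E_ki\<close> in the classical
  \<open>r\<close>-matrix.\<close>

definition half_step :: "nat \<Rightarrow> nat \<Rightarrow> ratfun"
  where "half_step i k = (if i = k then 1 else if k < i then 2 else 0)"

text \<open>In tensor form: the \<open>r\<close>-matrix plus its flip is twice the permutation
  matrix. This is the source of every trade between left and right actions below.\<close>

lemma half_step_add_swap: "half_step i k + half_step k i = 2"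
  by (auto simp: half_step_def)

lemma half_step_same [simp]: "half_step i i = 1"
  by (simp add: half_step_def)

lemma half_step_less: "i < k \<Longrightarrow> half_step i k = 0"
  by (simp add: half_step_def)

text \<open>The diagonal and the strictly lower part merge into one coefficient function. The
  conditions are kept as nested \<open>if\<close> with value 0, so that sums over tensor indices
  collapse by \<open>sum.delta\<close>.\<close>

lemma r_matrix_eq_tens:
  "r_matrix N = tens N (\<lambda>i k j l. if j = k then if l = i then half_step i k else 0 else 0)"
proof (rule eq_matI)
  fix a b assume "a < dim_row (tens N (\<lambda>i k j l. if j = k then if l = i then half_step i k else 0 else 0))"
    "b < dim_col (tens N (\<lambda>i k j l. if j = k then if l = i then half_step i k else 0 else 0))"
  then have ab: "a < N * N" "b < N * N" by (auto simp: tens_def)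
  define i k j l where ij: "i = a div N" "k = a mod N" "j = b div N" "l = b mod N"
  note less = index_less_square[OF ab(1)] index_less_square[OF ab(2)]
  have K: "kronecker (unit_matrix N p q) (unit_matrix N p' q') $$ (a, b) =
      (if i = p \<and> j = q \<and> k = p' \<and> l = q' then 1 else 0)" for p q p' q'
    using less ab by (auto simp: tensor_by_def unit_matrix_def ij)
  have 1: "(\<Sum>p<N. kronecker (unit_matrix N p p) (unit_matrix N p p) $$ (a, b)) =
      (if i = k \<and> j = k \<and> l = i then 1 else 0)"
  proof -
    have "(\<Sum>p<N. kronecker (unit_matrix N p p) (unit_matrix N p p) $$ (a, b)) =
        (\<Sum>p<N. if p = i then if i = k \<and> j = k \<and> l = i then 1 else 0 else 0)"
      unfolding K by (intro sum.cong) auto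
    then show ?thesis using less ij by simp
  qed
  have 2: "(\<Sum>p<N. \<Sum>q<p. kronecker (unit_matrix N p q) (unit_matrix N q p) $$ (a, b)) =
      (if k < i \<and> j = k \<and> l = i then 1 else 0)"
  proof -
    have "(\<Sum>q<p. kronecker (unit_matrix N p q) (unit_matrix N q p) $$ (a, b)) =
        (if p = i then if k < i \<and> j = k \<and> l = i then 1 else 0 else 0)" for p
    proof -
      have "(\<Sum>q<p. kronecker (unit_matrix N p q) (unit_matrix N q p) $$ (a, b)) =
        (\<Sum>q<p. if q = k then if p = i \<and> j = k \<and> l = i then 1 else 0 else 0)"
        unfolding K by (intro sum.cong) auto
      then show ?thesis by auto
    qed
    then show ?thesis using less ij by simp
  qed
  have "r_matrix N $$ (a, b) = (\<Sum>p<N. kronecker (unit_matrix N p p) (unit_matrix N p p) $$ (a, b)) +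
    2 * (\<Sum>p<N. \<Sum>q<p. kronecker (unit_matrix N p q) (unit_matrix N q p) $$ (a, b))"
    using ab by (simp add: r_matrix_def)
  then show "r_matrix N $$ (a, b) =
      tens N (\<lambda>i k j l. if j = k then if l = i then half_step i k else 0 else 0) $$ (a, b)"
    unfolding 1 2 using ab by (auto simp: tens_def half_step_def ij)
qed (auto simp: r_matrix_def tens_def)

text \<open>Each product contains a single \<open>r\<close> and hence collapses to one term:
  \<open>r\<close> on the left exchanges the two row indices, on the right the two column indices,
  and a partial transpose in the middle exchanges a column index with a row index. The two
  transposes differ only in the direction of the step.\<close>

lemma
  assumes X: "X \<in> carrier_mat N N" and Y: "Y \<in> carrier_mat N N"
  shows r_first_second: "r_matrix N * in_first N X * in_second N Y =
      tens N (\<lambda>i k j l. half_step i k * X $$ (k, j) * Y $$ (i, l))"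
    and first_second_r: "in_first N X * in_second N Y * r_matrix N =
      tens N (\<lambda>i k j l. half_step l j * X $$ (i, l) * Y $$ (k, j))"
    and first_r1_second: "in_first N X * transpose_first N (r_matrix N) * in_second N Y =
      tens N (\<lambda>i k j l. half_step j k * X $$ (i, k) * Y $$ (j, l))"
    and second_r1_first: "in_second N Y * transpose_first N (r_matrix N) * in_first N X =
      tens N (\<lambda>i k j l. half_step l i * Y $$ (k, i) * X $$ (l, j))"
    and first_r2_second: "in_first N X * transpose_second N (r_matrix N) * in_second N Y =
      tens N (\<lambda>i k j l. half_step k j * X $$ (i, k) * Y $$ (j, l))"
proof -
  note tens = r_matrix_eq_tens transpose_first_tens transpose_second_tens
    in_first_mult_tens[OF X] in_second_mult_tens[OF Y] tens_mult_in_first[OF X] tens_mult_in_second[OF Y]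
  show "r_matrix N * in_first N X * in_second N Y =
      tens N (\<lambda>i k j l. half_step i k * X $$ (k, j) * Y $$ (i, l))"
    unfolding tens by (rule tens_cong) (simp add: delta_sum_simps cong: if_cong)
  show "in_first N X * in_second N Y * r_matrix N =
      tens N (\<lambda>i k j l. half_step l j * X $$ (i, l) * Y $$ (k, j))"
  proof -
    have "in_first N X * in_second N Y = tens N (\<lambda>i k j l. X $$ (i, j) * Y $$ (k, l))"
      unfolding in_second_eq_tens[OF Y] tens
      by (rule tens_cong) (simp add: delta_sum_simps cong: if_cong)
    then show ?thesis
      unfolding r_matrix_eq_tens
      by (simp add: tens_mult, intro tens_cong) (simp add: delta_sum_simps cong: if_cong)
  qed
  show "in_first N X * transpose_first N (r_matrix N) * in_second N Y =
      tens N (\<lambda>i k j l. half_step j k * X $$ (i, k) * Y $$ (j, l))"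
    unfolding tens by (rule tens_cong) (simp add: delta_sum_simps cong: if_cong)
  show "in_second N Y * transpose_first N (r_matrix N) * in_first N X =
      tens N (\<lambda>i k j l. half_step l i * Y $$ (k, i) * X $$ (l, j))"
    unfolding tens by (rule tens_cong) (simp add: delta_sum_simps cong: if_cong)
  show "in_first N X * transpose_second N (r_matrix N) * in_second N Y =
      tens N (\<lambda>i k j l. half_step k j * X $$ (i, k) * Y $$ (j, l))"
    unfolding tens by (rule tens_cong) (simp add: delta_sum_simps cong: if_cong)
qed

lemma generic_mat_carrier [simp]: "generic_mat N s \<in> carrier_mat N N"
  by (simp add: generic_mat_def)

lemma generic_mat_dim [simp]: "dim_row (generic_mat N s) = N" "dim_col (generic_mat N s) = N"
  by (simp_all add: generic_mat_def)

lemma generic_mat_index [simp]: "i < N \<Longrightarrow> k < N \<Longrightarrow> generic_mat N s $$ (i, k) = coord (Entry s i k)"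
  by (simp add: generic_mat_def)

lemma
  assumes rel: "type_ii_relations N J br"
    and less: "i < N" "j < N" "k < N" "l < N"
  shows bracket_A_A: "br (coord (Entry A_site i j)) (coord (Entry A_site k l)) =
      half_step i k * coord (Entry A_site k j) * coord (Entry A_site i l)
      - half_step l j * coord (Entry A_site i l) * coord (Entry A_site k j)
      + half_step j k * coord (Entry A_site i k) * coord (Entry A_site j l)
      - half_step l i * coord (Entry A_site k i) * coord (Entry A_site l j)" (is ?AA)
    and bracket_1_A: "1 \<le> J \<Longrightarrow> X \<in> {B_site, C_site} \<Longrightarrow>
      br (coord (Entry (X 1) i j)) (coord (Entry A_site k l)) =
      - (half_step k j * coord (Entry (X 1) i k) * coord (Entry A_site j l))
      - half_step l j * coord (Entry (X 1) i l) * coord (Entry A_site k j)"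
    and bracket_same: "t \<in> {1..J} \<Longrightarrow> (X, Y) \<in> {(B_site, B_site), (C_site, C_site), (C_site, B_site)} \<Longrightarrow>
      br (coord (Entry (X t) i j)) (coord (Entry (Y t) k l)) =
      half_step i k * coord (Entry (X t) k j) * coord (Entry (Y t) i l)
      - half_step l j * coord (Entry (X t) i l) * coord (Entry (Y t) k j)"
    and bracket_next: "1 \<le> t \<Longrightarrow> t + 1 \<le> J \<Longrightarrow> X \<in> {B_site, C_site} \<Longrightarrow> Y \<in> {B_site, C_site} \<Longrightarrow>
      br (coord (Entry (X (t + 1)) i j)) (coord (Entry (Y t) k l)) =
      - (half_step k j * coord (Entry (X (t + 1)) i k) * coord (Entry (Y t) j l))"
    and bracket_far_A: "t \<in> {2..J} \<Longrightarrow> X \<in> {B_site, C_site} \<Longrightarrow>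
      br (coord (Entry (X t) i j)) (coord (Entry A_site k l)) = 0"
    and bracket_far: "t \<in> {1..J} \<Longrightarrow> u \<in> {1..J} \<Longrightarrow> u + 2 \<le> t \<Longrightarrow>
      X \<in> {B_site, C_site} \<Longrightarrow> Y \<in> {B_site, C_site} \<Longrightarrow>
      br (coord (Entry (X t) i j)) (coord (Entry (Y u) k l)) = 0"
proof -
  note tens = r_first_second[OF generic_mat_carrier generic_mat_carrier]
    first_second_r[OF generic_mat_carrier generic_mat_carrier]
    first_r1_second[OF generic_mat_carrier generic_mat_carrier]
    second_r1_first[OF generic_mat_carrier generic_mat_carrier]
    first_r2_second[OF generic_mat_carrier generic_mat_carrier]
    tensor_by_eq_tens[OF generic_mat_carrier generic_mat_carrier]
    tens_add tens_minus tens_uminus tens_zero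
  note rel' = rel[unfolded type_ii_relations_def Let_def tens]
  note at = tens_eqD[OF _ less(1) less(3) less(2) less(4)]
  show ?AA
    using at[OF rel'[THEN conjunct1]] less by simp
  show "br (coord (Entry (X 1) i j)) (coord (Entry A_site k l)) =
      - (half_step k j * coord (Entry (X 1) i k) * coord (Entry A_site j l))
      - half_step l j * coord (Entry (X 1) i l) * coord (Entry A_site k j)"
    if "1 \<le> J" "X \<in> {B_site, C_site}"
    using at[OF rel'[THEN conjunct2, THEN conjunct1, rule_format, OF that]] less by simp
  show "br (coord (Entry (X t) i j)) (coord (Entry (Y t) k l)) =
      half_step i k * coord (Entry (X t) k j) * coord (Entry (Y t) i l)
      - half_step l j * coord (Entry (X t) i l) * coord (Entry (Y t) k j)"
    if t: "t \<in> {1..J}" and XY: "(X, Y) \<in> {(B_site, B_site), (C_site, C_site), (C_site, B_site)}"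
  proof -
    note r = rel'[THEN conjunct2, THEN conjunct2, THEN conjunct1, rule_format, OF t]
    show ?thesis
      using XY at[OF r[THEN conjunct1]] at[OF r[THEN conjunct2, THEN conjunct1]]
        at[OF r[THEN conjunct2, THEN conjunct2]] less by auto
  qed
  show "br (coord (Entry (X (t + 1)) i j)) (coord (Entry (Y t) k l)) =
      - (half_step k j * coord (Entry (X (t + 1)) i k) * coord (Entry (Y t) j l))"
    if "1 \<le> t" "t + 1 \<le> J" "X \<in> {B_site, C_site}" "Y \<in> {B_site, C_site}"
    using at[OF rel'[THEN conjunct2, THEN conjunct2, THEN conjunct2, THEN conjunct1, rule_format,
        OF conjI[OF that(1,2)] that(3,4)]] less by simp
  show "br (coord (Entry (X t) i j)) (coord (Entry A_site k l)) = 0"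
    if "t \<in> {2..J}" "X \<in> {B_site, C_site}"
    using at[OF rel'[THEN conjunct2, THEN conjunct2, THEN conjunct2, THEN conjunct2, THEN conjunct1,
        rule_format, OF that]] less by simp
  show "br (coord (Entry (X t) i j)) (coord (Entry (Y u) k l)) = 0"
    if "t \<in> {1..J}" "u \<in> {1..J}" "u + 2 \<le> t" "X \<in> {B_site, C_site}" "Y \<in> {B_site, C_site}"
    using at[OF rel'[THEN conjunct2, THEN conjunct2, THEN conjunct2, THEN conjunct2, THEN conjunct2,
        rule_format, OF that]] less by simp
qed

section \<open>Specialisations of the generic matrices\<close>

lemma map_generic_mat: "map_mat f (generic_mat N s) = mat N N (\<lambda>(a, b). f (coord (Entry s a b)))"
  by (intro eq_matI) auto

lemma subst_generic_mat:
  "map_mat (subst_fun \<sigma>) (generic_mat N s) = mat N N (\<lambda>(a, b). \<sigma> (Entry s a b))"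
  unfolding map_generic_mat by (simp add: subst_coord)

lemma subst_det_generic_mat:
  "det (generic_mat N s) \<in> regular_at \<sigma>"
  "subst_fun \<sigma> (det (generic_mat N s)) = det (mat N N (\<lambda>(a, b). \<sigma> (Entry s a b)))"
  using subst.det_closed[of "generic_mat N s" N \<sigma>] subst.hom_det[of "generic_mat N s" N \<sigma>]
  by (simp_all add: subst_generic_mat subst_coord)

lemma one_mat_eq: "mat N N (\<lambda>(a, b). if a = b then 1 else 0) = 1\<^sub>m N"
  by (intro eq_matI) auto

text \<open>At the identity matrix the determinant takes the value 1.\<close>

lemma det_generic_mat_nonzero: "det (generic_mat N s) \<noteq> 0"
proof
  define \<sigma> where "\<sigma> v = (case v of Entry s a b \<Rightarrow> if a = b then 1 else (0 :: ratfun))" for v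
  assume "det (generic_mat N s) = 0"
  then have "subst_fun \<sigma> (det (generic_mat N s)) = 0" by simp
  then show False by (simp add: subst_det_generic_mat \<sigma>_def one_mat_eq)
qed

lemma inverse_generic_mat:
  fixes N s
  defines "X \<equiv> the (mat_inverse (generic_mat N s))"
  shows "X \<in> carrier_mat N N" "generic_mat N s * X = 1\<^sub>m N" "X * generic_mat N s = 1\<^sub>m N"
proof -
  have "generic_mat N s \<in> Units (ring_mat TYPE(ratfun) N ())"
    by (rule det_non_zero_imp_unit) (simp_all add: det_generic_mat_nonzero)
  then obtain Y where "mat_inverse (generic_mat N s) = Some Y"
    using mat_inverse(1)[of "generic_mat N s" N "()"] by fastforce
  then show "X \<in> carrier_mat N N" "generic_mat N s * X = 1\<^sub>m N" "X * generic_mat N s = 1\<^sub>m N"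
    using mat_inverse(2)[of "generic_mat N s" N Y] by (simp_all add: X_def)
qed

text \<open>Cramer's rule. It places the entries of the inverses in \<open>chain_functions\<close>,
  and later among the functions regular at a special point.\<close>

lemma left_inverse_mat_index:
  fixes B X :: "'a::field mat"
  assumes B: "B \<in> carrier_mat n n" and X: "X \<in> carrier_mat n n" and XB: "X * B = 1\<^sub>m n"
    and d: "det B \<noteq> 0" and ij: "i < n" "j < n"
  shows "X $$ (i, j) = cofactor B j i / det B"
proof -
  note adj = adj_mat[OF B]
  have "adj_mat B = X * B * adj_mat B" using XB adj by simp
  also have "\<dots> = X * (B * adj_mat B)" using X B adj by simp
  also have "\<dots> = det B \<cdot>\<^sub>m X"
    using X adj by (simp add: mult_smult_distrib[of X n n "1\<^sub>m n" n])
  finally have "adj_mat B $$ (i, j) = det B * X $$ (i, j)" using X ij by simp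
  moreover have "adj_mat B $$ (i, j) = cofactor B j i" using B ij by (simp add: adj_mat_def)
  ultimately show ?thesis using d by simp
qed

lemma (in subring_of) cofactor_closed:
  assumes "B \<in> carrier_mat n n" "\<And>i j. i < n \<Longrightarrow> j < n \<Longrightarrow> B $$ (i, j) \<in> R" "i < n" "j < n"
  shows "cofactor B i j \<in> R"
proof -
  have "det (mat_delete B i j) \<in> R"
    by (rule det_closed[of _ "n - 1"]) (use assms in \<open>auto simp: mat_delete_def\<close>)
  moreover have "(- 1) ^ k \<in> R" for k by (induction k) auto
  ultimately show ?thesis unfolding cofactor_def by blast
qed

lemma S_mat_carrier: "S_mat N m \<in> carrier_mat N N"
proof (induction m)
  case (Suc m)
  then show ?case using inverse_generic_mat(1)[of N "B_site (Suc m)"] by auto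
qed simp

lemma generic_mat_chain_functions:
  "s \<in> chain_sites j \<Longrightarrow> a < N \<Longrightarrow> b < N \<Longrightarrow> generic_mat N s $$ (a, b) \<in> chain_functions N j"
  by (simp add: coord_chain_functions chain_entries_def)

lemma chain_sites_simps: "A_site \<in> chain_sites j" "u \<in> {1..j} \<Longrightarrow> B_site u \<in> chain_sites j"
  "u \<in> {1..j} \<Longrightarrow> C_site u \<in> chain_sites j"
  by (auto simp: chain_sites_def)

lemma inverse_generic_mat_chain_functions:
  assumes "s \<in> chain_sites j" "a < N" "b < N"
  shows "the (mat_inverse (generic_mat N s)) $$ (a, b) \<in> chain_functions N j"
proof -
  interpret subring_of "chain_functions N j" by (rule subring_chain_functions)
  have "the (mat_inverse (generic_mat N s)) $$ (a, b) =
      cofactor (generic_mat N s) b a / det (generic_mat N s)"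
    by (rule left_inverse_mat_index[of _ N])
      (use inverse_generic_mat[of N s] assms in \<open>auto simp: det_generic_mat_nonzero\<close>)
  moreover have "cofactor (generic_mat N s) b a \<in> chain_functions N j"
    by (rule cofactor_closed[of _ N]) (use assms generic_mat_chain_functions in auto)
  moreover have "det (generic_mat N s) \<in> chain_functions N j"
    by (rule det_closed[of _ N]) (use assms generic_mat_chain_functions in auto)
  ultimately show ?thesis
    by (simp add: divide_inverse inverse_chain_functions)
qed

lemma (in subring_of) mat_mult_closed:
  assumes "A \<in> carrier_mat n n" "B \<in> carrier_mat n n"
    and "\<And>i j. i < n \<Longrightarrow> j < n \<Longrightarrow> A $$ (i, j) \<in> R"
    and "\<And>i j. i < n \<Longrightarrow> j < n \<Longrightarrow> B $$ (i, j) \<in> R"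
    and "i < n" "j < n"
  shows "(A * B) $$ (i, j) \<in> R"
  unfolding index_mult_mat_sum[OF assms(1,2,5,6)] using assms by (intro sum_closed mult_closed) auto

lemma S_mat_chain_functions:
  "m \<le> j \<Longrightarrow> a < N \<Longrightarrow> b < N \<Longrightarrow> S_mat N m $$ (a, b) \<in> chain_functions N j"
proof (induction m arbitrary: a b)
  case 0
  then show ?case by (simp add: coord_chain_functions chain_entries_def chain_sites_def)
next
  case (Suc m)
  interpret subring_of "chain_functions N j" by (rule subring_chain_functions)
  have s: "B_site (Suc m) \<in> chain_sites j" using Suc.prems by (simp add: chain_sites_simps)
  show ?case
    unfolding S_mat.simps
    by (rule mat_mult_closed[of _ N])
      (use Suc S_mat_carrier inverse_generic_mat(1) inverse_generic_mat_chain_functions[OF s]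
        generic_mat_chain_functions[OF s] in auto)
qed

section \<open>Infinitesimal symmetries\<close>

text \<open>The trace of a diagonal block. Start \<open>m = 0\<close> belongs to the first
  \<open>q\<close> rows or columns, \<open>m = N - q\<close> to the last ones.\<close>

definition diag_sum :: "nat \<Rightarrow> nat \<Rightarrow> 'a::comm_ring_1 mat \<Rightarrow> 'a"
  where "diag_sum m q M = (\<Sum>i<q. M $$ (m + i, m + i))"

lemma diag_sum_0: "diag_sum m q (0\<^sub>m n n) = 0" if "m + q \<le> n"
  unfolding diag_sum_def using that by (intro sum.neutral) auto

lemma diag_sum_transpose:
  "M \<in> carrier_mat n n \<Longrightarrow> m + q \<le> n \<Longrightarrow> diag_sum m q (transpose_mat M) = diag_sum m q M"
  unfolding diag_sum_def by (intro sum.cong refl index_transpose_mat) auto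

lemma diag_sum_uminus:
  "M \<in> carrier_mat n n \<Longrightarrow> m + q \<le> n \<Longrightarrow> diag_sum m q (- M) = - diag_sum m q M"
  unfolding diag_sum_def sum_negf[symmetric] by (intro sum.cong refl index_uminus_mat) auto

lemma diag_sum_add:
  "M \<in> carrier_mat n n \<Longrightarrow> M' \<in> carrier_mat n n \<Longrightarrow> m + q \<le> n \<Longrightarrow>
    diag_sum m q (M + M') = diag_sum m q M + diag_sum m q M'"
  unfolding diag_sum_def sum.distrib[symmetric] by (intro sum.cong refl index_add_mat) auto

context subfield_der
begin

lemma eigen_det_diag_sum:
  assumes "A \<in> carrier_mat n n" "\<And>i j. i < n \<Longrightarrow> j < n \<Longrightarrow> A $$ (i, j) \<in> R"
    and "P \<in> carrier_mat n n" "Q \<in> carrier_mat n n" "map_mat D A = P * A + A * Q"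
  shows "eigen (diag_sum 0 n P + diag_sum 0 n Q) (det A)"
  using eigen_det[OF assms] by (simp add: diag_sum_def)

lemma der_mat_index:
  assumes "M \<in> carrier_mat n n" "P \<in> carrier_mat n n" "Q \<in> carrier_mat n n"
    and "map_mat D M = P * M + M * Q" "i < n" "j < n"
  shows "D (M $$ (i, j)) = (\<Sum>c<n. P $$ (i, c) * M $$ (c, j)) + (\<Sum>c<n. M $$ (i, c) * Q $$ (c, j))"
proof -
  have "D (M $$ (i, j)) = (P * M) $$ (i, j) + (M * Q) $$ (i, j)"
    using arg_cong[OF assms(4), of "\<lambda>M. M $$ (i, j)"] assms(1-3,5,6) by simp
  then show ?thesis
    unfolding index_mult_mat_sum[OF assms(2,1,5,6)] index_mult_mat_sum[OF assms(1,3,5,6)] .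
qed

text \<open>For lower triangular \<open>P\<close> the first \<open>q\<close> rows of
  \<open>P M\<close> involve only the first \<open>q\<close> rows of \<open>M\<close>; for lower
  triangular \<open>Q\<close> the last \<open>q\<close> columns of \<open>M Q\<close> involve only
  the last \<open>q\<close> columns of \<open>M\<close>. So the corner block satisfies a two-sided
  equation with the matching diagonal blocks of \<open>P\<close> and \<open>Q\<close>.\<close>

lemma eigen_upper_right_minor:
  assumes M: "M \<in> carrier_mat n n" and P: "P \<in> carrier_mat n n" and Q: "Q \<in> carrier_mat n n"
    and MR: "\<And>i j. i < n \<Longrightarrow> j < n \<Longrightarrow> M $$ (i, j) \<in> R"
    and D: "map_mat D M = P * M + M * Q"
    and lowP: "\<And>i j. i < j \<Longrightarrow> j < n \<Longrightarrow> P $$ (i, j) = 0"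
    and lowQ: "\<And>i j. i < j \<Longrightarrow> j < n \<Longrightarrow> Q $$ (i, j) = 0"
    and q: "q \<le> n"
  shows "eigen (diag_sum 0 q P + diag_sum (n - q) q Q) (upper_right_minor M q)"
proof -
  define M' where "M' = mat q q (\<lambda>(a, b). M $$ (a, n - q + b))"
  define P' where "P' = mat q q (\<lambda>(a, b). P $$ (a, b))"
  define Q' where "Q' = mat q q (\<lambda>(a, b). Q $$ (n - q + a, n - q + b))"
  have "map_mat D M' = P' * M' + M' * Q'"
  proof (rule eq_matI)
    fix a b assume "a < dim_row (P' * M' + M' * Q')" "b < dim_col (P' * M' + M' * Q')"
    then have ab: "a < q" "b < q" by (auto simp: M'_def P'_def Q'_def)
    have "D (M $$ (a, n - q + b)) =
      (\<Sum>c<n. P $$ (a, c) * M $$ (c, n - q + b)) + (\<Sum>c<n. M $$ (a, c) * Q $$ (c, n - q + b))"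
      by (rule der_mat_index[OF M P Q D]) (use ab q in auto)
    also have "(\<Sum>c<n. P $$ (a, c) * M $$ (c, n - q + b)) = (\<Sum>c<q. P $$ (a, c) * M $$ (c, n - q + b))"
      by (rule sum.mono_neutral_right) (use ab q lowP in auto)
    also have "(\<Sum>c<n. M $$ (a, c) * Q $$ (c, n - q + b)) =
        (\<Sum>c\<in>{n - q..<n}. M $$ (a, c) * Q $$ (c, n - q + b))"
      by (rule sum.mono_neutral_right) (use ab q lowQ in auto)
    also have "\<dots> = (\<Sum>c<q. M $$ (a, n - q + c) * Q $$ (n - q + c, n - q + b))"
      by (rule sum.reindex_bij_witness[of _ "\<lambda>c. n - q + c" "\<lambda>c. c - (n - q)"]) (use q in auto)
    finally show "map_mat D M' $$ (a, b) = (P' * M' + M' * Q') $$ (a, b)"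
      using ab index_mult_mat_sum[of P' q q M' q a b] index_mult_mat_sum[of M' q q Q' q a b]
      by (simp add: M'_def P'_def Q'_def)
  qed (auto simp: M'_def P'_def Q'_def)
  then have "eigen ((\<Sum>i<q. P' $$ (i, i)) + (\<Sum>i<q. Q' $$ (i, i))) (det M')"
    by (intro eigen_det) (use q MR in \<open>auto simp: M'_def P'_def Q'_def\<close>)
  moreover have "det M' = upper_right_minor M q"
    using M by (simp add: upper_right_minor_def M'_def)
  ultimately show ?thesis by (simp add: P'_def Q'_def diag_sum_def)
qed

text \<open>Now the first \<open>q\<close> columns have to close up, which asks for an upper
  triangular \<open>Q\<close>. This is the situation for odd \<open>j\<close>, where
  \<open>S\<close> ends in an inverse.\<close>

lemma eigen_upper_left_minor:
  assumes M: "M \<in> carrier_mat n n" and P: "P \<in> carrier_mat n n" and Q: "Q \<in> carrier_mat n n"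
    and MR: "\<And>i j. i < n \<Longrightarrow> j < n \<Longrightarrow> M $$ (i, j) \<in> R"
    and D: "map_mat D M = P * M + M * Q"
    and lowP: "\<And>i j. i < j \<Longrightarrow> j < n \<Longrightarrow> P $$ (i, j) = 0"
    and upQ: "\<And>i j. j < i \<Longrightarrow> i < n \<Longrightarrow> Q $$ (i, j) = 0"
    and q: "q \<le> n"
  shows "eigen (diag_sum 0 q P + diag_sum 0 q Q) (upper_left_minor M q)"
proof -
  define M' where "M' = mat q q (\<lambda>(a, b). M $$ (a, b))"
  define P' where "P' = mat q q (\<lambda>(a, b). P $$ (a, b))"
  define Q' where "Q' = mat q q (\<lambda>(a, b). Q $$ (a, b))"
  have "map_mat D M' = P' * M' + M' * Q'"
  proof (rule eq_matI)
    fix a b assume "a < dim_row (P' * M' + M' * Q')" "b < dim_col (P' * M' + M' * Q')"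
    then have ab: "a < q" "b < q" by (auto simp: M'_def P'_def Q'_def)
    have "D (M $$ (a, b)) =
      (\<Sum>c<n. P $$ (a, c) * M $$ (c, b)) + (\<Sum>c<n. M $$ (a, c) * Q $$ (c, b))"
      by (rule der_mat_index[OF M P Q D]) (use ab q in auto)
    also have "(\<Sum>c<n. P $$ (a, c) * M $$ (c, b)) = (\<Sum>c<q. P $$ (a, c) * M $$ (c, b))"
      by (rule sum.mono_neutral_right) (use ab q lowP in auto)
    also have "(\<Sum>c<n. M $$ (a, c) * Q $$ (c, b)) = (\<Sum>c<q. M $$ (a, c) * Q $$ (c, b))"
      by (rule sum.mono_neutral_right) (use ab q upQ in auto)
    finally show "map_mat D M' $$ (a, b) = (P' * M' + M' * Q') $$ (a, b)"
      using ab index_mult_mat_sum[of P' q q M' q a b] index_mult_mat_sum[of M' q q Q' q a b]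
      by (simp add: M'_def P'_def Q'_def)
  qed (auto simp: M'_def P'_def Q'_def)
  then have "eigen ((\<Sum>i<q. P' $$ (i, i)) + (\<Sum>i<q. Q' $$ (i, i))) (det M')"
    by (intro eigen_det) (use q MR in \<open>auto simp: M'_def P'_def Q'_def\<close>)
  then show ?thesis by (simp add: P'_def Q'_def upper_left_minor_def M'_def diag_sum_def)
qed

text \<open>Differentiate \<open>B X = 1\<close> and multiply by \<open>X\<close> from the left: the
  two actions change sides and sign.\<close>

lemma der_inverse_mat:
  assumes B: "B \<in> carrier_mat n n" and X: "X \<in> carrier_mat n n"
    and P: "P \<in> carrier_mat n n" and Q: "Q \<in> carrier_mat n n"
    and BX: "B * X = 1\<^sub>m n" and XB: "X * B = 1\<^sub>m n"
    and BR: "\<And>i j. i < n \<Longrightarrow> j < n \<Longrightarrow> B $$ (i, j) \<in> R"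
    and XR: "\<And>i j. i < n \<Longrightarrow> j < n \<Longrightarrow> X $$ (i, j) \<in> R"
    and D: "map_mat D B = P * B + B * Q"
  shows "map_mat D X = - Q * X + X * - P"
proof -
  have DX: "map_mat D X \<in> carrier_mat n n" using X by simp
  have "map_mat D (B * X) = 0\<^sub>m n n"
    unfolding BX by (intro eq_matI) auto
  then have "(P * B + B * Q) * X + B * map_mat D X = 0\<^sub>m n n"
    using der_mat_mult[OF B X BR XR] D by simp
  then have "X * ((P * B + B * Q) * X + B * map_mat D X) = 0\<^sub>m n n"
    using X by simp
  also have "X * ((P * B + B * Q) * X + B * map_mat D X) =
      X * ((P * B + B * Q) * X) + X * (B * map_mat D X)"
    using X P B Q DX by (intro mult_add_distrib_mat[of _ n n _ n]) auto
  also have "X * (B * map_mat D X) = map_mat D X"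
    using XB by (simp add: assoc_mult_mat[OF X B DX, symmetric] left_mult_one_mat[OF DX])
  also have "(P * B + B * Q) * X = P * B * X + B * Q * X"
    using X P B Q by (intro add_mult_distrib_mat[of _ n n _ _ n]) auto
  also have "P * B * X = P"
    using P B X BX by simp
  also have "X * (P + B * Q * X) = X * P + X * (B * Q * X)"
    using X P B Q by (intro mult_add_distrib_mat[of _ n n _ n]) auto
  also have "X * (B * Q * X) = X * B * (Q * X)"
    by (subst assoc_mult_mat[OF B Q X], subst assoc_mult_mat[OF X B, symmetric]) (use Q X in auto)
  also have "\<dots> = Q * X"
    unfolding XB using X Q by simp
  finally have E: "X * P + Q * X + map_mat D X = 0\<^sub>m n n" .
  show ?thesis
  proof (rule eq_matI)
    fix i j assume "i < dim_row (- Q * X + X * - P)" "j < dim_col (- Q * X + X * - P)"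
    then have ij: "i < n" "j < n" using X Q P by auto
    have "(X * P) $$ (i, j) + (Q * X) $$ (i, j) + D (X $$ (i, j)) = 0"
      using arg_cong[OF E, of "\<lambda>M. M $$ (i, j)"] X P Q ij by simp
    then show "map_mat D X $$ (i, j) = (- Q * X + X * - P) $$ (i, j)"
      using X P Q ij by (simp add: algebra_simps eq_neg_iff_add_eq_0)
  qed (use X P Q in auto)
qed

lemma der_transpose:
  assumes "B \<in> carrier_mat n n" "P \<in> carrier_mat n n" "Q \<in> carrier_mat n n"
    and "map_mat D B = P * B + B * transpose_mat Q"
  shows "map_mat D (transpose_mat B) = Q * transpose_mat B + transpose_mat B * transpose_mat P"
proof -
  have "map_mat D (transpose_mat B) = transpose_mat (map_mat D B)"
    by (simp add: map_mat_transpose)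
  also have "\<dots> = transpose_mat (P * B) + transpose_mat (B * transpose_mat Q)"
    unfolding assms(4) by (rule transpose_add[of _ n n]) (use assms in auto)
  also have "transpose_mat (P * B) = transpose_mat B * transpose_mat P"
    by (rule transpose_mult[of _ n n _ n]) (use assms in auto)
  also have "transpose_mat (B * transpose_mat Q) = Q * transpose_mat B"
    by (subst transpose_mult[of _ n n _ n]) (use assms in auto)
  finally show ?thesis
    using assms by (simp add: comm_add_mat[of _ n n])
qed

text \<open>The right action on one factor is cancelled by the left action on the next one.\<close>

lemma der_mult_telescope:
  assumes S: "S \<in> carrier_mat n n" and F: "F \<in> carrier_mat n n" and U: "U \<in> carrier_mat n n"
    and T: "T \<in> carrier_mat n n" and T': "T' \<in> carrier_mat n n"
    and SR: "\<And>i j. i < n \<Longrightarrow> j < n \<Longrightarrow> S $$ (i, j) \<in> R"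
    and FR: "\<And>i j. i < n \<Longrightarrow> j < n \<Longrightarrow> F $$ (i, j) \<in> R"
    and DS: "map_mat D S = U * S + S * T" and DF: "map_mat D F = - T * F + F * T'"
  shows "map_mat D (S * F) = U * (S * F) + (S * F) * T'"
proof -
  have "map_mat D (S * F) = (U * S + S * T) * F + S * (- T * F + F * T')"
    using der_mat_mult[OF S F SR FR] DS DF by simp
  also have "(U * S + S * T) * F = U * (S * F) + S * (T * F)"
    using S F U T by (subst add_mult_distrib_mat[of _ n n _ _ n]) auto
  also have "S * (- T * F + F * T') = - (S * (T * F)) + S * F * T'"
    using S F T T' by (subst mult_add_distrib_mat[of _ n n _ n]) auto
  also have "U * (S * F) + S * (T * F) + (- (S * (T * F)) + S * F * T') = U * (S * F) + S * F * T'"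
    using S F U T T' by (intro eq_matI) (auto simp del: assoc_mult_mat)
  finally show ?thesis .
qed

end

text \<open>A transposed factor has left action \<open>W (u - 1)\<close> and right action the
  transpose of \<open>W u\<close>; an inverted factor has left action minus the transpose of
  \<open>W (u - 1)\<close> and right action \<open>- W u\<close>. Since the two kinds alternate,
  beginning with the transpose of \<open>A\<close>, each left action is minus the preceding right
  action.\<close>

lemma der_S_mat:
  assumes "subfield_der (chain_functions N j) D"
    and W: "\<And>u. W u \<in> carrier_mat N N" and U: "U \<in> carrier_mat N N"
    and DA: "map_mat D (mat_A N) = W 0 * mat_A N + mat_A N * transpose_mat U"
    and DB: "\<And>u. u \<in> {1..j} \<Longrightarrow>
      map_mat D (mat_B N u) = W u * mat_B N u + mat_B N u * transpose_mat (W (u - 1))"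
    and m: "m \<le> j"
  shows "map_mat D (S_mat N m) =
    U * S_mat N m + S_mat N m * (if odd m then - W m else transpose_mat (W m))"
  using m
proof (induction m)
  interpret subfield_der "chain_functions N j" D by fact
  case 0
  show ?case using der_transpose[OF generic_mat_carrier W U DA] by simp
next
  interpret subfield_der "chain_functions N j" D by fact
  case (Suc m)
  define u where "u = Suc m"
  define F where "F = (if odd u then the (mat_inverse (mat_B N u)) else transpose_mat (mat_B N u))"
  have u: "u \<in> {1..j}" using Suc.prems by (simp add: u_def)
  note s = chain_sites_simps(2)[OF u]
  note inv = inverse_generic_mat[of N "B_site u"]
  have F: "F \<in> carrier_mat N N" using inv by (simp add: F_def)
  have FR: "F $$ (a, b) \<in> chain_functions N j" if "a < N" "b < N" for a b
    using that inverse_generic_mat_chain_functions[OF s that] generic_mat_chain_functions[OF s that(2,1)]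
    by (simp add: F_def)
  have DF: "map_mat D F = - (if odd m then - W m else transpose_mat (W m)) * F +
      F * (if odd u then - W u else transpose_mat (W u))"
  proof (cases "odd u")
    case True
    have "map_mat D (the (mat_inverse (mat_B N u))) =
        - transpose_mat (W (u - 1)) * the (mat_inverse (mat_B N u)) +
        the (mat_inverse (mat_B N u)) * - W u"
      by (rule der_inverse_mat[OF generic_mat_carrier inv(1) W _ inv(2,3) _ _ DB[OF u]])
        (use W generic_mat_chain_functions[OF s] inverse_generic_mat_chain_functions[OF s] in auto)
    then show ?thesis using True by (simp add: F_def u_def)
  next
    case False
    then show ?thesis
      using der_transpose[OF generic_mat_carrier W W DB[OF u]] by (simp add: F_def u_def)
  qed
  have "map_mat D (S_mat N m * F) =
      U * (S_mat N m * F) + S_mat N m * F * (if odd u then - W u else transpose_mat (W u))"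
    by (rule der_mult_telescope[OF S_mat_carrier F U _ _ _ FR _ DF])
      (use W Suc S_mat_chain_functions[of m j _ N] in auto)
  moreover have "S_mat N (Suc m) = S_mat N m * F"
    by (simp add: F_def u_def)
  ultimately show ?case by (simp add: u_def)
qed

section \<open>Weights of the functions X\<close>

text \<open>The bookkeeping is separated from the brackets, because it is shared by the coordinates
  of \<open>A\<close> and those of \<open>B\<close> and \<open>C\<close>.\<close>

lemma eigen_X_even:
  assumes "subfield_der (chain_functions N j) D"
    and S: "\<And>q. q \<le> N \<Longrightarrow> subfield_der.eigen (chain_functions N j) D (wS q) (upper_right_minor (S_mat N j) q)"
    and C: "\<And>u q. u \<in> {1..j} \<Longrightarrow> q \<le> N \<Longrightarrow>
      subfield_der.eigen (chain_functions N j) D (wC u q) (upper_right_minor (mat_C N u) q)"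
    and p: "p \<le> N"
    and total: "wS p - wS (N - p) + (\<Sum>u=1..j. wC u p - wC u (N - p)) = 0"
  shows "subfield_der.eigen (chain_functions N j) D 0 (X_even N j p)"
proof -
  interpret subfield_der "chain_functions N j" D by fact
  have "eigen (wS p + (\<Sum>u=1..j. wC u p) - (wS (N - p) + (\<Sum>u=1..j. wC u (N - p)))) (X_even N j p)"
    unfolding X_even_def by (intro eigen_divide eigen_mult eigen_prod S C) (use p in auto)
  then show ?thesis using total by (simp add: sum_subtractf algebra_simps)
qed

lemma prod_odd_even:
  fixes f :: "nat \<Rightarrow> 'a::comm_monoid_mult"
  shows "(\<Prod>u=1..2 * r + 1. f u) = (\<Prod>k=1..r. f (2 * k)) * (\<Prod>k=1..r+1. f (2 * k - 1))"
  by (induction r) (simp_all add: mult_ac)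

text \<open>Every site contributes the same quotient or its inverse, depending on its parity. In
  this form the eigenvalues carry the alternating sign \<open>(- 1) ^ u\<close>.\<close>

lemma X_odd_eq_prod:
  fixes N r p
  defines "MC \<equiv> \<lambda>u. upper_right_minor (mat_C N u) p * upper_right_minor (mat_C N u) (N - p)"
    and "d \<equiv> \<lambda>u. det (mat_B N u) * det (mat_C N u)"
  shows "X_odd N r p =
    upper_left_minor (S_mat N (2 * r + 1)) p * upper_left_minor (S_mat N (2 * r + 1)) (N - p) / det (mat_A N)
    * (\<Prod>u=1..2 * r + 1. if even u then MC u / d u else d u / MC u)"
  unfolding X_odd_def Let_def prod_odd_even
  by (simp add: MC_def d_def prod_dividef mult_ac)

text \<open>The determinants of \<open>B_u\<close> and \<open>C_u\<close> enter with one common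
  eigenvalue \<open>dB u\<close>, whence the term \<open>2 * dB u\<close>.\<close>

lemma eigen_X_odd:
  assumes "subfield_der (chain_functions N j) D" and j: "j = 2 * r + 1"
    and S: "\<And>q. q \<le> N \<Longrightarrow> subfield_der.eigen (chain_functions N j) D (wS q) (upper_left_minor (S_mat N j) q)"
    and C: "\<And>u q. u \<in> {1..j} \<Longrightarrow> q \<le> N \<Longrightarrow>
      subfield_der.eigen (chain_functions N j) D (wC u q) (upper_right_minor (mat_C N u) q)"
    and dA: "subfield_der.eigen (chain_functions N j) D dA (det (mat_A N))"
    and dB: "\<And>u. u \<in> {1..j} \<Longrightarrow> subfield_der.eigen (chain_functions N j) D (dB u) (det (mat_B N u))"
    and dC: "\<And>u. u \<in> {1..j} \<Longrightarrow> subfield_der.eigen (chain_functions N j) D (dB u) (det (mat_C N u))"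
    and p: "p \<le> N"
    and total: "wS p + wS (N - p) - dA +
      (\<Sum>u=1..j. (- 1) ^ u * (wC u p + wC u (N - p) - 2 * dB u)) = 0"
  shows "subfield_der.eigen (chain_functions N j) D 0 (X_odd N r p)"
proof -
  interpret subfield_der "chain_functions N j" D by fact
  let ?MC = "\<lambda>u. upper_right_minor (mat_C N u) p * upper_right_minor (mat_C N u) (N - p)"
  let ?d = "\<lambda>u. det (mat_B N u) * det (mat_C N u)"
  have "eigen ((- 1) ^ u * (wC u p + wC u (N - p) - 2 * dB u)) (if even u then ?MC u / ?d u else ?d u / ?MC u)"
    if u: "u \<in> {1..j}" for u
  proof (cases "even u")
    case True
    have "eigen (wC u p + wC u (N - p) - (dB u + dB u)) (?MC u / ?d u)"
      by (intro eigen_divide eigen_mult C dB dC u) (use p in auto)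
    then show ?thesis using True by (simp add: algebra_simps)
  next
    case False
    have "eigen (dB u + dB u - (wC u p + wC u (N - p))) (?d u / ?MC u)"
      by (intro eigen_divide eigen_mult C dB dC u) (use p in auto)
    then show ?thesis using False by (simp add: algebra_simps)
  qed
  then have "eigen (wS p + wS (N - p) - dA + (\<Sum>u=1..j. (- 1) ^ u * (wC u p + wC u (N - p) - 2 * dB u)))
      (X_odd N r p)"
    unfolding X_odd_eq_prod j[symmetric] by (intro eigen_mult eigen_divide eigen_prod S dA) (use p in auto)
  then show ?thesis unfolding total .
qed

section \<open>The action of a coordinate\<close>

text \<open>The rank one matrix with the vector \<open>u\<close> in column \<open>p\<close>. Acting
  from the left it adds multiples of row \<open>p\<close> only, which is the shape of a bracket with
  a single coordinate; all actions below are sums of such matrices and, on the right, of their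
  transposes.\<close>

definition col_mat :: "nat \<Rightarrow> nat \<Rightarrow> (nat \<Rightarrow> 'a) \<Rightarrow> 'a::zero mat"
  where "col_mat n p u = mat n n (\<lambda>(i, m). if m = p then u i else 0)"

lemma col_mat_carrier [simp]: "col_mat n p u \<in> carrier_mat n n"
  and col_mat_dim [simp]: "dim_row (col_mat n p u) = n" "dim_col (col_mat n p u) = n"
  and col_mat_index [simp]: "i < n \<Longrightarrow> m < n \<Longrightarrow> col_mat n p u $$ (i, m) = (if m = p then u i else 0)"
  by (simp_all add: col_mat_def)

lemma col_mat_mult_index:
  fixes X :: "'a::comm_ring_1 mat"
  assumes "X \<in> carrier_mat n n" "p < n" "i < n" "m < n"
  shows "(col_mat n p u * X) $$ (i, m) = u i * X $$ (p, m)"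
proof -
  have "(col_mat n p u * X) $$ (i, m) = (\<Sum>c<n. col_mat n p u $$ (i, c) * X $$ (c, m))"
    by (rule index_mult_mat_sum) (use assms in auto)
  also have "\<dots> = (\<Sum>c<n. if c = p then u i * X $$ (p, m) else 0)"
    using assms by (intro sum.cong) auto
  finally show ?thesis using assms by simp
qed

lemma mult_col_mat_transpose_index:
  fixes X :: "'a::comm_ring_1 mat"
  assumes "X \<in> carrier_mat n n" "p < n" "i < n" "m < n"
  shows "(X * transpose_mat (col_mat n p u)) $$ (i, m) = X $$ (i, p) * u m"
proof -
  have "(X * transpose_mat (col_mat n p u)) $$ (i, m) =
      (\<Sum>c<n. X $$ (i, c) * transpose_mat (col_mat n p u) $$ (c, m))"
    by (rule index_mult_mat_sum) (use assms in auto)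
  also have "\<dots> = (\<Sum>c<n. if c = p then X $$ (i, p) * u m else 0)"
    using assms by (intro sum.cong) auto
  finally show ?thesis using assms by simp
qed

lemma diag_sum_col_mat:
  assumes "p < n" "m + q \<le> n"
  shows "diag_sum m q (col_mat n p u) = (if m \<le> p \<and> p < m + q then u p else (0::'a::comm_ring_1))"
proof -
  have "diag_sum m q (col_mat n p u) = (\<Sum>i<q. if i = p - m then if m \<le> p then u p else 0 else 0)"
    unfolding diag_sum_def using assms by (intro sum.cong) auto
  then show ?thesis by auto
qed

lemma eq_two_sided:
  assumes "M \<in> carrier_mat n n" "P \<in> carrier_mat n n" "Q \<in> carrier_mat n n"
    and "\<And>i m. i < n \<Longrightarrow> m < n \<Longrightarrow> f (M $$ (i, m)) = (P * M) $$ (i, m) + (M * Q) $$ (i, m)"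
  shows "map_mat f M = P * M + M * Q"
  using assms by (intro eq_matI) auto

lemma upper_right_minor_full: "M \<in> carrier_mat n n \<Longrightarrow> upper_right_minor M n = det M"
  unfolding upper_right_minor_def by (intro arg_cong[of _ _ det] eq_matI) auto

text \<open>A coordinate of site \<open>t\<close> affects only the site itself and its two
  neighbours, and the three eigenvalues cancel. At an end of the chain a boundary term stands in for
  the missing neighbour; it will come from \<open>S\<close> and \<open>det A\<close>.\<close>

lemma sum_neighbours:
  fixes t j :: nat
  assumes "t \<in> {1..j}"
  shows "(\<Sum>u=1..j. if u = t then - (a + b) else if u = t + 1 then b else if u + 1 = t then a else 0)
    + (if t = 1 then a else 0) + (if t = j then b else 0) = (0::'a::ab_group_add)"
proof -
  have "(\<Sum>u=1..j. if u = t then - (a + b) else if u = t + 1 then b else if u + 1 = t then a else 0) =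
    (\<Sum>u=1..j. (if u = t then - (a + b) else 0) + (if u = t + 1 then b else 0) + (if u = t - 1 then a else 0))"
    by (intro sum.cong) auto
  also have "\<dots> = - (a + b) + (if t = j then 0 else b) + (if t = 1 then 0 else a)"
    using assms by (auto simp: sum.distrib)
  finally show ?thesis by auto
qed

locale type_ii_bracket =
  fixes N j :: nat and br :: "ratfun \<Rightarrow> ratfun \<Rightarrow> ratfun"
  assumes poisson: "poisson_bracket_on (chain_functions N j) br"
    and relations: "type_ii_relations N j br"
begin

abbreviation crd :: "site \<Rightarrow> nat \<Rightarrow> nat \<Rightarrow> ratfun"
  where "crd s a b \<equiv> coord (Entry s a b)"

lemma bracket_der:
  assumes "v \<in> chain_entries N j"
  shows "subfield_der (chain_functions N j) (\<lambda>f. br f (coord v))"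
proof -
  interpret subring_of "chain_functions N j" by (rule subring_chain_functions)
  show ?thesis
  proof
    fix x y assume "x \<in> chain_functions N j" "y \<in> chain_functions N j"
    then show "br (x + y) (coord v) = br x (coord v) + br y (coord v)"
      "br (x * y) (coord v) = x * br y (coord v) + br x (coord v) * y"
      using poisson coord_chain_functions[OF assms] unfolding poisson_bracket_on_def by blast+
  qed (rule inverse_chain_functions)
qed

lemma bracket_skew:
  assumes "s \<in> chain_sites j" "s' \<in> chain_sites j" "a < N" "b < N" "c < N" "d < N"
  shows "br (crd s a b) (crd s' c d) = - br (crd s' c d) (crd s a b)"
proof -
  have "crd s a b \<in> chain_functions N j" "crd s' c d \<in> chain_functions N j"
    using assms by (auto intro!: coord_chain_functions simp: chain_entries_def)
  then show ?thesis using poisson unfolding poisson_bracket_on_def by blast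
qed

end

locale chain_entry = type_ii_bracket +
  fixes s :: site and k l :: nat
  assumes s: "s \<in> chain_sites j" and k: "k < N" and l: "l < N"
begin

abbreviation D :: "ratfun \<Rightarrow> ratfun" where "D \<equiv> \<lambda>f. br f (crd s k l)"

sublocale subfield_der "chain_functions N j" D
  using s k l by (intro bracket_der) (auto simp: chain_entries_def)

definition y :: ratfun where "y = crd s k l"
text \<open>Indices are 0-based, so \<open>a q\<close> indicates that \<open>k\<close> is among the
  first \<open>q\<close> indices, and \<open>1 - a (N - q)\<close> that it is among the last
  \<open>q\<close>; likewise \<open>b\<close> for \<open>l\<close>. All eigenvalues below are
  combinations of such indicators times \<open>y\<close>.\<close>

definition a :: "nat \<Rightarrow> ratfun" where "a q = (if k < q then 1 else 0)"
definition b :: "nat \<Rightarrow> ratfun" where "b q = (if l < q then 1 else 0)"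

lemma a_b_simps [simp]: "a N = 1" "b N = 1" "a 0 = 0" "b 0 = 0"
  using k l by (simp_all add: a_def b_def)

end

subsection \<open>Coordinates of B and C\<close>

locale BC_entry = chain_entry N j br "Y t" k l for N j br Y and t :: nat and k l +
  assumes Y: "Y \<in> {B_site, C_site}" and t: "t \<in> {1..j}"
begin

text \<open>
  \<open>D B\<^sub>u = W\<^sub>u B\<^sub>u + B\<^sub>u W\<^sub>u\<^sub>-\<^sub>1\<^sup>T\<close> holds for all \<open>u\<close>, whether the coordinate belongs to \<open>B\<^sub>t\<close> or to \<open>C\<^sub>t\<close>;
  this is the form that telescopes in \<open>S\<close>. For \<open>u = t\<close> it is an upper triangular action, while
  the upper right minors of \<open>C\<^sub>t\<close> need the lower triangular action by \<open>L\<close> and \<open>R'\<close>. The two agree on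
  the matrix that contains the coordinate, since \<open>half_step i k + half_step k i = 2\<close>.
\<close>

definition W :: "nat \<Rightarrow> ratfun mat"
  where "W u = (if u = t then col_mat N k (\<lambda>i. - (half_step k i * crd (Y t) i l))
    else if u + 1 = t then col_mat N l (\<lambda>i. half_step i l * crd (Y t) k i) else 0\<^sub>m N N)"

lemma W_carrier [simp]: "W u \<in> carrier_mat N N"
  by (simp add: W_def)

lemma W_simps:
  "W t = col_mat N k (\<lambda>i. - (half_step k i * crd (Y t) i l))"
  "u + 1 = t \<Longrightarrow> W u = col_mat N l (\<lambda>i. half_step i l * crd (Y t) k i)"
  "u \<noteq> t \<Longrightarrow> u + 1 \<noteq> t \<Longrightarrow> W u = 0\<^sub>m N N"
  by (auto simp: W_def)

lemma W_t_upper: "m < i \<Longrightarrow> i < N \<Longrightarrow> W t $$ (i, m) = 0"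
  by (auto simp: W_simps half_step_less)

lemma W_lower: "u \<noteq> t \<Longrightarrow> i < m \<Longrightarrow> m < N \<Longrightarrow> W u $$ (i, m) = 0"
  by (auto simp: W_def half_step_less)

lemma diag_sum_W:
  assumes "m + q \<le> N"
  shows "diag_sum m q (W u) =
    (if u = t then - y * (a (m + q) - a m) else if u + 1 = t then y * (b (m + q) - b m) else 0)"
  using assms k l by (auto simp: W_def diag_sum_col_mat diag_sum_0 a_def b_def y_def)

lemmas index_simps = col_mat_mult_index[OF generic_mat_carrier] mult_col_mat_transpose_index[OF generic_mat_carrier]

text \<open>Of the coordinates of \<open>B\<close> and \<open>C\<close> only those with
  \<open>t = 1\<close> reach \<open>A\<close>, and they act by a congruence. So the same
  \<open>W 0\<close> serves the functions \<open>Y_p\<close> and the left end of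
  \<open>S\<close>.\<close>

lemma D_A: "map_mat D (mat_A N) = W 0 * mat_A N + mat_A N * transpose_mat (W 0)"
proof (rule eq_two_sided)
  fix i m assume im: "i < N" "m < N"
  have skew: "D (crd A_site i m) = - br (crd (Y t) k l) (crd A_site i m)"
    by (rule bracket_skew) (use s im k l in \<open>auto simp: chain_sites_def\<close>)
  show "D (mat_A N $$ (i, m)) = (W 0 * mat_A N) $$ (i, m) + (mat_A N * transpose_mat (W 0)) $$ (i, m)"
  proof (cases "t = 1")
    case True
    have "br (crd (Y t) k l) (crd A_site i m) =
        - (half_step i l * crd (Y t) k i * crd A_site l m) - half_step m l * crd (Y t) k m * crd A_site i l"
      using bracket_1_A[OF relations k l im, of Y] t Y True by simp
    moreover have "W 0 = col_mat N l (\<lambda>i. half_step i l * crd (Y t) k i)"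
      unfolding W_def using True by simp
    ultimately show ?thesis
      using im k l skew by (simp add: index_simps del: index_mult_mat)
  next
    case False
    have "br (crd (Y t) k l) (crd A_site i m) = 0"
      by (rule bracket_far_A[OF relations k l im]) (use t Y False in auto)
    moreover have "W 0 = 0\<^sub>m N N" using t False by (simp add: W_def)
    ultimately show ?thesis using im skew by simp
  qed
qed simp_all

text \<open>For \<open>u = t\<close> there are two forms with opposite directions of the steps. The
  fourth claim is read off the relations. The fifth follows by skew-symmetry for \<open>B_t\<close>
  against a coordinate of \<open>C_t\<close>, and by trading the surplus between the two terms when
  both matrices coincide.\<close>

lemma bracket_BC_cases:
  assumes Z: "Z \<in> {B_site, C_site}" and u: "u \<in> {1..j}" and im: "i < N" "m < N"
  shows "u = t + 1 \<Longrightarrow> D (crd (Z u) i m) = - (half_step k m * crd (Z u) i k * crd (Y t) m l)"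
    and "u + 1 = t \<Longrightarrow> D (crd (Z u) i m) = half_step i l * crd (Y t) k i * crd (Z u) l m"
    and "u \<noteq> t \<Longrightarrow> u \<noteq> t + 1 \<Longrightarrow> u + 1 \<noteq> t \<Longrightarrow> D (crd (Z u) i m) = 0"
    and "u = t \<Longrightarrow> (Z, Y) \<in> {(B_site, B_site), (C_site, C_site), (C_site, B_site)} \<Longrightarrow>
      D (crd (Z u) i m) = half_step i k * crd (Y t) i l * crd (Z u) k m - half_step l m * crd (Z u) i l * crd (Y t) k m"
    and "u = t \<Longrightarrow> Z = B_site \<or> Y = C_site \<Longrightarrow>
      D (crd (Z u) i m) = half_step m l * crd (Z u) i l * crd (Y t) k m - half_step k i * crd (Y t) i l * crd (Z u) k m"
proof -
  have skew: "D (crd (Z u) i m) = - br (crd (Y t) k l) (crd (Z u) i m)"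
    by (rule bracket_skew) (use s im k l u Z in \<open>auto simp: chain_sites_def\<close>)
  show "D (crd (Z u) i m) = - (half_step k m * crd (Z u) i k * crd (Y t) m l)" if "u = t + 1"
    using bracket_next[OF relations im k l, of t Z Y] t u Z Y that by simp
  show "D (crd (Z u) i m) = half_step i l * crd (Y t) k i * crd (Z u) l m" if "u + 1 = t"
    using bracket_next[OF relations k l im, of u Y Z] t u Z Y skew that[symmetric] by simp
  show "D (crd (Z u) i m) = 0" if "u \<noteq> t" "u \<noteq> t + 1" "u + 1 \<noteq> t"
  proof (cases "t < u")
    case True
    then show ?thesis
      using bracket_far[OF relations im k l u t _ Z Y] that by simp
  next
    case False
    then show ?thesis
      using bracket_far[OF relations k l im t u _ Y Z] that skew by simp
  qed
  have first: "D (crd (Z u) i m) = half_step i k * crd (Y t) i l * crd (Z u) k m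
      - half_step l m * crd (Z u) i l * crd (Y t) k m"
    if "u = t" "(Z, Y) \<in> {(B_site, B_site), (C_site, C_site), (C_site, B_site)}"
    using bracket_same[OF relations im k l t that(2)] that(1) by (simp add: mult_ac)
  then show "u = t \<Longrightarrow> (Z, Y) \<in> {(B_site, B_site), (C_site, C_site), (C_site, B_site)} \<Longrightarrow>
      D (crd (Z u) i m) = half_step i k * crd (Y t) i l * crd (Z u) k m - half_step l m * crd (Z u) i l * crd (Y t) k m" .
  assume "u = t" and ZY: "Z = B_site \<or> Y = C_site"
  show "D (crd (Z u) i m) = half_step m l * crd (Z u) i l * crd (Y t) k m - half_step k i * crd (Y t) i l * crd (Z u) k m"
  proof (cases "Z = Y")
    case True
    have hs: "half_step i k = 2 - half_step k i" "half_step l m = 2 - half_step m l"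
      using half_step_add_swap[of i k] half_step_add_swap[of l m] by (simp_all add: eq_diff_eq)
    show ?thesis
      using first[OF \<open>u = t\<close>] True Z \<open>u = t\<close> unfolding hs by (auto simp: algebra_simps)
  next
    case False
    with ZY Z Y have "(Y, Z) = (C_site, B_site)" by auto
    then show ?thesis
      using bracket_same[OF relations k l im t, of Y Z] skew \<open>u = t\<close> by (simp add: algebra_simps)
  qed
qed

text \<open>The case left out is \<open>C_t\<close> under a coordinate of \<open>B_t\<close>, where
  the relations give the lower triangular form and the trade is impossible.\<close>

lemma D_BC:
  assumes Z: "Z \<in> {B_site, C_site}" and u: "u \<in> {1..j}" and cases: "u \<noteq> t \<or> Z = B_site \<or> Y = C_site"
  shows "map_mat D (generic_mat N (Z u)) =
    W u * generic_mat N (Z u) + generic_mat N (Z u) * transpose_mat (W (u - 1))"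
proof (rule eq_two_sided)
  fix i m assume im: "i < N" "m < N"
  note br = bracket_BC_cases[OF Z u im]
  consider "u = t" | "u = t + 1" | "u + 1 = t" | "u \<noteq> t" "u \<noteq> t + 1" "u + 1 \<noteq> t" by blast
  then show "D (generic_mat N (Z u) $$ (i, m)) = (W u * generic_mat N (Z u)) $$ (i, m)
      + (generic_mat N (Z u) * transpose_mat (W (u - 1))) $$ (i, m)"
  proof cases
    case 1
    then have "W u = col_mat N k (\<lambda>i. - (half_step k i * crd (Y t) i l))"
      "W (u - 1) = col_mat N l (\<lambda>i. half_step i l * crd (Y t) k i)"
      using u by (auto simp: W_def)
    then show ?thesis
      using br(5)[OF 1] cases 1 im k l by (simp add: index_simps del: index_mult_mat)
  next
    case 2
    then have "W u = 0\<^sub>m N N" "W (u - 1) = col_mat N k (\<lambda>i. - (half_step k i * crd (Y t) i l))"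
      using u by (auto simp: W_def)
    then show ?thesis
      using br(1)[OF 2] im k l by (simp add: index_simps left_mult_zero_mat[of _ N N] del: index_mult_mat)
  next
    case 3
    then have "W u = col_mat N l (\<lambda>i. half_step i l * crd (Y t) k i)" "W (u - 1) = 0\<^sub>m N N"
      using u by (auto simp: W_def)
    then show ?thesis
      using br(2)[OF 3] im k l by (simp add: index_simps right_mult_zero_mat[of _ N N] del: index_mult_mat)
  next
    case 4
    then have "W u = 0\<^sub>m N N" "W (u - 1) = 0\<^sub>m N N"
      using u by (auto simp: W_def)
    then show ?thesis
      using br(3)[OF 4] im by simp
  qed
qed simp_all

definition L :: "ratfun mat" where "L = col_mat N k (\<lambda>i. half_step i k * crd (Y t) i l)"
definition R' :: "ratfun mat" where "R' = transpose_mat (col_mat N l (\<lambda>i. - (half_step l i * crd (Y t) k i)))"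

lemma L_R'_carrier [simp]: "L \<in> carrier_mat N N" "R' \<in> carrier_mat N N"
  by (simp_all add: L_def R'_def)

lemma D_BC_same:
  assumes Z: "(Z, Y) \<in> {(B_site, B_site), (C_site, C_site), (C_site, B_site)}"
  shows "map_mat D (generic_mat N (Z t)) = L * generic_mat N (Z t) + generic_mat N (Z t) * R'"
proof (rule eq_two_sided)
  fix i m assume im: "i < N" "m < N"
  have "Z \<in> {B_site, C_site}" using Z by auto
  from bracket_BC_cases(4)[OF this t im refl Z]
  show "D (generic_mat N (Z t) $$ (i, m)) = (L * generic_mat N (Z t)) $$ (i, m)
      + (generic_mat N (Z t) * R') $$ (i, m)"
    using im k l by (simp add: L_def R'_def index_simps del: index_mult_mat)
qed (simp_all add: L_def R'_def)

lemma diag_sum_L_R':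
  assumes "m + q \<le> N"
  shows "diag_sum m q L = y * (a (m + q) - a m)" "diag_sum m q R' = - y * (b (m + q) - b m)"
  using assms k l
  by (auto simp: L_def R'_def diag_sum_transpose[of _ N] diag_sum_col_mat a_def b_def y_def)

text \<open>The case \<open>u = t\<close> comes from the lower triangular action by \<open>L\<close>
  and \<open>R'\<close>, the two neighbouring cases from \<open>W\<close>.\<close>

definition wC :: "nat \<Rightarrow> nat \<Rightarrow> ratfun"
  where "wC u q = (if u = t then y * (a q - 1 + b (N - q)) else if u = t + 1 then - y * (1 - a (N - q))
    else if u + 1 = t then y * b q else 0)"

lemma eigen_C:
  assumes u: "u \<in> {1..j}" and q: "q \<le> N"
  shows "eigen (wC u q) (upper_right_minor (mat_C N u) q)"
proof (cases "u = t")
  case True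
  have "eigen (diag_sum 0 q L + diag_sum (N - q) q R') (upper_right_minor (mat_C N t) q)"
    by (rule eigen_upper_right_minor[OF generic_mat_carrier _ _ _ D_BC_same _ _ q])
      (use t Y generic_mat_chain_functions[OF chain_sites_simps(3)[OF t]]
        in \<open>auto simp: L_def R'_def half_step_less\<close>)
  moreover have "diag_sum 0 q L + diag_sum (N - q) q R' = wC t q"
    using q by (simp add: diag_sum_L_R' wC_def algebra_simps)
  ultimately show ?thesis unfolding True by simp
next
  case False
  have "transpose_mat (W (u - 1)) $$ (i, m) = 0" if "i < m" "m < N" for i m
    using that False u W_t_upper[of i m] carrier_matD[OF W_carrier, of "u - 1"]
    by (cases "u - 1 = t") (auto simp: W_simps)
  then have "eigen (diag_sum 0 q (W u) + diag_sum (N - q) q (transpose_mat (W (u - 1))))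
      (upper_right_minor (mat_C N u) q)"
    by (intro eigen_upper_right_minor[OF generic_mat_carrier _ _ _ D_BC _ _ q])
      (use False u W_lower generic_mat_chain_functions[OF chain_sites_simps(3)[OF u]] in auto)
  moreover have "diag_sum 0 q (W u) + diag_sum (N - q) q (transpose_mat (W (u - 1))) = wC u q"
    using False u q by (auto simp: diag_sum_transpose[OF W_carrier] diag_sum_W wC_def)
  ultimately show ?thesis by simp
qed

definition dB :: "nat \<Rightarrow> ratfun"
  where "dB u = (if u = t + 1 then - y else if u + 1 = t then y else 0)"

lemma eigen_det_C:
  assumes "u \<in> {1..j}"
  shows "eigen (dB u) (det (mat_C N u))"
proof -
  have "wC u N = dB u" by (simp add: wC_def dB_def)
  then show ?thesis
    using eigen_C[OF assms order_refl] by (simp add: upper_right_minor_full[OF generic_mat_carrier])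
qed

lemma eigen_det_B:
  assumes u: "u \<in> {1..j}"
  shows "eigen (dB u) (det (mat_B N u))"
proof -
  have "eigen (diag_sum 0 N (W u) + diag_sum 0 N (transpose_mat (W (u - 1)))) (det (mat_B N u))"
    by (intro eigen_det_diag_sum[OF generic_mat_carrier _ _ _ D_BC])
      (use u generic_mat_chain_functions[OF chain_sites_simps(2)[OF u]] in auto)
  moreover have "diag_sum 0 N (W u) + diag_sum 0 N (transpose_mat (W (u - 1))) = dB u"
    using u by (auto simp: diag_sum_transpose[OF W_carrier] diag_sum_W dB_def)
  ultimately show ?thesis by simp
qed

text \<open>At the site \<open>t\<close>, a coordinate of \<open>B_t\<close> acts on both matrices
  in the lower triangular form and a coordinate of \<open>C_t\<close> in the upper triangular form.
  Either way \<open>B_t\<close> and \<open>C_t\<close> share \<open>P\<close> and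
  \<open>Q\<close>.\<close>

lemma D_pencil:
  assumes u: "u \<in> {1..j}"
  obtains P Q where "P \<in> carrier_mat N N" "Q \<in> carrier_mat N N"
    "map_mat D (mat_B N u) = P * mat_B N u + mat_B N u * Q"
    "map_mat D (mat_C N u) = P * mat_C N u + mat_C N u * Q"
proof (cases "u = t \<and> Y = B_site")
  case True
  have "map_mat D (mat_B N t) = L * mat_B N t + mat_B N t * R'"
    by (rule D_BC_same) (use True in simp)
  moreover have "map_mat D (mat_C N t) = L * mat_C N t + mat_C N t * R'"
    by (rule D_BC_same) (use True in simp)
  moreover have "u = t" using True by simp
  ultimately show ?thesis using that[OF L_R'_carrier] by blast
next
  case False
  have "map_mat D (mat_B N u) = W u * mat_B N u + mat_B N u * transpose_mat (W (u - 1))"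
    by (rule D_BC) (use u in auto)
  moreover have "map_mat D (mat_C N u) = W u * mat_C N u + mat_C N u * transpose_mat (W (u - 1))"
    by (rule D_BC) (use u False Y in auto)
  ultimately show ?thesis
    using that[of "W u" "transpose_mat (W (u - 1))"] by simp
qed

lemma D_S: "m \<le> j \<Longrightarrow> map_mat D (S_mat N m) =
    W 0 * S_mat N m + S_mat N m * (if odd m then - W m else transpose_mat (W m))"
  using D_BC[of B_site] by (intro der_S_mat[where W = W and U = "W 0", OF subfield_der_axioms _ _ D_A]) auto

definition wS :: "nat \<Rightarrow> ratfun"
  where "wS q = (if t = 1 then y * b q else 0) +
    (if t = j then if even j then - y * (1 - a (N - q)) else y * a q else 0)"

text \<open>The right end of \<open>S\<close> is affected only for \<open>t = j\<close>, where
  \<open>W j\<close> is upper triangular. A final transposed factor makes this lower triangular, as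
  upper right minors demand; a final inverse keeps it upper triangular, as upper left minors demand.
  This explains the change of minors with the parity of \<open>j\<close>.\<close>

lemma eigen_S_even:
  assumes "even j" and q: "q \<le> N"
  shows "eigen (wS q) (upper_right_minor (S_mat N j) q)"
proof -
  have DS: "map_mat D (S_mat N j) = W 0 * S_mat N j + S_mat N j * transpose_mat (W j)"
    using D_S[of j] assms by simp
  have "transpose_mat (W j) $$ (i, m) = 0" if "i < m" "m < N" for i m
    using that t W_t_upper[of i m] carrier_matD[OF W_carrier, of j]
    by (cases "j = t") (auto simp: W_simps)
  then have "eigen (diag_sum 0 q (W 0) + diag_sum (N - q) q (transpose_mat (W j)))
      (upper_right_minor (S_mat N j) q)"
    by (intro eigen_upper_right_minor[OF S_mat_carrier _ _ _ DS _ _ q])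
      (use t W_lower S_mat_chain_functions in auto)
  moreover have "diag_sum 0 q (W 0) + diag_sum (N - q) q (transpose_mat (W j)) = wS q"
    using t q assms by (auto simp: diag_sum_transpose[OF W_carrier] diag_sum_W wS_def)
  ultimately show ?thesis by simp
qed

lemma eigen_S_odd:
  assumes "odd j" and q: "q \<le> N"
  shows "eigen (wS q) (upper_left_minor (S_mat N j) q)"
proof -
  have DS: "map_mat D (S_mat N j) = W 0 * S_mat N j + S_mat N j * - W j"
    using D_S[of j] assms by simp
  have "(- W j) $$ (i, m) = 0" if "m < i" "i < N" for i m
    using that t W_t_upper[of m i] carrier_matD[OF W_carrier, of j]
    by (cases "j = t") (auto simp: W_simps)
  then have "eigen (diag_sum 0 q (W 0) + diag_sum 0 q (- W j)) (upper_left_minor (S_mat N j) q)"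
    by (intro eigen_upper_left_minor[OF S_mat_carrier _ _ _ DS _ _ q])
      (use t W_lower S_mat_chain_functions in auto)
  moreover have "diag_sum 0 q (W 0) + diag_sum 0 q (- W j) = wS q"
    using t q assms by (auto simp: diag_sum_uminus[OF W_carrier] diag_sum_W wS_def)
  ultimately show ?thesis by simp
qed

lemma eigen_det_A: "eigen (if t = 1 then 2 * y else 0) (det (mat_A N))"
proof -
  have "eigen (diag_sum 0 N (W 0) + diag_sum 0 N (transpose_mat (W 0))) (det (mat_A N))"
    by (intro eigen_det_diag_sum[OF generic_mat_carrier _ _ _ D_A])
      (use generic_mat_chain_functions[OF chain_sites_simps(1)] in auto)
  moreover have "diag_sum 0 N (W 0) + diag_sum 0 N (transpose_mat (W 0)) = (if t = 1 then 2 * y else 0)"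
    using t by (auto simp: diag_sum_transpose[OF W_carrier] diag_sum_W)
  ultimately show ?thesis by simp
qed

lemma eigen_X_even':
  assumes "even j" and p: "p \<le> N"
  shows "eigen 0 (X_even N j p)"
proof (rule eigen_X_even[OF subfield_der_axioms eigen_S_even[OF assms(1)] eigen_C p])
  \<comment> \<open>\<open>A\<close> and \<open>B\<close> are the differences of the eigenvalues for
    sizes \<open>p\<close> and \<open>N - p\<close> at the left and the right neighbour of
    \<open>t\<close>.\<close>
  define A where "A = y * (b p - b (N - p))"
  define B where "B = y * (a (N - p) - a p)"
  have "(\<Sum>u=1..j. wC u p - wC u (N - p)) =
      (\<Sum>u=1..j. if u = t then - (A + B) else if u = t + 1 then B else if u + 1 = t then A else 0)"
    using p by (intro sum.cong) (auto simp: wC_def A_def B_def algebra_simps)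
  moreover have "wS p - wS (N - p) = (if t = 1 then A else 0) + (if t = j then B else 0)"
    using p assms by (auto simp: wS_def A_def B_def algebra_simps)
  ultimately show "wS p - wS (N - p) + (\<Sum>u=1..j. wC u p - wC u (N - p)) = 0"
    using sum_neighbours[OF t, of A B] by (simp add: algebra_simps)
qed

lemma eigen_X_odd':
  assumes j: "j = 2 * r + 1" and p: "p \<le> N"
  shows "eigen 0 (X_odd N r p)"
proof (rule eigen_X_odd[OF subfield_der_axioms j eigen_S_odd eigen_C eigen_det_A eigen_det_B eigen_det_C p])
  have "odd j" using j by simp
  \<comment> \<open>The sign is that of the neighbours of \<open>t\<close>. The \<open>- 2\<close>
    stems from \<open>2 * dB u\<close> at the left neighbour, or from \<open>det A\<close> if
    \<open>t = 1\<close>; at the right neighbour the determinants cancel the constants.\<close>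
  define A where "A = (- 1) ^ (t + 1) * (y * (b p + b (N - p) - 2))"
  define B where "B = (- 1) ^ (t + 1) * (y * (a p + a (N - p)))"
  have "(\<Sum>u=1..j. (- 1) ^ u * (wC u p + wC u (N - p) - 2 * dB u)) =
      (\<Sum>u=1..j. if u = t then - (A + B) else if u = t + 1 then B else if u + 1 = t then A else 0)"
    using p by (intro sum.cong) (auto simp: wC_def dB_def A_def B_def algebra_simps)
  moreover have "wS p + wS (N - p) - (if t = 1 then 2 * y else 0) =
      (if t = 1 then A else 0) + (if t = j then B else 0)"
    using \<open>odd j\<close> by (auto simp: wS_def A_def B_def algebra_simps)
  ultimately show "wS p + wS (N - p) - (if t = 1 then 2 * y else 0) +
      (\<Sum>u=1..j. (- 1) ^ u * (wC u p + wC u (N - p) - 2 * dB u)) = 0"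
    using sum_neighbours[OF t, of A B] by (simp add: algebra_simps)
qed (use j in auto)

end

subsection \<open>Coordinates of A\<close>

locale A_entry = chain_entry N j br A_site k l for N j br k l
begin

text \<open>Two descriptions of the action on \<open>A\<close> are needed. \<open>V\<close> gives a
  congruence, as the pencil demands, but mixes lower and upper triangular parts; the pair
  \<open>W 0\<close>, \<open>U\<close> is upper and lower triangular, as \<open>S\<close> demands,
  but is not a congruence. They are related by \<open>half_step_add_swap\<close>.\<close>

definition W :: "nat \<Rightarrow> ratfun mat"
  where "W u = (if u = 0 then col_mat N k (\<lambda>i. - (half_step k i * crd A_site i l))
    + col_mat N l (\<lambda>i. - (half_step l i * crd A_site k i)) else 0\<^sub>m N N)"

definition U :: "ratfun mat"
  where "U = col_mat N k (\<lambda>i. half_step i k * crd A_site i l) + col_mat N l (\<lambda>i. half_step i l * crd A_site k i)"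

definition V :: "ratfun mat"
  where "V = col_mat N k (\<lambda>i. half_step i k * crd A_site i l) + col_mat N l (\<lambda>i. - (half_step l i * crd A_site k i))"

lemma W_U_V_carrier [simp]: "W u \<in> carrier_mat N N" "U \<in> carrier_mat N N" "V \<in> carrier_mat N N"
  by (simp_all add: W_def U_def V_def)

lemma W_0_upper: "m < i \<Longrightarrow> i < N \<Longrightarrow> W 0 $$ (i, m) = 0"
  by (auto simp: W_def half_step_less)

lemma U_lower: "i < m \<Longrightarrow> m < N \<Longrightarrow> U $$ (i, m) = 0"
  by (auto simp: U_def half_step_less)

lemma diag_sum_W_U_V:
  assumes "m + q \<le> N"
  shows "diag_sum m q U = y * (a (m + q) - a m + b (m + q) - b m)"
    and "diag_sum m q (W u) = (if u = 0 then - y * (a (m + q) - a m + b (m + q) - b m) else 0)"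
    and "diag_sum m q V = y * (a (m + q) - a m - (b (m + q) - b m))"
  using assms k l
  by (auto simp: U_def W_def V_def diag_sum_add[of _ N] diag_sum_col_mat diag_sum_0 a_def b_def y_def)

lemma add_mult_index:
  fixes X :: "ratfun mat"
  assumes "X \<in> carrier_mat N N" "i < N" "m < N" "p < N" "q < N"
  shows "((col_mat N p f + col_mat N q g) * X) $$ (i, m) = f i * X $$ (p, m) + g i * X $$ (q, m)"
    and "(X * transpose_mat (col_mat N p f + col_mat N q g)) $$ (i, m) = X $$ (i, p) * f m + X $$ (i, q) * g m"
proof -
  have "(col_mat N p f + col_mat N q g) * X = col_mat N p f * X + col_mat N q g * X"
    using assms by (intro add_mult_distrib_mat[of _ N N _ _ N]) auto
  then show "((col_mat N p f + col_mat N q g) * X) $$ (i, m) = f i * X $$ (p, m) + g i * X $$ (q, m)"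
    using assms by (simp add: col_mat_mult_index[OF assms(1)] del: index_mult_mat(1))
  have "transpose_mat (col_mat N p f + col_mat N q g) = transpose_mat (col_mat N p f) + transpose_mat (col_mat N q g)"
    by (rule transpose_add) auto
  then have "X * transpose_mat (col_mat N p f + col_mat N q g) =
      X * transpose_mat (col_mat N p f) + X * transpose_mat (col_mat N q g)"
    using assms by (simp add: mult_add_distrib_mat[of _ N N _ N])
  then show "(X * transpose_mat (col_mat N p f + col_mat N q g)) $$ (i, m) = X $$ (i, p) * f m + X $$ (i, q) * g m"
    using assms by (simp add: mult_col_mat_transpose_index[OF assms(1)] del: index_mult_mat(1))
qed

lemma D_A_congruence: "map_mat D (mat_A N) = V * mat_A N + mat_A N * transpose_mat V"
proof (rule eq_two_sided)
  fix i m assume im: "i < N" "m < N"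
  show "D (mat_A N $$ (i, m)) = (V * mat_A N) $$ (i, m) + (mat_A N * transpose_mat V) $$ (i, m)"
    unfolding V_def add_mult_index[OF generic_mat_carrier im k l]
    using bracket_A_A[OF relations im k l] im k l by (simp add: mult_ac)
qed simp_all

lemma D_A: "map_mat D (mat_A N) = W 0 * mat_A N + mat_A N * transpose_mat U"
proof (rule eq_two_sided)
  fix i m assume im: "i < N" "m < N"
  have W0: "W 0 = col_mat N k (\<lambda>i. - (half_step k i * crd A_site i l))
    + col_mat N l (\<lambda>i. - (half_step l i * crd A_site k i))" by (simp add: W_def)
  \<comment> \<open>After these replacements the surplus terms, twice the product of the entries
    \<open>(i, l)\<close> and \<open>(k, m)\<close> of \<open>A\<close>, cancel.\<close>
  have hs: "half_step i k = 2 - half_step k i" "half_step l m = 2 - half_step m l"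
    using half_step_add_swap[of i k] half_step_add_swap[of l m] by (simp_all add: eq_diff_eq)
  show "D (mat_A N $$ (i, m)) = (W 0 * mat_A N) $$ (i, m) + (mat_A N * transpose_mat U) $$ (i, m)"
    unfolding W0 U_def add_mult_index[OF generic_mat_carrier im k l]
    using bracket_A_A[OF relations im k l] im k l unfolding hs by (simp add: algebra_simps)
qed simp_all

lemma D_BC:
  assumes Z: "Z \<in> {B_site, C_site}" and u: "u \<in> {1..j}"
  shows "map_mat D (generic_mat N (Z u)) =
    W u * generic_mat N (Z u) + generic_mat N (Z u) * transpose_mat (W (u - 1))"
proof (rule eq_two_sided)
  fix i m assume im: "i < N" "m < N"
  have Wu: "W u = 0\<^sub>m N N" using u by (simp add: W_def)
  show "D (generic_mat N (Z u) $$ (i, m)) = (W u * generic_mat N (Z u)) $$ (i, m)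
      + (generic_mat N (Z u) * transpose_mat (W (u - 1))) $$ (i, m)"
  proof (cases "u = 1")
    case True
    have W0: "W (u - 1) = col_mat N k (\<lambda>i. - (half_step k i * crd A_site i l))
      + col_mat N l (\<lambda>i. - (half_step l i * crd A_site k i))" using True by (simp add: W_def)
    show ?thesis
      unfolding Wu W0 add_mult_index[OF generic_mat_carrier im k l]
      using bracket_1_A[OF relations im k l _ Z] u im k l True by (simp add: mult_ac)
  next
    case False
    then have "W (u - 1) = 0\<^sub>m N N" using u by (simp add: W_def)
    then show ?thesis
      using bracket_far_A[OF relations im k l _ Z, of u] False u im by (simp add: Wu)
  qed
qed simp_all

definition wC :: "nat \<Rightarrow> nat \<Rightarrow> ratfun"
  where "wC u q = (if u = 1 then - y * ((1 - a (N - q)) + (1 - b (N - q))) else 0)"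

lemma eigen_C:
  assumes u: "u \<in> {1..j}" and q: "q \<le> N"
  shows "eigen (wC u q) (upper_right_minor (mat_C N u) q)"
proof -
  have "transpose_mat (W (u - 1)) $$ (i, m) = 0" if "i < m" "m < N" for i m
    using that u W_0_upper[of i m] carrier_matD[OF W_U_V_carrier(1), of "u - 1"]
    by (cases "u = 1") (auto simp: W_def half_step_less)
  then have "eigen (diag_sum 0 q (W u) + diag_sum (N - q) q (transpose_mat (W (u - 1))))
      (upper_right_minor (mat_C N u) q)"
    by (intro eigen_upper_right_minor[OF generic_mat_carrier _ _ _ D_BC _ _ q])
      (use u generic_mat_chain_functions[OF chain_sites_simps(3)[OF u]] in \<open>auto simp: W_def\<close>)
  moreover have "diag_sum 0 q (W u) + diag_sum (N - q) q (transpose_mat (W (u - 1))) = wC u q"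
    using u q by (auto simp: diag_sum_transpose[OF W_U_V_carrier(1)] diag_sum_W_U_V wC_def algebra_simps)
  ultimately show ?thesis by simp
qed

definition dB :: "nat \<Rightarrow> ratfun" where "dB u = (if u = 1 then - 2 * y else 0)"

lemma eigen_det_C:
  assumes "u \<in> {1..j}"
  shows "eigen (dB u) (det (mat_C N u))"
proof -
  have "wC u N = dB u" by (simp add: wC_def dB_def)
  then show ?thesis
    using eigen_C[OF assms order_refl] by (simp add: upper_right_minor_full[OF generic_mat_carrier])
qed

lemma eigen_det_B:
  assumes u: "u \<in> {1..j}"
  shows "eigen (dB u) (det (mat_B N u))"
proof -
  have "eigen (diag_sum 0 N (W u) + diag_sum 0 N (transpose_mat (W (u - 1)))) (det (mat_B N u))"
    by (intro eigen_det_diag_sum[OF generic_mat_carrier _ _ _ D_BC])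
      (use u generic_mat_chain_functions[OF chain_sites_simps(2)[OF u]] in auto)
  moreover have "diag_sum 0 N (W u) + diag_sum 0 N (transpose_mat (W (u - 1))) = dB u"
    using u by (auto simp: diag_sum_transpose[OF W_U_V_carrier(1)] diag_sum_W_U_V dB_def)
  ultimately show ?thesis by simp
qed

lemma eigen_det_A: "eigen 0 (det (mat_A N))"
proof -
  have "eigen (diag_sum 0 N V + diag_sum 0 N (transpose_mat V)) (det (mat_A N))"
    by (intro eigen_det_diag_sum[OF generic_mat_carrier _ _ _ D_A_congruence])
      (use generic_mat_chain_functions[OF chain_sites_simps(1)] in auto)
  then show ?thesis by (simp add: diag_sum_transpose[OF W_U_V_carrier(3)] diag_sum_W_U_V)
qed

lemma D_S: "m \<le> j \<Longrightarrow> map_mat D (S_mat N m) =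
    U * S_mat N m + S_mat N m * (if odd m then - W m else transpose_mat (W m))"
  using D_BC[of B_site] by (intro der_S_mat[where W = W and U = U, OF subfield_der_axioms _ _ D_A]) auto

text \<open>For \<open>j = 0\<close> the right action by \<open>W 0\<close> is still visible in
  \<open>S\<close>. For \<open>j > 0\<close> it is cancelled by the inverse of \<open>B_1\<close>,
  and \<open>C_1\<close> carries the same weight instead.\<close>

definition wS :: "nat \<Rightarrow> ratfun"
  where "wS q = y * (a q + b q) + (if j = 0 then - y * ((1 - a (N - q)) + (1 - b (N - q))) else 0)"

lemma eigen_S_even:
  assumes "even j" and q: "q \<le> N"
  shows "eigen (wS q) (upper_right_minor (S_mat N j) q)"
proof -
  have DS: "map_mat D (S_mat N j) = U * S_mat N j + S_mat N j * transpose_mat (W j)"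
    using D_S[of j] assms by simp
  have "transpose_mat (W j) $$ (i, m) = 0" if "i < m" "m < N" for i m
    using that W_0_upper[of i m] carrier_matD[OF W_U_V_carrier(1), of j]
    by (cases "j = 0") (auto simp: W_def half_step_less)
  then have "eigen (diag_sum 0 q U + diag_sum (N - q) q (transpose_mat (W j)))
      (upper_right_minor (S_mat N j) q)"
    by (intro eigen_upper_right_minor[OF S_mat_carrier _ _ _ DS _ _ q])
      (use U_lower S_mat_chain_functions in auto)
  moreover have "diag_sum 0 q U + diag_sum (N - q) q (transpose_mat (W j)) = wS q"
    using q by (auto simp: diag_sum_transpose[OF W_U_V_carrier(1)] diag_sum_W_U_V wS_def algebra_simps)
  ultimately show ?thesis by simp
qed

lemma eigen_S_odd:
  assumes "odd j" and q: "q \<le> N"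
  shows "eigen (wS q) (upper_left_minor (S_mat N j) q)"
proof -
  have j: "j \<noteq> 0" using assms by (intro notI) simp
  have DS: "map_mat D (S_mat N j) = U * S_mat N j + S_mat N j * - W j"
    using D_S[of j] assms by simp
  have "eigen (diag_sum 0 q U + diag_sum 0 q (- W j)) (upper_left_minor (S_mat N j) q)"
    by (intro eigen_upper_left_minor[OF S_mat_carrier _ _ _ DS _ _ q])
      (use j U_lower S_mat_chain_functions in \<open>auto simp: W_def\<close>)
  moreover have "diag_sum 0 q U + diag_sum 0 q (- W j) = wS q"
    using j q by (simp add: diag_sum_uminus[OF W_U_V_carrier(1)] diag_sum_W_U_V wS_def)
  ultimately show ?thesis by simp
qed

lemma eigen_X_even':
  assumes "even j" and p: "p \<le> N"
  shows "eigen 0 (X_even N j p)"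
proof (rule eigen_X_even[OF subfield_der_axioms eigen_S_even[OF assms(1)] eigen_C p])
  have *: "(\<Sum>u=1..j. wC u p - wC u (N - p)) =
      (if j = 0 then 0 else - y * (a p + b p - a (N - p) - b (N - p)))"
  proof -
    have "(\<Sum>u=1..j. wC u p - wC u (N - p)) =
        (\<Sum>u=1..j. if u = 1 then - y * (a p + b p - a (N - p) - b (N - p)) else 0)"
      using p by (intro sum.cong) (auto simp: wC_def algebra_simps)
    then show ?thesis by (auto simp: sum.delta)
  qed
  show "wS p - wS (N - p) + (\<Sum>u=1..j. wC u p - wC u (N - p)) = 0"
    unfolding * using p by (auto simp: wS_def algebra_simps)
qed

lemma eigen_X_odd':
  assumes j: "j = 2 * r + 1" and p: "p \<le> N"
  shows "eigen 0 (X_odd N r p)"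
proof (rule eigen_X_odd[OF subfield_der_axioms j eigen_S_odd eigen_C eigen_det_A eigen_det_B eigen_det_C p])
  have "(\<Sum>u=1..j. (- 1) ^ u * (wC u p + wC u (N - p) - 2 * dB u)) =
      (\<Sum>u=1..j. if u = 1 then - y * (a p + b p + a (N - p) + b (N - p)) else 0)"
    using p by (intro sum.cong) (auto simp: wC_def dB_def algebra_simps)
  also have "\<dots> = - y * (a p + b p + a (N - p) + b (N - p))"
    using j by (simp add: sum.delta)
  finally have sum: "(\<Sum>u=1..j. (- 1) ^ u * (wC u p + wC u (N - p) - 2 * dB u)) =
      - y * (a p + b p + a (N - p) + b (N - p))" .
  have "j \<noteq> 0" using j by simp
  then show "wS p + wS (N - p) - 0 +
      (\<Sum>u=1..j. (- 1) ^ u * (wC u p + wC u (N - p) - 2 * dB u)) = 0"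
    unfolding sum by (simp add: wS_def algebra_simps)
qed (use j in auto)

end

section \<open>The expansions of the pencils\<close>

lemma poly_eq_sum_atMost:
  fixes p :: "'a::comm_ring_1 poly"
  assumes "degree p \<le> n"
  shows "poly p z = (\<Sum>m\<le>n. coeff p m * z ^ m)"
  unfolding poly_altdef by (rule sum.mono_neutral_left) (use assms in \<open>auto simp: coeff_eq_0\<close>)

definition A_coeff :: "nat \<Rightarrow> nat \<Rightarrow> ratfun"
  where "A_coeff N m = coeff (pencil_det (transpose_mat (mat_A N)) (mat_A N)) m / det (mat_A N)"

lemma A_coeff_palindromic: "m \<le> N \<Longrightarrow> A_coeff N m = A_coeff N (N - m)"
  unfolding A_coeff_def
  using coeff_pencil_det_palindromic[OF infinite_ratfun generic_mat_carrier] by metis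

lemma A_coeff_0: "A_coeff N 0 = 1"
  unfolding A_coeff_def using det_generic_mat_nonzero[of N A_site]
  by (subst coeff_0_pencil_det[of _ N]) (auto simp: det_transpose[of _ N])

lemma A_coeff_N: "A_coeff N N = 1"
  using A_coeff_palindromic[of N N] A_coeff_0 by simp

text \<open>Taking one factor \<open>1/\<lambda>\<close> out of every row leaves a polynomial pencil
  at the square of \<open>\<lambda>\<close>, so its coefficient of degree \<open>m\<close> sits at
  exponent \<open>2 m - N\<close>.\<close>

lemma pencil_A_eq_sum:
  "pencil_A N = (\<Sum>m\<le>N. fls_const (A_coeff N m) * fls_X_intpow (2 * int m - int N))"
proof -
  let ?A = "mat_A N" and ?q = "pencil_det (transpose_mat (mat_A N)) (mat_A N)"
  have hom: "comm_ring_hom (fls_const :: ratfun \<Rightarrow> ratfun fls)"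
    by unfold_locales (auto simp: fls_plus_const)
  have X: "fls_X_inv * (fls_X * (fls_X * x)) = fls_X * x" for x :: "ratfun fls"
  proof -
    have "fls_X_inv * fls_X = (1 :: ratfun fls)" by (simp flip: fls_inverse_X)
    then show ?thesis by (simp flip: mult.assoc)
  qed
  have "fls_X \<cdot>\<^sub>m map_mat fls_const ?A + fls_X_inv \<cdot>\<^sub>m map_mat fls_const (transpose_mat ?A) =
      fls_X_inv \<cdot>\<^sub>m (map_mat fls_const (transpose_mat ?A) + fls_X ^ 2 \<cdot>\<^sub>m map_mat fls_const ?A)"
    by (intro eq_matI) (auto simp: X power2_eq_square distrib_left mult.assoc)
  then have "det (fls_X \<cdot>\<^sub>m map_mat fls_const ?A + fls_X_inv \<cdot>\<^sub>m map_mat fls_const (transpose_mat ?A)) =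
      fls_X_inv ^ N * poly (map_poly fls_const ?q) (fls_X ^ 2)"
    by (simp add: poly_map_poly_pencil_det[OF hom, of _ N])
  also have "poly (map_poly fls_const ?q) (fls_X ^ 2) =
      (\<Sum>m\<le>N. fls_const (coeff ?q m) * (fls_X ^ 2) ^ m)"
    by (subst poly_eq_sum_atMost[of _ N])
      (auto intro!: order_trans[OF degree_map_poly_le] degree_pencil_det simp: coeff_map_poly)
  also have "fls_X_inv ^ N * \<dots> = (\<Sum>m\<le>N. fls_const (coeff ?q m) * fls_X_intpow (2 * int m - int N))"
  proof -
    have key: "fls_X_inv ^ N * (fls_const c * (fls_X ^ 2) ^ m) = fls_const c * fls_X_intpow (2 * int m - int N)"
      for c :: ratfun and m
    proof -
      have "fls_X_inv ^ N * (fls_X ^ 2) ^ m = (fls_X_intpow (2 * int m - int N) :: ratfun fls)"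
        by (simp add: fls_X_inv_power_times_conv_shift fls_X_power_conv_shift_1 fls_X_intpow_power mult.commute)
      then show ?thesis by (simp add: mult.left_commute)
    qed
    show ?thesis unfolding sum_distrib_left by (intro sum.cong refl) (rule key)
  qed
  finally have "pencil_A N = (\<Sum>m\<le>N. fls_const (coeff ?q m) * fls_X_intpow (2 * int m - int N)) / fls_const (det ?A)"
    by (simp add: pencil_A_def)
  moreover have "inverse (fls_const (det ?A)) = fls_const (inverse (det ?A))"
    using det_generic_mat_nonzero[of N A_site] by (intro inverse_unique) simp
  ultimately show ?thesis
    by (simp add: divide_inverse sum_distrib_left A_coeff_def mult_ac flip: fls_const_mult_const)
qed

lemma Y_fun_eq:
  assumes "p \<le> N"
  shows "Y_fun N p = A_coeff N (N - p) / (if N = 2 * p then 2 else 1)"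
proof -
  have "fls_nth (pencil_A N) (int N - 2 * int p) =
      (\<Sum>m\<le>N. if m = N - p then A_coeff N (N - p) else 0)"
    unfolding pencil_A_eq_sum fls_nth_sum using assms by (intro sum.cong) auto
  then show ?thesis by (simp add: Y_fun_def)
qed

lemma rconst_2: "rconst 2 = 2"
  using rconst_add[of 1 1] by simp

lemma two_ratfun_nonzero: "(2 :: ratfun) \<noteq> 0"
  using rconst_2 by (metis rconst_eq_0_iff zero_neq_numeral)

lemma pencil_A_expansion:
  assumes "N \<ge> 1"
  shows "pencil_A N = (fls_X_intpow (int N) + fls_X_intpow (- int N))
       + (\<Sum>p=1..N div 2.
           (fls_X_intpow (int N - 2 * int p) + fls_X_intpow (2 * int p - int N))
             * fls_const (Y_fun N p))"
proof -
  define g where "g m = fls_const (A_coeff N m) * fls_X_intpow (2 * int m - int N)" for m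
  define n where "n = N div 2"
  let ?A = "{1..n}" and ?B = "(\<lambda>p. N - p) ` {1..n}"
  have inj: "inj_on (\<lambda>p. N - p) {1..n}" by (auto simp: inj_on_def n_def)
  \<comment> \<open>For \<open>N = 2 * p\<close> both powers are 1; their sum 2 is compensated by
    the denominator in \<open>Y_fun\<close>, and the middle coefficient is counted once.\<close>
  have summand: "(fls_X_intpow (int N - 2 * int p) + fls_X_intpow (2 * int p - int N)) * fls_const (Y_fun N p)
      = g p + (if N = 2 * p then 0 else g (N - p))" if p: "p \<in> {1..n}" for p
  proof -
    have pN: "p \<le> N" using p le_trans[OF _ div_le_dividend, of p N 2] by (simp add: n_def)
    have Y: "Y_fun N p = A_coeff N p / (if N = 2 * p then 2 else 1)"
      using Y_fun_eq[OF pN] A_coeff_palindromic[OF pN] by simp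
    show ?thesis
    proof (cases "N = 2 * p")
      case True
      have "(2 :: ratfun fls) * fls_const (A_coeff N p / 2) = fls_const (A_coeff N p)"
        using two_ratfun_nonzero by (simp flip: fls_const_numeral)
      moreover have "Y_fun N p = A_coeff N p / 2"
        unfolding Y by (subst if_P[OF True]) (rule refl)
      ultimately have "2 * fls_const (Y_fun N p) = fls_const (A_coeff N p)" by (simp only:)
      then show ?thesis using True by (simp add: g_def)
    next
      case False
      have "g (N - p) = fls_const (A_coeff N p) * fls_X_intpow (int N - 2 * int p)"
        using pN A_coeff_palindromic[OF pN] by (simp add: g_def of_nat_diff)
      then show ?thesis using False by (simp add: Y g_def algebra_simps)
    qed
  qed
  have "{..N} = insert 0 (insert N ({1..<N}))" using assms by auto
  then have "pencil_A N = g 0 + (g N + sum g {1..<N})"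
    using assms unfolding pencil_A_eq_sum g_def[symmetric] by simp
  also have "{1..<N} = ?A \<union> ?B"
  proof (intro equalityI subsetI)
    fix m assume m: "m \<in> {1..<N}"
    show "m \<in> ?A \<union> ?B"
    proof (cases "m \<le> n")
      case False
      then have "N - m \<in> {1..n}" "m = N - (N - m)" using m by (auto simp: n_def)
      then show ?thesis by blast
    qed (use m in auto)
  qed (auto simp: n_def)
  also have "sum g (?A \<union> ?B) = sum g ?A + (\<Sum>p\<in>?A. if N = 2 * p then 0 else g (N - p))"
  proof -
    have "sum g (?A \<union> ?B) = sum g ?A + sum g (?B - ?A)"
      using sum.union_disjoint[of ?A "?B - ?A" g] by simp
    also have "?B - ?A = (\<lambda>p. N - p) ` {p \<in> ?A. N \<noteq> 2 * p}"
      by (auto simp: n_def)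
    also have "sum g \<dots> = (\<Sum>p\<in>{p \<in> ?A. N \<noteq> 2 * p}. g (N - p))"
      by (rule sum.reindex_cong[OF inj_on_subset[OF inj]]) auto
    also have "\<dots> = (\<Sum>p\<in>?A. if N = 2 * p then 0 else g (N - p))"
      by (subst sum.inter_filter) (auto intro!: sum.cong)
    finally show ?thesis .
  qed
  finally show ?thesis
    using summand by (simp add: g_def A_coeff_0 A_coeff_N sum.distrib n_def add_ac flip: sum.distrib)
qed

lemma pencil_BC_eq: "pencil_BC N u = Polynomial.smult (1 / det (mat_B N u)) (pencil_det (mat_B N u) (mat_C N u))"
  by (simp add: pencil_BC_def pencil_det_def)

lemma Z_fun_eq: "Z_fun N u p = coeff (pencil_det (mat_B N u) (mat_C N u)) p / det (mat_B N u)"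
  by (simp add: Z_fun_def pencil_BC_eq)

lemma pencil_BC_expansion: "pencil_BC N u = 1 + (\<Sum>p=1..N. Polynomial.monom (Z_fun N u p) p)"
proof (rule poly_eqI)
  fix m
  have "coeff (1 + (\<Sum>p=1..N. Polynomial.monom (Z_fun N u p) p)) m =
      coeff 1 m + (\<Sum>p=1..N. if p = m then Z_fun N u m else 0)"
    unfolding coeff_add coeff_sum by (intro arg_cong2[where f = "(+)"] sum.cong) auto
  moreover have "coeff (pencil_BC N u) 0 = 1"
    using coeff_0_pencil_det[of "mat_B N u" N "mat_C N u"] det_generic_mat_nonzero[of N "B_site u"]
    by (simp add: pencil_BC_eq)
  moreover have "coeff (pencil_BC N u) m = 0" if "m > N"
    using that degree_pencil_det[of "mat_B N u" N "mat_C N u"] by (simp add: pencil_BC_eq coeff_eq_0)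
  ultimately show "coeff (pencil_BC N u) m = coeff (1 + (\<Sum>p=1..N. Polynomial.monom (Z_fun N u p) p)) m"
    by (cases "m = 0"; cases "m \<le> N") (auto simp: Z_fun_def coeff_1)
qed

section \<open>The Casimir property\<close>

context chain_entry
begin

lemma eigen_coeff_pencil_det:
  assumes G: "s1 \<in> chain_sites j" "s2 \<in> chain_sites j"
    and U: "U \<in> {generic_mat N s1, transpose_mat (generic_mat N s1)}"
    and PQ: "P \<in> carrier_mat N N" "Q \<in> carrier_mat N N"
    and DU: "map_mat D U = P * U + U * Q"
    and DV: "map_mat D (generic_mat N s2) = P * generic_mat N s2 + generic_mat N s2 * Q"
  shows "eigen ((\<Sum>i<N. P $$ (i, i)) + (\<Sum>i<N. Q $$ (i, i))) (coeff (pencil_det U (generic_mat N s2)) m)"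
    and "eigen ((\<Sum>i<N. P $$ (i, i)) + (\<Sum>i<N. Q $$ (i, i))) (det (generic_mat N s2))"
    and "eigen ((\<Sum>i<N. P $$ (i, i)) + (\<Sum>i<N. Q $$ (i, i))) (det U)"
proof -
  have Uc: "U \<in> carrier_mat N N" using U by auto
  have UR: "U $$ (i, m) \<in> chain_functions N j" if "i < N" "m < N" for i m
    using U generic_mat_chain_functions[OF G(1) that] generic_mat_chain_functions[OF G(1) that(2,1)] that by auto
  show "eigen ((\<Sum>i<N. P $$ (i, i)) + (\<Sum>i<N. Q $$ (i, i))) (coeff (pencil_det U (generic_mat N s2)) m)"
    unfolding eigen_def
    using coeff_pencil_det_closed[OF Uc generic_mat_carrier UR generic_mat_chain_functions[OF G(2)]]
      der_coeff_pencil_det[OF Uc generic_mat_carrier UR generic_mat_chain_functions[OF G(2)] PQ DU DV]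
    by blast
  show "eigen ((\<Sum>i<N. P $$ (i, i)) + (\<Sum>i<N. Q $$ (i, i))) (det (generic_mat N s2))"
    by (rule eigen_det[OF generic_mat_carrier generic_mat_chain_functions[OF G(2)] PQ DV])
  show "eigen ((\<Sum>i<N. P $$ (i, i)) + (\<Sum>i<N. Q $$ (i, i))) (det U)"
    by (rule eigen_det[OF Uc UR PQ DU])
qed

text \<open>A congruence action passes to the transpose with the same \<open>P\<close>. So both
  matrices of the pencil obey one equation, and its coefficients share the eigenvalue of
  \<open>det A\<close>.\<close>

lemma eigen_Y:
  assumes P: "P \<in> carrier_mat N N" and DA: "map_mat D (mat_A N) = P * mat_A N + mat_A N * transpose_mat P"
    and p: "p \<le> N"
  shows "eigen 0 (Y_fun N p)"
proof -
  have DAT: "map_mat D (transpose_mat (mat_A N)) =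
      P * transpose_mat (mat_A N) + transpose_mat (mat_A N) * transpose_mat P"
    by (rule der_transpose[OF generic_mat_carrier P P DA])
  note e = eigen_coeff_pencil_det[OF chain_sites_simps(1,1) _ P _ DAT DA]
  have two: "eigen 0 2" using one_closed add_closed[of 1 1] der_add[of 1 1] by (auto simp: eigen_def)
  have "eigen 0 (A_coeff N (N - p))"
    unfolding A_coeff_def using eigen_divide[OF e(1) e(2)] P by simp
  then show ?thesis
    unfolding Y_fun_eq[OF p] using eigen_divide[OF _ two] eigen_divide[OF _ eigen_one] by auto
qed

lemma eigen_Z:
  assumes "P \<in> carrier_mat N N" "Q \<in> carrier_mat N N" and u: "u \<in> {1..j}"
    and "map_mat D (mat_B N u) = P * mat_B N u + mat_B N u * Q"
    and "map_mat D (mat_C N u) = P * mat_C N u + mat_C N u * Q"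
  shows "eigen 0 (Z_fun N u p)"
proof -
  note e = eigen_coeff_pencil_det[OF chain_sites_simps(2)[OF u] chain_sites_simps(3)[OF u] _ assms(1,2,4,5)]
  show ?thesis
    unfolding Z_fun_eq using eigen_divide[OF e(1) e(3)] by simp
qed

end

context type_ii_bracket
begin

lemma eigen_chain_casimir:
  assumes v: "v \<in> chain_entries N j" and i: "i \<in> casimir_labels N j"
  shows "subfield_der.eigen (chain_functions N j) (\<lambda>f. br f (coord v)) 0 (chain_casimir N j i)"
proof -
  obtain s k l where v_eq: "v = Entry s k l" and s: "s \<in> chain_sites j" and kl: "k < N" "l < N"
    using v by (auto simp: chain_entries_def)
  have bracket: "type_ii_bracket N j br" by unfold_locales
  show ?thesis
  proof (cases "s = A_site")
    case True
    interpret A_entry N j br k l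
      using kl True s by unfold_locales auto
    have "eigen 0 (chain_casimir N j i)"
      using i unfolding casimir_labels_def
    proof (elim UnE)
      assume "i \<in> Y_label ` {1..N div 2}"
      then show ?thesis using eigen_Y[OF W_U_V_carrier(3) D_A_congruence] by auto
    next
      assume "i \<in> {Z_label k p |k p. k \<in> {1..j} \<and> p \<in> {1..N}}"
      then obtain u p where i: "i = Z_label u p" and u: "u \<in> {1..j}" by blast
      show ?thesis
        using eigen_Z[OF W_U_V_carrier(1) _ u D_BC[of B_site u] D_BC[of C_site u], of p] u
        by (simp add: i)
    next
      assume "i \<in> X_label ` (if even j then {0..<(N + 1) div 2} else {1..N div 2})"
      then show ?thesis
        using eigen_X_even' eigen_X_odd'[of "j div 2"] by (auto split: if_splits)
    qed
    then show ?thesis unfolding v_eq True .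
  next
    case False
    then obtain Y t where Yt: "Y \<in> {B_site, C_site}" "t \<in> {1..j}" "s = Y t"
      using s False that[of B_site] that[of C_site] by (auto simp: chain_sites_def)
    interpret BC_entry N j br Y t k l
      using kl Yt s by unfold_locales auto
    have "eigen 0 (chain_casimir N j i)"
      using i unfolding casimir_labels_def
    proof (elim UnE)
      assume "i \<in> Y_label ` {1..N div 2}"
      then show ?thesis using eigen_Y[OF W_carrier D_A] by auto
    next
      assume "i \<in> {Z_label k p |k p. k \<in> {1..j} \<and> p \<in> {1..N}}"
      then obtain u p where "i = Z_label u p" "u \<in> {1..j}" by blast
      then show ?thesis using D_pencil[of u] eigen_Z by (metis chain_casimir.simps(2))
    next
      assume "i \<in> X_label ` (if even j then {0..<(N + 1) div 2} else {1..N div 2})"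
      then show ?thesis
        using eigen_X_even' eigen_X_odd'[of "j div 2"] by (auto split: if_splits)
    qed
    then show ?thesis unfolding v_eq Yt(3) .
  qed
qed

lemma casimir_chain_casimir:
  assumes "N \<ge> 1" and i: "i \<in> casimir_labels N j"
  shows "casimir_function N j br (chain_casimir N j i)"
proof -
  \<comment> \<open>Membership in the field is part of \<open>eigen\<close>, so one coordinate must
    exist to extract it; here \<open>N \<ge> 1\<close> enters.\<close>
  have v0: "Entry A_site 0 0 \<in> chain_entries N j"
    using assms by (simp add: chain_entries_def chain_sites_def)
  have "chain_casimir N j i \<in> chain_functions N j \<and> br (chain_casimir N j i) (coord v) = 0"
    if v: "v \<in> chain_entries N j" for v
  proof -
    interpret subfield_der "chain_functions N j" "\<lambda>f. br f (coord v)" by (rule bracket_der[OF v])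
    show ?thesis using eigen_chain_casimir[OF v i] by (simp add: eigen_def)
  qed
  then show ?thesis unfolding casimir_function_def using v0 by blast
qed

end

section \<open>Pencils with prescribed coefficients\<close>

text \<open>
  Multiplying by the inverse of \<open>1 - \<lambda> J\<close>, with \<open>J\<close> the shift, makes the pencil lower triangular.
\<close>

lemma pencil_det_companion:
  fixes z :: "nat \<Rightarrow> 'a::idom"
  defines "C \<equiv> \<lambda>N. mat N N (\<lambda>(a, b). if b = 0 then z (Suc a) else if b = Suc a then - 1 else 0)"
  assumes "N \<ge> 1"
  shows "pencil_det (1\<^sub>m N) (C N) = 1 + (\<Sum>p=1..N. monom (z p) p)"
proof -
  define M where "M = map_mat (\<lambda>x. [:x:]) (1\<^sub>m N) + [:0, 1:] \<cdot>\<^sub>m map_mat (\<lambda>x. [:x:]) (C N)"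
  define G where "G = mat N N (\<lambda>(a, b). if a \<le> b then monom (1::'a) (b - a) else 0)"
  define d where "d = 1 + (\<Sum>p=1..N. monom (z p) p)"
  have M: "M \<in> carrier_mat N N" and G: "G \<in> carrier_mat N N"
    by (simp_all add: M_def G_def C_def)
  have sum_0: "(\<Sum>c\<in>{0..<N}. monom (z (Suc c)) (Suc c)) = (\<Sum>p=1..N. monom (z p) p)"
    by (rule sum.reindex_bij_witness[of _ "\<lambda>p. p - 1" Suc]) auto
  have M_index: "M $$ (c, b) = (if c = b then 1 else 0) + (if b = 0 then monom (z (Suc c)) 1 else 0)
      + (if b = Suc c then - monom 1 1 else 0)" if "c < N" "b < N" for c b
    using that by (auto simp: M_def C_def monom_altdef one_pCons)
  have GM: "(G * M) $$ (a, b) = (if b = 0 then (if a = 0 then d else (\<Sum>c\<in>{a..<N}. monom (z (Suc c)) (Suc (c - a))))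
      else if a = b then 1 else 0)" if ab: "a < N" "b < N" for a b
  proof -
    have "(G * M) $$ (a, b) = (\<Sum>c<N. G $$ (a, c) * M $$ (c, b))"
      by (rule index_mult_mat_sum[OF G M ab])
    also have "\<dots> = (\<Sum>c<N. (if c = b then if a \<le> b then monom 1 (b - a) else 0 else 0)
        + (if a \<le> c then if b = 0 then monom (z (Suc c)) (Suc (c - a)) else 0 else 0)
        + (if c = b - 1 then if b \<noteq> 0 \<and> a \<le> b - 1 then - monom 1 (Suc (b - 1 - a)) else 0 else 0))"
      using ab by (intro sum.cong) (auto simp: M_index G_def mult_monom)
    also have "\<dots> = (if a \<le> b then monom 1 (b - a) else 0)
        + (\<Sum>c<N. if a \<le> c then if b = 0 then monom (z (Suc c)) (Suc (c - a)) else 0 else 0)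
        + (if b \<noteq> 0 \<and> a \<le> b - 1 then - monom 1 (Suc (b - 1 - a)) else 0)"
      using ab by (simp add: sum.distrib)
    also have "(\<Sum>c<N. if a \<le> c then if b = 0 then monom (z (Suc c)) (Suc (c - a)) else 0 else 0)
        = (if b = 0 then \<Sum>c\<in>{a..<N}. monom (z (Suc c)) (Suc (c - a)) else 0)"
    proof -
      have "{..<N} \<inter> {c. a \<le> c} = {a..<N}" by auto
      then show ?thesis
        by (cases "b = 0") (simp_all add: sum.If_cases)
    qed
    finally show ?thesis
      using sum_0 by (cases "b = 0"; cases "a = 0"; cases "a < b") (auto simp: d_def Suc_diff_Suc not_less)
  qed
  have "det G = prod_list (diag_mat G)"
    by (rule det_upper_triangular[OF _ G]) (auto simp: G_def)
  also have "\<dots> = 1"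
    by (simp add: prod_list_diag_prod) (simp add: G_def)
  finally have "det G = 1" .
  then have "det M = det (G * M)" using det_mult[OF G M] by simp
  also have "\<dots> = prod_list (diag_mat (G * M))"
    by (rule det_lower_triangular[of N]) (use G M GM in \<open>auto simp del: index_mult_mat\<close>)
  also have "\<dots> = (\<Prod>i = 0..<N. (G * M) $$ (i, i))"
    using G by (simp add: prod_list_diag_prod del: index_mult_mat(1))
  also have "\<dots> = (\<Prod>i = 0..<N. if i = 0 then d else 1)"
    by (intro prod.cong) (auto simp: GM simp del: index_mult_mat)
  also have "\<dots> = d" using assms(2) by simp
  finally show ?thesis by (simp add: pencil_det_def M_def d_def)
qed

section \<open>Pencils of antidiagonal matrices\<close>

definition flip_mat :: "nat \<Rightarrow> (nat \<Rightarrow> 'a) \<Rightarrow> 'a::comm_ring_1 mat"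
  where "flip_mat n f = mat n n (\<lambda>(a, b). if a + b + 1 = n then f a else 0)"

lemma flip_mat_carrier [simp]: "flip_mat n f \<in> carrier_mat n n"
  by (simp add: flip_mat_def)

text \<open>The entries split off as a diagonal matrix. The sign that remains is left uncomputed: it
  cancels in the quotient by \<open>det A\<close>, and its square is 1.\<close>

lemma det_flip_mat: "det (flip_mat n f) = (\<Prod>a<n. f a) * det (flip_mat n (\<lambda>_. 1))"
proof -
  let ?d = "mat n n (\<lambda>(a, b). if a = b then f a else 0)"
  have "flip_mat n f = ?d * flip_mat n (\<lambda>_. 1)"
  proof (rule eq_matI)
    fix a b assume "a < dim_row (?d * flip_mat n (\<lambda>_. 1))" "b < dim_col (?d * flip_mat n (\<lambda>_. 1))"
    then have ab: "a < n" "b < n" by (auto simp: flip_mat_def)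
    have "(?d * flip_mat n (\<lambda>_. 1)) $$ (a, b) = (\<Sum>c<n. ?d $$ (a, c) * flip_mat n (\<lambda>_. 1) $$ (c, b))"
      by (rule index_mult_mat_sum) (use ab in auto)
    also have "\<dots> = (\<Sum>c<n. if c = a then f a * flip_mat n (\<lambda>_. 1) $$ (a, b) else 0)"
      using ab by (intro sum.cong) auto
    finally show "flip_mat n f $$ (a, b) = (?d * flip_mat n (\<lambda>_. 1)) $$ (a, b)"
      using ab by (simp add: flip_mat_def)
  qed (auto simp: flip_mat_def)
  moreover have "det ?d = (\<Prod>a<n. f a)"
  proof -
    have "det ?d = prod_list (diag_mat ?d)"
      by (rule det_upper_triangular[of _ n]) auto
    then show ?thesis by (simp add: prod_list_diag_prod atLeast0LessThan)
  qed
  ultimately show ?thesis by (simp add: det_mult[of _ n])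
qed

lemma det_flip_mat_one_square: "det (flip_mat n (\<lambda>_. 1 :: 'a::comm_ring_1)) * det (flip_mat n (\<lambda>_. 1)) = 1"
proof -
  let ?J = "flip_mat n (\<lambda>_. 1) :: 'a mat"
  have "?J * ?J = 1\<^sub>m n"
  proof (rule eq_matI)
    fix a b assume "a < dim_row (1\<^sub>m n)" "b < dim_col (1\<^sub>m n)"
    then have ab: "a < n" "b < n" by auto
    have "(?J * ?J) $$ (a, b) = (\<Sum>c<n. ?J $$ (a, c) * ?J $$ (c, b))"
      by (rule index_mult_mat_sum) (use ab in auto)
    also have "\<dots> = (\<Sum>c<n. if c = n - 1 - a then if a = b then 1 else 0 else 0)"
      using ab by (intro sum.cong) (auto simp: flip_mat_def)
    also have "\<dots> = (if a = b then 1 else 0)" using ab by simp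
    finally show "(?J * ?J) $$ (a, b) = 1\<^sub>m n $$ (a, b)" using ab by simp
  qed (auto simp: flip_mat_def)
  then show ?thesis using det_mult[of ?J n ?J] by simp
qed

text \<open>Transposing an antidiagonal matrix reverses its entries, so the pencil is again
  antidiagonal and its determinant factors into linear polynomials.\<close>

lemma pencil_det_flip_mat:
  fixes f :: "nat \<Rightarrow> 'a::field"
  shows "pencil_det (transpose_mat (flip_mat n f)) (flip_mat n f) =
    Polynomial.smult (det (flip_mat n (\<lambda>_. 1))) (\<Prod>a<n. [:f (n - 1 - a), f a:])"
proof -
  have sum: "map_mat (\<lambda>x. [:x:]) (transpose_mat (flip_mat n f)) + [:0, 1:] \<cdot>\<^sub>m map_mat (\<lambda>x. [:x:]) (flip_mat n f) =
      flip_mat n (\<lambda>a. [:f (n - 1 - a), f a:])"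
  proof (rule eq_matI)
    fix a b assume "a < dim_row (flip_mat n (\<lambda>a. [:f (n - 1 - a), f a:]))"
      "b < dim_col (flip_mat n (\<lambda>a. [:f (n - 1 - a), f a:]))"
    then have ab: "a < n" "b < n" by (auto simp: flip_mat_def)
    have "n - 1 - a = b" if "a + b + 1 = n" using that by simp
    then show "(map_mat (\<lambda>x. [:x:]) (transpose_mat (flip_mat n f)) +
        [:0, 1:] \<cdot>\<^sub>m map_mat (\<lambda>x. [:x:]) (flip_mat n f)) $$ (a, b) =
        flip_mat n (\<lambda>a. [:f (n - 1 - a), f a:]) $$ (a, b)"
      using ab by (auto simp: flip_mat_def)
  qed (auto simp: flip_mat_def)
  have det: "det (flip_mat n (\<lambda>_. 1 :: 'a poly)) = [:det (flip_mat n (\<lambda>_. 1 :: 'a)):]"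
  proof -
    have "comm_ring_hom (\<lambda>x :: 'a. [:x:])" by unfold_locales (auto simp: one_pCons)
    from comm_ring_hom.hom_det[OF this, of "flip_mat n (\<lambda>_. 1)"]
    have "[:det (flip_mat n (\<lambda>_. 1 :: 'a)):] = det (map_mat (\<lambda>x. [:x:]) (flip_mat n (\<lambda>_. 1)))" by simp
    also have "map_mat (\<lambda>x :: 'a. [:x:]) (flip_mat n (\<lambda>_. 1)) = flip_mat n (\<lambda>_. 1)"
      by (intro eq_matI) (auto simp: flip_mat_def one_pCons)
    finally show ?thesis ..
  qed
  show ?thesis
    unfolding pencil_det_def sum det_flip_mat[of n "\<lambda>a. [:f (n - 1 - a), f a:]"] det by simp
qed

text \<open>The polynomial \<open>x\<^sup>n r(x + 1/x)\<close>.\<close>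

definition recip_poly :: "nat \<Rightarrow> 'a::comm_ring_1 poly \<Rightarrow> 'a poly"
  where "recip_poly n r = (\<Sum>k\<le>n. Polynomial.smult (coeff r k) (monom 1 (n - k) * [:1, 0, 1:] ^ k))"

text \<open>For \<open>t = x + 1/x\<close> the factor \<open>t + w\<close>, multiplied by the extra
  power of \<open>x\<close>, becomes the quadratic polynomial with coefficients 1, \<open>w\<close>,
  1.\<close>

lemma recip_poly_Suc:
  assumes "degree r \<le> n"
  shows "recip_poly (Suc n) (r * [:w, 1:]) = recip_poly n r * [:1, w, 1:]"
proof -
  let ?q = "[:1, 0, 1:] :: 'a poly"
  have c: "coeff (r * [:w, 1:]) k = w * coeff r k + (case k of 0 \<Rightarrow> 0 | Suc k' \<Rightarrow> coeff r k')" for k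
    by (simp add: coeff_pCons split: nat.splits)
  have r: "coeff r (Suc n) = 0" using assms by (simp add: coeff_eq_0)
  have shift: "Polynomial.smult (w * coeff r k) (monom 1 (Suc n - k) * ?q ^ k) =
      Polynomial.smult (coeff r k) (monom 1 (n - k) * ?q ^ k) * monom w 1" if "k \<le> n" for k
  proof -
    have "monom 1 (Suc n - k) = monom 1 (n - k) * (monom 1 1 :: 'a poly)"
      using that by (simp add: mult_monom Suc_diff_le)
    moreover have "monom w 1 = Polynomial.smult w (monom 1 1)"
      by (simp add: smult_monom)
    ultimately show ?thesis
      by (simp only: mult_smult_left mult_smult_right smult_smult mult_ac)
  qed
  have "recip_poly (Suc n) (r * [:w, 1:]) =
      (\<Sum>k\<le>Suc n. Polynomial.smult (w * coeff r k) (monom 1 (Suc n - k) * ?q ^ k)) +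
      (\<Sum>k\<le>Suc n. Polynomial.smult (case k of 0 \<Rightarrow> 0 | Suc k' \<Rightarrow> coeff r k') (monom 1 (Suc n - k) * ?q ^ k))"
    unfolding recip_poly_def c smult_add_left sum.distrib ..
  also have "(\<Sum>k\<le>Suc n. Polynomial.smult (w * coeff r k) (monom 1 (Suc n - k) * ?q ^ k)) =
      (\<Sum>k\<le>n. Polynomial.smult (coeff r k) (monom 1 (n - k) * ?q ^ k) * monom w 1)"
    unfolding sum.atMost_Suc r by (simp only: mult_zero_right smult_0_left add_0_right) (intro sum.cong refl shift, simp)
  also have "(\<Sum>k\<le>Suc n. Polynomial.smult (case k of 0 \<Rightarrow> 0 | Suc k' \<Rightarrow> coeff r k') (monom 1 (Suc n - k) * ?q ^ k)) =
      (\<Sum>k\<le>n. Polynomial.smult (coeff r k) (monom 1 (n - k) * ?q ^ k) * ?q)"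
    by (subst sum.atMost_Suc_shift) (simp add: mult_ac)
  also have "(\<Sum>k\<le>n. Polynomial.smult (coeff r k) (monom 1 (n - k) * ?q ^ k) * monom w 1) +
      (\<Sum>k\<le>n. Polynomial.smult (coeff r k) (monom 1 (n - k) * ?q ^ k) * ?q) = recip_poly n r * (monom w 1 + ?q)"
    unfolding recip_poly_def sum_distrib_right[symmetric] distrib_left ..
  also have "monom w 1 + ?q = [:1, w, 1:]"
    by (simp add: monom_altdef)
  finally show ?thesis .
qed

lemma recip_poly_prod: "recip_poly n (\<Prod>a<n. [:w a, 1:]) = (\<Prod>a<n. [:1, w a, 1:])"
proof (induction n)
  case (Suc n)
  have "degree (\<Prod>a<n. [:w a, 1:]) \<le> (\<Sum>a<n. degree [:w a, 1:])"
    using degree_prod_sum_le[of "{..<n}" "\<lambda>a. [:w a, 1:]"] by (simp add: o_def)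
  also have "\<dots> \<le> (\<Sum>a<n. 1)" by (intro sum_mono) simp
  finally have "degree (\<Prod>a<n. [:w a, 1:]) \<le> n" by simp
  then show ?case using recip_poly_Suc[of "\<Prod>a<n. [:w a, 1:]" n "w n"] Suc.IH by simp
qed (simp add: recip_poly_def)

text \<open>The system is triangular: the summand for \<open>k\<close> starts at degree
  \<open>n - k\<close>. So the leading coefficient of \<open>r\<close> determines the constant term,
  and once its contribution is subtracted the same problem remains with all degrees shifted by
  one.\<close>

lemma recip_poly_low_coeffs:
  fixes c :: "nat \<Rightarrow> 'a::comm_ring_1"
  shows "\<exists>r. degree r \<le> n \<and> coeff r n = c 0 \<and> (\<forall>p\<le>n. coeff (recip_poly n r) p = c p)"
proof (induction n arbitrary: c)
  case 0
  show ?case by (rule exI[of _ "[:c 0:]"]) (simp add: recip_poly_def)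
next
  case (Suc n)
  let ?q = "[:1, 0, 1:] :: 'a poly"
  obtain r where r: "degree r \<le> n"
    "\<And>p. p \<le> n \<Longrightarrow> coeff (recip_poly n r) p = c (Suc p) - c 0 * coeff (?q ^ Suc n) (Suc p)"
    using Suc.IH[of "\<lambda>p. c (Suc p) - c 0 * coeff (?q ^ Suc n) (Suc p)"] by blast
  define r' where "r' = r + monom (c 0) (Suc n)"
  have r'_k: "coeff r' k = coeff r k" if "k \<le> n" for k using that by (simp add: r'_def)
  have r'_top: "coeff r' (Suc n) = c 0" using r(1) by (simp add: r'_def coeff_eq_0)
  have "recip_poly (Suc n) r' = (\<Sum>k\<le>n. Polynomial.smult (coeff r k) (monom 1 (Suc n - k) * ?q ^ k))
      + Polynomial.smult (c 0) (?q ^ Suc n)"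
    unfolding recip_poly_def by (simp add: r'_k r'_top)
  also have "(\<Sum>k\<le>n. Polynomial.smult (coeff r k) (monom 1 (Suc n - k) * ?q ^ k)) = monom 1 1 * recip_poly n r"
    unfolding recip_poly_def sum_distrib_left
    by (intro sum.cong) (auto simp: Suc_diff_le mult.assoc[symmetric] mult_monom)
  finally have eq: "recip_poly (Suc n) r' = monom 1 1 * recip_poly n r + Polynomial.smult (c 0) (?q ^ Suc n)" .
  have q0: "coeff (?q ^ k) 0 = 1" for k by (induction k) (auto simp: coeff_mult)
  have "coeff (recip_poly (Suc n) r') p = c p" if "p \<le> Suc n" for p
  proof (cases p)
    case 0
    then show ?thesis unfolding eq by (simp add: coeff_monom_mult q0 del: power_Suc)
  next
    case (Suc p')
    then show ?thesis using that unfolding eq by (simp add: coeff_monom_mult r(2) del: power_Suc)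
  qed
  moreover have "degree r' \<le> Suc n"
    unfolding r'_def using r(1) by (intro degree_add_le) (auto simp: degree_monom_le)
  ultimately show ?case using r'_top by blast
qed

text \<open>The condition \<open>c 0 = 1\<close> makes \<open>r\<close> monic of degree
  \<open>n\<close>. Over the complex numbers it splits into linear factors, and
  \<open>recip_poly\<close> turns each into a quadratic one.\<close>

lemma exists_quadratic_factors:
  fixes c :: "nat \<Rightarrow> complex"
  assumes c0: "c 0 = 1"
  shows "\<exists>w. \<forall>p\<le>n. coeff (\<Prod>a<n. [:1, w a, 1:]) p = c p"
proof -
  obtain r where r: "degree r \<le> n" "coeff r n = 1" "\<And>p. p \<le> n \<Longrightarrow> coeff (recip_poly n r) p = c p"
    using recip_poly_low_coeffs[of n c] c0 by auto
  then have deg: "degree r = n" by (metis le_antisym le_degree one_neq_zero)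
  obtain as where as: "Polynomial.smult (coeff r (degree r)) (\<Prod>a\<leftarrow>as. [:- a, 1:]) = r" "length as = degree r"
    using fundamental_theorem_algebra_factorized by blast
  have "r = (\<Prod>a<n. [:- (as ! a), 1:])"
    using as deg r(2) by (simp add: prod.list_conv_set_nth atLeast0LessThan)
  then have "recip_poly n r = (\<Prod>a<n. [:1, - (as ! a), 1:])"
    using recip_poly_prod[of n "\<lambda>a. - (as ! a)"] by simp
  then show ?thesis using r(3) by (intro exI[of _ "\<lambda>a. - (as ! a)"]) simp
qed

lemma exists_palindromic_factors:
  fixes c :: "nat \<Rightarrow> complex"
  shows "\<exists>w. \<forall>p\<in>{1..N div 2}. coeff ((\<Prod>a<N div 2. [:1, w a, 1:]) * [:1, 1:] ^ (N mod 2)) p = c p"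
proof (cases "even N")
  case True
  obtain w where "\<forall>p\<le>N div 2. coeff (\<Prod>a<N div 2. [:1, w a, 1:]) p = (c(0 := 1)) p"
    using exists_quadratic_factors[of "c(0 := 1)"] by auto
  then show ?thesis using True by (intro exI[of _ w]) auto
next
  case False
  \<comment> \<open>The low coefficients of the quotient by \<open>1 + x\<close>, normalised to
    constant term 1.\<close>
  define c' where "c' = rec_nat (1 :: complex) (\<lambda>p x. c (Suc p) - x)"
  obtain w where w: "\<forall>p\<le>N div 2. coeff (\<Prod>a<N div 2. [:1, w a, 1:]) p = c' p"
    using exists_quadratic_factors[of c'] by (auto simp: c'_def)
  have "coeff ((\<Prod>a<N div 2. [:1, w a, 1:]) * [:1, 1:]) p = c p" if p: "p \<in> {1..N div 2}" for p
  proof -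
    obtain p' where p': "p = Suc p'" using p by (cases p) auto
    then have "coeff ((\<Prod>a<N div 2. [:1, w a, 1:]) * [:1, 1:]) p = c' (Suc p') + c' p'"
      using w p by (simp add: coeff_pCons)
    then show ?thesis by (simp add: c'_def p')
  qed
  then show ?thesis using False by (intro exI[of _ w]) (simp add: odd_iff_mod_2_eq_one)
qed

text \<open>The two roots of the quadratic polynomial with coefficients 1, \<open>- w\<close>, 1
  have sum \<open>w\<close> and product 1.\<close>

lemma exists_sum_inverse:
  fixes w :: complex
  shows "\<exists>x. x \<noteq> 0 \<and> x + inverse x = w"
proof -
  define x where "x = (w + csqrt (w\<^sup>2 - 4)) / 2"
  have "x * (w - x) = (w\<^sup>2 - (csqrt (w\<^sup>2 - 4))\<^sup>2) / 4"
    unfolding x_def by (simp add: field_simps power2_eq_square)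
  then have x: "x * (w - x) = 1" by (simp add: power2_csqrt)
  then have "x \<noteq> 0" by auto
  moreover have "inverse x = w - x" by (rule inverse_unique[OF x])
  ultimately show ?thesis by (intro exI[of _ x]) simp
qed

text \<open>The positions \<open>a\<close> and \<open>N - 1 - a\<close> carry
  \<open>1 + x_a z\<close> and \<open>x_a + z\<close>; their product is \<open>x_a\<close> times the
  quadratic factor. For odd \<open>N\<close> the middle position carries
  \<open>1 + z\<close>.\<close>

lemma prod_flip_pairs:
  fixes x :: "nat \<Rightarrow> 'a::field"
  assumes f: "\<And>a. f a = (if a < N div 2 then x a else 1)" and x: "\<And>a. x a \<noteq> 0"
  shows "(\<Prod>a<N. [:f (N - 1 - a), f a:]) =
    Polynomial.smult (\<Prod>a<N. f a)
      ((\<Prod>a<N div 2. [:1, x a + inverse (x a), 1:]) * [:1, 1:] ^ (N mod 2))"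
proof -
  let ?n = "N div 2"
  have split: "{..<N} = {..<?n} \<union> (\<lambda>a. N - 1 - a) ` {..<?n} \<union> (if even N then {} else {?n})"
  proof (intro subset_antisym subsetI)
    fix a assume a: "a \<in> {..<N}"
    show "a \<in> {..<?n} \<union> (\<lambda>a. N - 1 - a) ` {..<?n} \<union> (if even N then {} else {?n})"
    proof (cases "a < ?n \<or> N - 1 - a < ?n")
      case True
      have "a = N - 1 - (N - 1 - a)" using a by auto
      then show ?thesis using True by blast
    next
      case False
      then have "odd N \<and> a = ?n" using a by simp presburger
      then show ?thesis by simp
    qed
  qed (auto split: if_splits elim!: oddE)
  have inj: "inj_on (\<lambda>a. N - 1 - a) {..<?n}" by (auto simp: inj_on_def)
  have prod_split: "prod g {..<N} = (\<Prod>a<?n. g a * g (N - 1 - a)) * (if even N then 1 else g ?n)"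
    for g :: "nat \<Rightarrow> 'b::comm_ring_1"
  proof -
    have "prod g {..<N} = prod g ({..<?n} \<union> (\<lambda>a. N - 1 - a) ` {..<?n}) * prod g (if even N then {} else {?n})"
      by (subst split, rule prod.union_disjoint) (auto split: if_splits elim!: oddE)
    also have "prod g ({..<?n} \<union> (\<lambda>a. N - 1 - a) ` {..<?n}) = prod g {..<?n} * prod g ((\<lambda>a. N - 1 - a) ` {..<?n})"
      by (rule prod.union_disjoint) auto
    also have "prod g ((\<lambda>a. N - 1 - a) ` {..<?n}) = (\<Prod>a<?n. g (N - 1 - a))"
      by (rule prod.reindex_cong[OF inj]) auto
    finally show ?thesis by (simp add: prod.distrib)
  qed
  have pair: "[:f (N - 1 - a), f a:] * [:f (N - 1 - (N - 1 - a)), f (N - 1 - a):] =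
      Polynomial.smult (x a) [:1, x a + inverse (x a), 1:]" if "a < ?n" for a
  proof -
    have "N - 1 - (N - 1 - a) = a" "\<not> N - 1 - a < ?n" using that by auto
    then show ?thesis using that x[of a] by (simp add: f distrib_left)
  qed
  have pairs: "(\<Prod>a<?n. [:f (N - 1 - a), f a:] * [:f (N - 1 - (N - 1 - a)), f (N - 1 - a):]) =
      (\<Prod>a<?n. Polynomial.smult (x a) [:1, x a + inverse (x a), 1:])"
    by (intro prod.cong refl pair) simp
  have middle: "(if even N then 1 else [:f (N - 1 - ?n), f ?n:]) = [:1, 1:] ^ (N mod 2)"
    by (auto simp: f elim!: oddE)
  have "(\<Prod>a<N. [:f (N - 1 - a), f a:]) =
      (\<Prod>a<?n. Polynomial.smult (x a) [:1, x a + inverse (x a), 1:]) * [:1, 1:] ^ (N mod 2)"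
    unfolding prod_split[of "\<lambda>a. [:f (N - 1 - a), f a:]"] pairs middle ..
  also have "\<dots> = Polynomial.smult (\<Prod>a<?n. x a)
      ((\<Prod>a<?n. [:1, x a + inverse (x a), 1:]) * [:1, 1:] ^ (N mod 2))"
    by (simp only: prod_smult mult_smult_left)
  also have "(\<Prod>a<?n. x a) = (\<Prod>a<N. f a)"
    unfolding prod_split[of f] by (auto simp: f intro!: prod.cong)
  finally show ?thesis .
qed

section \<open>Independence of the functions Y and Z\<close>

lemma subst_coeff_pencil_det:
  assumes "U \<in> {generic_mat N s, transpose_mat (generic_mat N s)}"
  shows "coeff (pencil_det U (generic_mat N s')) m \<in> regular_at \<sigma>"
    and "subst_fun \<sigma> (coeff (pencil_det U (generic_mat N s')) m) =
      coeff (pencil_det (map_mat (subst_fun \<sigma>) U) (mat N N (\<lambda>(a, b). \<sigma> (Entry s' a b)))) m"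
proof -
  have U: "U \<in> carrier_mat N N" and UR: "\<And>a b. a < N \<Longrightarrow> b < N \<Longrightarrow> U $$ (a, b) \<in> regular_at \<sigma>"
    using assms by (auto simp: subst_coord)
  show "coeff (pencil_det U (generic_mat N s')) m \<in> regular_at \<sigma>"
    by (rule subst.coeff_pencil_det_closed[OF U generic_mat_carrier UR]) (simp_all add: subst_coord)
  show "subst_fun \<sigma> (coeff (pencil_det U (generic_mat N s')) m) =
      coeff (pencil_det (map_mat (subst_fun \<sigma>) U) (mat N N (\<lambda>(a, b). \<sigma> (Entry s' a b)))) m"
    unfolding subst_generic_mat[symmetric]
    by (rule subst.hom_coeff_pencil_det[OF U generic_mat_carrier UR]) (simp_all add: subst_coord)
qed

lemma subst_A_coeff:
  fixes N \<sigma>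
  defines "M \<equiv> mat N N (\<lambda>(a, b). \<sigma> (Entry A_site a b))"
  assumes "det M \<noteq> 0"
  shows "A_coeff N m \<in> regular_at \<sigma>"
    and "subst_fun \<sigma> (A_coeff N m) = coeff (pencil_det (transpose_mat M) M) m / det M"
proof -
  have 1: "coeff (pencil_det (transpose_mat (mat_A N)) (mat_A N)) m \<in> regular_at \<sigma>"
    by (rule subst_coeff_pencil_det(1)[where s = A_site]) simp
  have 2: "subst_fun \<sigma> (coeff (pencil_det (transpose_mat (mat_A N)) (mat_A N)) m) =
      coeff (pencil_det (transpose_mat M) M) m"
    unfolding M_def by (subst subst_coeff_pencil_det(2)[where s = A_site])
      (simp_all add: subst_generic_mat flip: map_mat_transpose)
  have 3: "subst_fun \<sigma> (det (mat_A N)) = det M"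
    unfolding M_def by (rule subst_det_generic_mat)
  show "A_coeff N m \<in> regular_at \<sigma>"
    "subst_fun \<sigma> (A_coeff N m) = coeff (pencil_det (transpose_mat M) M) m / det M"
    using subst_divide[OF 1 subst_det_generic_mat(1)[of N A_site \<sigma>]] assms(2) by (simp_all add: A_coeff_def 2 3)
qed

lemma subst_Z_fun:
  fixes N \<sigma> u
  defines "M \<equiv> mat N N (\<lambda>(a, b). \<sigma> (Entry (B_site u) a b))"
  assumes "det M \<noteq> 0"
  shows "Z_fun N u p \<in> regular_at \<sigma>"
    and "subst_fun \<sigma> (Z_fun N u p) =
      coeff (pencil_det M (mat N N (\<lambda>(a, b). \<sigma> (Entry (C_site u) a b)))) p / det M"
proof -
  have 1: "coeff (pencil_det (mat_B N u) (mat_C N u)) p \<in> regular_at \<sigma>"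
    by (rule subst_coeff_pencil_det(1)[where s = "B_site u"]) simp
  have 2: "subst_fun \<sigma> (coeff (pencil_det (mat_B N u) (mat_C N u)) p) =
      coeff (pencil_det M (mat N N (\<lambda>(a, b). \<sigma> (Entry (C_site u) a b)))) p"
    unfolding M_def by (subst subst_coeff_pencil_det(2)[where s = "B_site u"]) (simp_all add: subst_generic_mat)
  have 3: "subst_fun \<sigma> (det (mat_B N u)) = det M"
    unfolding M_def by (rule subst_det_generic_mat)
  show "Z_fun N u p \<in> regular_at \<sigma>" "subst_fun \<sigma> (Z_fun N u p) =
      coeff (pencil_det M (mat N N (\<lambda>(a, b). \<sigma> (Entry (C_site u) a b)))) p / det M"
    using subst_divide[OF 1 subst_det_generic_mat(1)[of N "B_site u" \<sigma>]] assms(2) by (simp_all add: Z_fun_eq 2 3)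
qed

lemma subst_half_or_one:
  "(if P then 2 else 1) \<in> regular_at \<sigma>" "subst_fun \<sigma> (if P then 2 else 1) = (if P then 2 else 1)"
  using subst_rconst[where c = 2 and \<sigma> = \<sigma>] by (auto simp: rconst_2)

text \<open>Every tuple \<open>y\<close> of complex numbers is attained at a point where all these
  functions are regular, so a relation vanishes at all complex tuples.\<close>

lemma independent_Y_Z:
  assumes N: "N \<ge> 1"
  shows "algebraically_independent
    (Y_label ` {1..N div 2} \<union> {Z_label k p | k p. k \<in> {1..j} \<and> p \<in> {1..N}}) (chain_casimir N j)"
    (is "algebraically_independent ?J _")
  unfolding algebraically_independent_def
proof (intro allI impI)
  fix P :: "casimir_label cpoly"
  assume P: "indets P \<subseteq> ?J \<and> eval_cpoly (chain_casimir N j) P = 0"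
  have "{Z_label k p | k p. k \<in> {1..j} \<and> p \<in> {1..N}} = (\<lambda>(k, p). Z_label k p) ` ({1..j} \<times> {1..N})"
    by auto
  then have "finite ?J" by simp
  then show "P = 0"
  proof (rule eval_cpoly_constants_eq_0_imp)
    show "indets P \<subseteq> ?J" using P by simp
    fix y :: "casimir_label \<Rightarrow> complex"
    \<comment> \<open>The factor 2 undoes the halving in \<open>Y_fun\<close> for the middle
      coefficient.\<close>
    define c where "c p = y (Y_label p) * (if N = 2 * p then 2 else 1)" for p
    obtain w where w: "\<And>p. p \<in> {1..N div 2} \<Longrightarrow>
        coeff ((\<Prod>a<N div 2. [:1, w a, 1:]) * [:1, 1:] ^ (N mod 2)) p = c p"
      using exists_palindromic_factors[of N c] by blast
    obtain x where x: "\<And>a. x a \<noteq> 0" "\<And>a. x a + inverse (x a) = w a"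
      using exists_sum_inverse[of "w _"] by metis
    define f where "f a = (if a < N div 2 then rconst (x a) else 1)" for a
    define \<sigma> where "\<sigma> v = (case v of Entry s a b \<Rightarrow> (case s of
        A_site \<Rightarrow> if a + b + 1 = N then f a else 0
      | B_site u \<Rightarrow> if a = b then 1 else 0
      | C_site u \<Rightarrow> if b = 0 then rconst (y (Z_label u (Suc a))) else if b = Suc a then - 1 else 0))" for v
    have A: "mat N N (\<lambda>(a, b). \<sigma> (Entry A_site a b)) = flip_mat N f"
      by (intro eq_matI) (auto simp: \<sigma>_def flip_mat_def)
    have B: "mat N N (\<lambda>(a, b). \<sigma> (Entry (B_site u) a b)) = 1\<^sub>m N" for u
      by (intro eq_matI) (auto simp: \<sigma>_def)
    have C: "mat N N (\<lambda>(a, b). \<sigma> (Entry (C_site u) a b)) =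
        mat N N (\<lambda>(a, b). if b = 0 then rconst (y (Z_label u (Suc a))) else if b = Suc a then - 1 else 0)" for u
      by (intro eq_matI) (auto simp: \<sigma>_def)
    have f_nonzero: "(\<Prod>a<N. f a) \<noteq> 0" using x(1) by (auto simp: f_def)
    have J: "det (flip_mat N (\<lambda>_. 1 :: ratfun)) \<noteq> 0"
      using det_flip_mat_one_square[of N, where 'a = ratfun] by (metis mult_zero_left zero_neq_one)
    have detA: "det (flip_mat N f) \<noteq> 0"
      unfolding det_flip_mat[of N f] using f_nonzero J by simp
    have hom: "comm_ring_hom rconst" by (rule rconst_hom)
    interpret rc: map_poly_comm_ring_hom rconst
      unfolding map_poly_comm_ring_hom_def by (rule hom)
    have lin: "map_poly rconst [:1, w a, 1:] = [:1, rconst (w a), 1:]"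
      "map_poly rconst [:1, 1:] = [:1, 1:]" for a
      by (intro poly_eqI; simp add: coeff_map_poly coeff_pCons split: nat.splits)+
    have wx: "rconst (x a) + inverse (rconst (x a)) = rconst (w a)" for a
      by (simp flip: x(2) add: rconst_add rconst_inverse)
    have prod_eq: "(\<Prod>a<N. [:f (N - 1 - a), f a:]) = Polynomial.smult (\<Prod>a<N. f a)
        (map_poly rconst ((\<Prod>a<N div 2. [:1, w a, 1:]) * [:1, 1:] ^ (N mod 2)))"
    proof -
      have "(\<Prod>a<N. [:f (N - 1 - a), f a:]) = Polynomial.smult (\<Prod>a<N. f a)
          ((\<Prod>a<N div 2. [:1, rconst (x a) + inverse (rconst (x a)), 1:]) * [:1, 1:] ^ (N mod 2))"
        by (rule prod_flip_pairs) (simp_all add: f_def x(1))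
      then show ?thesis
        unfolding wx by (simp add: rc.hom_mult rc.hom_prod rc.hom_power lin)
    qed
    have Y: "Y_fun N p \<in> regular_at \<sigma> \<and> subst_fun \<sigma> (Y_fun N p) = rconst (y (Y_label p))"
      if p: "p \<in> {1..N div 2}" for p
    proof -
      have pN: "p \<le> N" using p le_trans[OF _ div_le_dividend, of p N 2] by simp
      note A_coeff = subst_A_coeff[of N \<sigma>, unfolded A, OF detA, of p]
      \<comment> \<open>The product of the entries and the uncomputed sign occur in the pencil as
        well as in the determinant and cancel.\<close>
      have "subst_fun \<sigma> (A_coeff N p) = rconst (c p)"
        unfolding A_coeff(2) pencil_det_flip_mat prod_eq det_flip_mat[of N f]
        using f_nonzero J w[OF p] by (simp add: coeff_map_poly del: rc.hom_mult)
      moreover have "Y_fun N p = A_coeff N p / (if N = 2 * p then 2 else 1)"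
        unfolding Y_fun_eq[OF pN] A_coeff_palindromic[OF pN] ..
      moreover have "subst_fun \<sigma> (if N = 2 * p then 2 else 1) \<noteq> 0"
        unfolding subst_half_or_one using two_ratfun_nonzero by simp
      ultimately have "Y_fun N p \<in> regular_at \<sigma>"
        "subst_fun \<sigma> (Y_fun N p) = rconst (c p) / (if N = 2 * p then 2 else 1)"
        using subst_divide[OF A_coeff(1) subst_half_or_one(1)] by (simp_all only: subst_half_or_one)
      moreover have "rconst (c p) / (if N = 2 * p then 2 else 1) = rconst (y (Y_label p))"
        using two_ratfun_nonzero by (simp add: c_def rconst_mult rconst_2)
      ultimately show ?thesis by simp
    qed
    have Z: "Z_fun N u p \<in> regular_at \<sigma> \<and> subst_fun \<sigma> (Z_fun N u p) = rconst (y (Z_label u p))"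
      if p: "p \<in> {1..N}" for u p
    proof -
      note Z_fun = subst_Z_fun[of N \<sigma> u p, unfolded B C]
      have "coeff (1 + (\<Sum>p=1..N. monom (rconst (y (Z_label u p))) p)) p =
          (\<Sum>q=1..N. if q = p then rconst (y (Z_label u p)) else 0)"
        using p unfolding coeff_add coeff_sum by (simp add: coeff_1)
      then show ?thesis
        using Z_fun p by (simp add: pencil_det_companion[OF N, of "\<lambda>p. rconst (y (Z_label u p))"])
    qed
    have i: "chain_casimir N j i \<in> regular_at \<sigma> \<and> subst_fun \<sigma> (chain_casimir N j i) = rconst (y i)"
      if "i \<in> ?J" for i
      using that Y Z by auto
    have "0 = subst_fun \<sigma> (eval_cpoly (chain_casimir N j) P)" using P by simp
    also have "\<dots> = eval_cpoly (\<lambda>i. subst_fun \<sigma> (chain_casimir N j i)) P"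
      using i P by (intro subst_eval_cpoly) blast
    also have "\<dots> = eval_cpoly (\<lambda>i. rconst (y i)) P"
      using i P by (intro eval_cpoly_cong) blast
    finally show "eval_cpoly (\<lambda>i. rconst (y i)) P = 0" ..
  qed
qed

section \<open>The functions X do not vanish\<close>

text \<open>At \<open>B_u = 1\<close> every factor after the first becomes 1. The entries of the
  inverses are regular there by Cramer's rule, since the determinant has value 1.\<close>

lemma subst_S_mat_B_one:
  assumes B: "\<And>u. mat N N (\<lambda>(a, b). \<sigma> (Entry (B_site u) a b)) = 1\<^sub>m N"
  shows "(\<forall>a<N. \<forall>b<N. S_mat N m $$ (a, b) \<in> regular_at \<sigma>) \<and>
    map_mat (subst_fun \<sigma>) (S_mat N m) = transpose_mat (mat N N (\<lambda>(a, b). \<sigma> (Entry A_site a b)))"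
proof (induction m)
  case 0
  show ?case by (simp add: subst_coord flip: map_mat_transpose subst_generic_mat)
next
  case (Suc m)
  let ?G = "mat_B N (Suc m)"
  let ?X = "the (mat_inverse ?G)"
  note inv = inverse_generic_mat[of N "B_site (Suc m)"]
  have GR: "?G $$ (a, b) \<in> regular_at \<sigma>" if "a < N" "b < N" for a b
    using that by (simp add: subst_coord)
  have G1: "map_mat (subst_fun \<sigma>) ?G = 1\<^sub>m N"
    by (simp add: subst_generic_mat B)
  have det: "subst_fun \<sigma> (det ?G) = 1"
    by (simp add: subst_det_generic_mat B)
  have XR: "?X $$ (a, b) \<in> regular_at \<sigma>" if "a < N" "b < N" for a b
  proof -
    have "?X $$ (a, b) = cofactor ?G b a / det ?G"
      by (rule left_inverse_mat_index[OF generic_mat_carrier inv(1,3) det_generic_mat_nonzero that])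
    moreover have "cofactor ?G b a \<in> regular_at \<sigma>"
      by (rule subst.cofactor_closed[OF generic_mat_carrier GR]) (use that in auto)
    ultimately show ?thesis using det by (simp add: subst_divide subst_det_generic_mat)
  qed
  have "map_mat (subst_fun \<sigma>) (?X * ?G) = map_mat (subst_fun \<sigma>) ?X * map_mat (subst_fun \<sigma>) ?G"
    by (rule subst.hom_mat_mult[OF inv(1) generic_mat_carrier XR GR])
  moreover have "map_mat (subst_fun \<sigma>) (1\<^sub>m N) = 1\<^sub>m N"
    by (intro eq_matI) auto
  ultimately have X1: "map_mat (subst_fun \<sigma>) ?X = 1\<^sub>m N"
    using inv G1 by simp
  define F where "F = (if odd (Suc m) then ?X else transpose_mat ?G)"
  have F: "F \<in> carrier_mat N N" using inv by (simp add: F_def)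
  have FR: "F $$ (a, b) \<in> regular_at \<sigma>" if "a < N" "b < N" for a b
    using that XR GR by (simp add: F_def)
  have F1: "map_mat (subst_fun \<sigma>) F = 1\<^sub>m N"
    using X1 G1 by (simp add: F_def flip: map_mat_transpose)
  have S: "S_mat N (Suc m) = S_mat N m * F" by (simp add: F_def)
  show ?case
    unfolding S
  proof (intro conjI allI impI)
    show "(S_mat N m * F) $$ (a, b) \<in> regular_at \<sigma>" if "a < N" "b < N" for a b
      by (rule subst.mat_mult_closed[OF S_mat_carrier F]) (use Suc.IH FR that in auto)
    have "map_mat (subst_fun \<sigma>) (S_mat N m * F) = map_mat (subst_fun \<sigma>) (S_mat N m) * map_mat (subst_fun \<sigma>) F"
      by (rule subst.hom_mat_mult[OF S_mat_carrier F]) (use Suc.IH FR in auto)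
    then show "map_mat (subst_fun \<sigma>) (S_mat N m * F) = transpose_mat (mat N N (\<lambda>(a, b). \<sigma> (Entry A_site a b)))"
      using Suc.IH F1 by simp
  qed
qed

lemma subst_upper_right_minor:
  assumes M: "M \<in> carrier_mat n n" and MR: "\<And>a b. a < n \<Longrightarrow> b < n \<Longrightarrow> M $$ (a, b) \<in> regular_at \<sigma>" and q: "q \<le> n"
  shows "subst_fun \<sigma> (upper_right_minor M q) = upper_right_minor (map_mat (subst_fun \<sigma>) M) q"
  unfolding upper_right_minor_def
  by (subst subst.hom_det[of _ q]) (use M MR q in \<open>auto intro!: arg_cong[of _ _ det] eq_matI\<close>)

lemma subst_upper_left_minor:
  assumes M: "M \<in> carrier_mat n n" and MR: "\<And>a b. a < n \<Longrightarrow> b < n \<Longrightarrow> M $$ (a, b) \<in> regular_at \<sigma>" and q: "q \<le> n"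
  shows "subst_fun \<sigma> (upper_left_minor M q) = upper_left_minor (map_mat (subst_fun \<sigma>) M) q"
  unfolding upper_left_minor_def
  by (subst subst.hom_det[of _ q]) (use M MR q in \<open>auto intro!: arg_cong[of _ _ det] eq_matI\<close>)

lemma upper_right_minor_flip_mat:
  assumes "q \<le> n"
  shows "upper_right_minor (flip_mat n (\<lambda>_. 1 :: 'a::field)) q \<noteq> 0"
proof -
  have "upper_right_minor (flip_mat n (\<lambda>_. 1 :: 'a)) q = det (flip_mat q (\<lambda>_. 1))"
    unfolding upper_right_minor_def
    by (intro arg_cong[of _ _ det] eq_matI) (use assms in \<open>auto simp: flip_mat_def\<close>)
  then show ?thesis
    using det_flip_mat_one_square[of q, where 'a = 'a] by (metis mult_zero_left zero_neq_one)
qed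

lemma upper_right_minor_C_nonzero:
  assumes "q \<le> N"
  shows "upper_right_minor (mat_C N u) q \<noteq> 0"
proof
  define \<sigma> where "\<sigma> v = (case v of Entry s a b \<Rightarrow> if a + b + 1 = N then 1 else (0 :: ratfun))" for v
  assume "upper_right_minor (mat_C N u) q = 0"
  then have "subst_fun \<sigma> (upper_right_minor (mat_C N u) q) = 0" by simp
  moreover have "map_mat (subst_fun \<sigma>) (mat_C N u) = flip_mat N (\<lambda>_. 1)"
    unfolding subst_generic_mat flip_mat_def by (simp add: \<sigma>_def)
  ultimately show False
    using subst_upper_right_minor[of "mat_C N u" N \<sigma> q] assms upper_right_minor_flip_mat[OF assms, where 'a = ratfun]
    by (simp add: subst_coord)
qed

text \<open>With all \<open>B_u\<close> equal to 1, \<open>S\<close> specialises to the transpose of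
  \<open>A\<close>, so an antidiagonal \<open>A\<close> is enough; for upper left minors the
  identity is.\<close>

lemma upper_right_minor_S_nonzero:
  assumes "q \<le> N"
  shows "upper_right_minor (S_mat N m) q \<noteq> 0"
proof
  define \<sigma> where "\<sigma> v = (case v of Entry s a b \<Rightarrow>
    if s = A_site then if a + b + 1 = N then 1 else 0 else if a = b then 1 else (0 :: ratfun))" for v
  assume "upper_right_minor (S_mat N m) q = 0"
  then have "subst_fun \<sigma> (upper_right_minor (S_mat N m) q) = 0" by simp
  moreover have "mat N N (\<lambda>(a, b). \<sigma> (Entry (B_site u) a b)) = 1\<^sub>m N" for u
    by (intro eq_matI) (auto simp: \<sigma>_def)
  note S = subst_S_mat_B_one[OF this, of m]
  moreover have "transpose_mat (mat N N (\<lambda>(a, b). \<sigma> (Entry A_site a b))) = flip_mat N (\<lambda>_. 1)"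
    by (intro eq_matI) (auto simp: \<sigma>_def flip_mat_def)
  ultimately show False
    using subst_upper_right_minor[OF S_mat_carrier, of N m \<sigma> q] assms upper_right_minor_flip_mat[OF assms, where 'a = ratfun]
    by simp
qed

lemma upper_left_minor_S_nonzero:
  assumes "q \<le> N"
  shows "upper_left_minor (S_mat N m) q \<noteq> 0"
proof
  define \<sigma> where "\<sigma> v = (case v of Entry s a b \<Rightarrow> if a = b then 1 else (0 :: ratfun))" for v
  assume "upper_left_minor (S_mat N m) q = 0"
  then have "subst_fun \<sigma> (upper_left_minor (S_mat N m) q) = 0" by simp
  moreover have "mat N N (\<lambda>(a, b). \<sigma> (Entry (B_site u) a b)) = 1\<^sub>m N" for u
    by (intro eq_matI) (auto simp: \<sigma>_def)
  note S = subst_S_mat_B_one[OF this, of m]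
  moreover have "transpose_mat (mat N N (\<lambda>(a, b). \<sigma> (Entry A_site a b))) = 1\<^sub>m N"
    by (intro eq_matI) (auto simp: \<sigma>_def)
  moreover have "upper_left_minor (1\<^sub>m N :: ratfun mat) q = det (1\<^sub>m q)"
    unfolding upper_left_minor_def by (intro arg_cong[of _ _ det] eq_matI) (use assms in auto)
  ultimately show False
    using subst_upper_left_minor[OF S_mat_carrier, of N m \<sigma> q] assms by simp
qed

lemma X_even_nonzero:
  assumes "p \<le> N"
  shows "X_even N j p \<noteq> 0"
  using assms by (simp add: X_even_def upper_right_minor_C_nonzero upper_right_minor_S_nonzero)

lemma X_odd_nonzero:
  assumes "p \<le> N"
  shows "X_odd N r p \<noteq> 0"
  using assms unfolding X_odd_eq_prod
  by (auto simp: upper_right_minor_C_nonzero upper_left_minor_S_nonzero det_generic_mat_nonzero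
      simp del: S_mat.simps)

section \<open>The torus action\<close>

lemma det_scale:
  fixes M :: "nat \<Rightarrow> nat \<Rightarrow> 'a::comm_ring_1"
  shows "det (mat q q (\<lambda>(a, b). f a * M a b * g b)) =
    (\<Prod>a<q. f a) * (\<Prod>b<q. g b) * det (mat q q (\<lambda>(a, b). M a b))"
proof -
  have "(\<Prod>i = 0..<q. mat q q (\<lambda>(a, b). f a * M a b * g b) $$ (i, p i)) =
      (\<Prod>a<q. f a) * (\<Prod>b<q. g b) * (\<Prod>i = 0..<q. mat q q (\<lambda>(a, b). M a b) $$ (i, p i))"
    if p: "p permutes {0..<q}" for p
  proof -
    have "(\<Prod>i = 0..<q. mat q q (\<lambda>(a, b). f a * M a b * g b) $$ (i, p i)) =
        (\<Prod>i = 0..<q. f i * mat q q (\<lambda>(a, b). M a b) $$ (i, p i) * g (p i))"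
      using permutes_less[OF p] by (intro prod.cong) auto
    also have "\<dots> = (\<Prod>i = 0..<q. f i) * (\<Prod>i = 0..<q. mat q q (\<lambda>(a, b). M a b) $$ (i, p i)) * (\<Prod>i = 0..<q. g (p i))"
      by (simp only: prod.distrib)
    also have "(\<Prod>i = 0..<q. g (p i)) = (\<Prod>b = 0..<q. g b)"
      using prod.permute[OF p, of g] by (simp add: o_def)
    finally show ?thesis by (simp add: atLeast0LessThan mult_ac)
  qed
  then show ?thesis
    by (subst (1 2) det_def'[of _ q]) (auto simp: sum_distrib_left mult_ac intro!: sum.cong)
qed

lemma pencil_det_scale:
  fixes U V :: "'a::comm_ring_1 mat"
  assumes "U \<in> carrier_mat n n" "V \<in> carrier_mat n n"
  shows "pencil_det (mat n n (\<lambda>(a, b). f a * U $$ (a, b) * g b)) (mat n n (\<lambda>(a, b). f a * V $$ (a, b) * g b)) =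
    Polynomial.smult ((\<Prod>a<n. f a) * (\<Prod>b<n. g b)) (pencil_det U V)"
proof -
  let ?M = "map_mat (\<lambda>x. [:x:]) U + [:0, 1:] \<cdot>\<^sub>m map_mat (\<lambda>x. [:x:]) V"
  have const: "(\<Prod>a<n. [:h a:]) = [:\<Prod>a<n. h a:]" for h :: "nat \<Rightarrow> 'a"
    by (induction n) (auto simp: one_pCons)
  have "map_mat (\<lambda>x. [:x:]) (mat n n (\<lambda>(a, b). f a * U $$ (a, b) * g b)) +
      [:0, 1:] \<cdot>\<^sub>m map_mat (\<lambda>x. [:x:]) (mat n n (\<lambda>(a, b). f a * V $$ (a, b) * g b)) =
      mat n n (\<lambda>(a, b). [:f a:] * ?M $$ (a, b) * [:g b:])"
    using assms by (intro eq_matI) (auto simp: mult.commute)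
  moreover have "mat n n (\<lambda>(a, b). ?M $$ (a, b)) = ?M"
    using assms by (intro eq_matI) auto
  ultimately show ?thesis
    unfolding pencil_det_def
    using det_scale[of n "\<lambda>a. [:f a:]" "\<lambda>a b. ?M $$ (a, b)" "\<lambda>b. [:g b:]"] by (simp add: const mult_ac)
qed

locale torus_action =
  fixes \<tau> :: "nat \<Rightarrow> complex"
  assumes \<tau>: "\<tau> a \<noteq> 0"
begin

text \<open>The scaling of \<open>B_1\<close> is matched to that of \<open>A\<close>: it absorbs the
  right factor in \<open>S\<close>, so that for \<open>j > 0\<close> the torus acts on
  \<open>S\<close> from the left only. Each pencil is multiplied by the same factor as its
  denominator.\<close>

definition scale :: "entry \<Rightarrow> complex"
  where "scale v = (case v of Entry s a b \<Rightarrow> (case s of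
      A_site \<Rightarrow> \<tau> a * \<tau> b
    | B_site u \<Rightarrow> if u = 1 then \<tau> b else 1
    | C_site u \<Rightarrow> if u = 1 then \<tau> b else 1))"

definition h :: "ratfun \<Rightarrow> ratfun"
  where "h = subst_fun (\<lambda>v. rconst (scale v) * coord v)"

definition T :: "nat \<Rightarrow> ratfun" where "T a = rconst (\<tau> a)"

lemma T_nonzero [simp]: "T a \<noteq> 0"
  using \<tau> by (simp add: T_def)

lemma regular: "regular_at (\<lambda>v. rconst (scale v) * coord v) = UNIV"
  using \<tau> by (intro regular_at_scaling[of scale]) (auto simp: scale_def split: entry.split site.split)

sublocale subring_hom UNIV h
  using subst.subring_hom_axioms[of "\<lambda>v. rconst (scale v) * coord v"] unfolding h_def regular .

lemma h_inverse: "h (inverse x) = inverse (h x)"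
proof (cases "x = 0")
  case False
  then have "h x * h (inverse x) = 1" by (simp flip: hom_mult)
  then show ?thesis by (metis inverse_unique)
qed simp

lemma h_divide: "h (x / y) = h x / h y"
  by (simp add: divide_inverse hom_mult h_inverse)

lemma h_coord:
  "h (coord (Entry A_site a b)) = T a * coord (Entry A_site a b) * T b"
  "h (coord (Entry (B_site u) a b)) = coord (Entry (B_site u) a b) * (if u = 1 then T b else 1)"
  "h (coord (Entry (C_site u) a b)) = coord (Entry (C_site u) a b) * (if u = 1 then T b else 1)"
  by (simp_all add: h_def subst_coord scale_def T_def rconst_mult)

lemma h_upper_right_minor_C:
  assumes "q \<le> N"
  shows "h (upper_right_minor (mat_C N u) q) =
    (if u = 1 then \<Prod>b<q. T (N - q + b) else 1) * upper_right_minor (mat_C N u) q"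
proof -
  let ?M = "mat q q (\<lambda>(a, b). mat_C N u $$ (a, N - q + b))"
  have "h (upper_right_minor (mat_C N u) q) = det (map_mat h ?M)"
    unfolding upper_right_minor_def by (subst hom_det[of _ q]) auto
  also have "map_mat h ?M = mat q q (\<lambda>(a, b). 1 * mat_C N u $$ (a, N - q + b) * (if u = 1 then T (N - q + b) else 1))"
    using assms by (intro eq_matI) (auto simp: h_coord)
  also have "det \<dots> = (\<Prod>b<q. if u = 1 then T (N - q + b) else 1) * upper_right_minor (mat_C N u) q"
    using det_scale[of q "\<lambda>_. 1" "\<lambda>a b. mat_C N u $$ (a, N - q + b)" "\<lambda>b. if u = 1 then T (N - q + b) else 1"]
    by (simp add: upper_right_minor_def)
  finally show ?thesis by auto
qed

lemma h_map_mat_A: "map_mat h (mat_A N) = mat N N (\<lambda>(a, b). T a * mat_A N $$ (a, b) * T b)"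
  by (intro eq_matI) (auto simp: h_coord)

lemma h_map_mat_BC:
  "Z \<in> {B_site, C_site} \<Longrightarrow> map_mat h (generic_mat N (Z u)) =
    mat N N (\<lambda>(a, b). 1 * generic_mat N (Z u) $$ (a, b) * (if u = 1 then T b else 1))"
  by (intro eq_matI) (auto simp: h_coord)

lemma mat_eta: "M \<in> carrier_mat n n \<Longrightarrow> mat n n (($$) M) = M"
  by (intro eq_matI) auto

lemma h_det_A: "h (det (mat_A N)) = (\<Prod>a<N. T a) * (\<Prod>a<N. T a) * det (mat_A N)"
  by (subst hom_det[OF generic_mat_carrier])
    (auto simp: h_map_mat_A det_scale[of N T "\<lambda>a b. mat_A N $$ (a, b)" T] mat_eta)

lemma h_det_BC:
  assumes "Z \<in> {B_site, C_site}"
  shows "h (det (generic_mat N (Z u))) = (\<Prod>b<N. if u = 1 then T b else 1) * det (generic_mat N (Z u))"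
  using det_scale[of N "\<lambda>_. 1" "\<lambda>a b. generic_mat N (Z u) $$ (a, b)" "\<lambda>b. if u = 1 then T b else 1"]
  by (subst hom_det[OF generic_mat_carrier]) (simp_all add: h_map_mat_BC[OF assms] mat_eta)

lemma h_A_coeff: "h (A_coeff N m) = A_coeff N m"
proof -
  have "map_mat h (transpose_mat (mat_A N)) = transpose_mat (map_mat h (mat_A N))"
    by (simp add: map_mat_transpose)
  also have "\<dots> = mat N N (\<lambda>(a, b). T a * transpose_mat (mat_A N) $$ (a, b) * T b)"
    unfolding h_map_mat_A by (intro eq_matI) auto
  finally have "h (coeff (pencil_det (transpose_mat (mat_A N)) (mat_A N)) m) =
      (\<Prod>a<N. T a) * (\<Prod>a<N. T a) * coeff (pencil_det (transpose_mat (mat_A N)) (mat_A N)) m"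
    by (subst hom_coeff_pencil_det[of _ N]) (simp_all add: h_map_mat_A pencil_det_scale)
  then show ?thesis by (simp add: A_coeff_def h_divide h_det_A)
qed

lemma h_Y_fun: "p \<le> N \<Longrightarrow> h (Y_fun N p) = Y_fun N p"
proof -
  have "h 2 = 2" using hom_add[of 1 1] by simp
  then show "p \<le> N \<Longrightarrow> h (Y_fun N p) = Y_fun N p"
    by (simp add: Y_fun_eq h_divide h_A_coeff)
qed

lemma h_Z_fun: "h (Z_fun N u p) = Z_fun N u p"
proof -
  let ?t = "\<Prod>b<N. if u = 1 then T b else 1"
  have "h (coeff (pencil_det (mat_B N u) (mat_C N u)) p) =
      coeff (pencil_det (map_mat h (mat_B N u)) (map_mat h (mat_C N u))) p"
    by (rule hom_coeff_pencil_det[of _ N]) simp_all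
  also have "\<dots> = ?t * coeff (pencil_det (mat_B N u) (mat_C N u)) p"
    unfolding h_map_mat_BC[OF insertI1] h_map_mat_BC[OF insertI2[OF singletonI]]
      pencil_det_scale[OF generic_mat_carrier generic_mat_carrier, where f = "\<lambda>_. 1" and
        g = "\<lambda>b. if u = 1 then T b else 1"] by simp
  finally have "h (coeff (pencil_det (mat_B N u) (mat_C N u)) p) = ?t * coeff (pencil_det (mat_B N u) (mat_C N u)) p" .
  moreover have "?t \<noteq> 0" by (auto simp: prod_zero_iff)
  ultimately show ?thesis
    using h_det_BC[of B_site N u] by (simp add: Z_fun_eq h_divide)
qed

text \<open>The rescaled inverse is an inverse of the rescaled matrix, and inverses are
  unique.\<close>

lemma h_inverse_B:
  fixes N u
  defines "X \<equiv> the (mat_inverse (mat_B N u))" and "t \<equiv> \<lambda>b. if u = 1 then T b else 1"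
  assumes "a < N" "b < N"
  shows "h (X $$ (a, b)) = X $$ (a, b) / t a"
proof -
  let ?G = "mat_B N u"
  define X' where "X' = mat N N (\<lambda>(a, b). inverse (t a) * X $$ (a, b))"
  note inv = inverse_generic_mat[of N "B_site u", folded X_def]
  have t: "t b \<noteq> 0" for b by (simp add: t_def)
  have hG: "map_mat h ?G \<in> carrier_mat N N" and hX: "map_mat h X \<in> carrier_mat N N"
    and X': "X' \<in> carrier_mat N N" using inv by (simp_all add: X'_def)
  have "map_mat h ?G * X' = 1\<^sub>m N"
  proof (rule eq_matI)
    fix a b assume "a < dim_row (1\<^sub>m N)" "b < dim_col (1\<^sub>m N)"
    then have ab: "a < N" "b < N" by auto
    have "(map_mat h ?G * X') $$ (a, b) = (\<Sum>c<N. map_mat h ?G $$ (a, c) * X' $$ (c, b))"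
      by (rule index_mult_mat_sum[OF hG X' ab])
    also have "\<dots> = (\<Sum>c<N. ?G $$ (a, c) * X $$ (c, b))"
      using ab t by (intro sum.cong) (auto simp: X'_def h_coord t_def field_simps)
    also have "\<dots> = (?G * X) $$ (a, b)"
      by (rule index_mult_mat_sum[OF generic_mat_carrier inv(1) ab, symmetric])
    finally show "(map_mat h ?G * X') $$ (a, b) = 1\<^sub>m N $$ (a, b)" using inv(2) by simp
  qed (use X' in auto)
  moreover have "map_mat h X * map_mat h ?G = 1\<^sub>m N"
  proof -
    have "map_mat h (1\<^sub>m N) = 1\<^sub>m N" by (intro eq_matI) auto
    then show ?thesis using hom_mat_mult[OF inv(1) generic_mat_carrier[of N "B_site u"]] inv(3) by simp
  qed
  ultimately have "map_mat h X = X'"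
    using assoc_mult_mat[OF hX hG X'] hX X' by simp
  then have "map_mat h X $$ (a, b) = X' $$ (a, b)" by simp
  then show ?thesis using assms(3,4) inv(1) by (simp add: X'_def divide_inverse mult.commute)
qed

lemma h_S_mat:
  "a < N \<Longrightarrow> b < N \<Longrightarrow> h (S_mat N m $$ (a, b)) = T a * S_mat N m $$ (a, b) * (if m = 0 then T b else 1)"
proof (induction m arbitrary: a b)
  case 0
  then show ?case by (simp add: h_coord mult_ac)
next
  case (Suc m)
  define F where "F = (if odd (Suc m) then the (mat_inverse (mat_B N (Suc m))) else transpose_mat (mat_B N (Suc m)))"
  have F: "F \<in> carrier_mat N N" using inverse_generic_mat(1) by (simp add: F_def)
  have hF: "h (F $$ (c, b)) = F $$ (c, b) / (if m = 0 then T c else 1)" if "c < N" for c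
    using that Suc.prems h_inverse_B[of c N b "Suc m"] by (auto simp: F_def h_coord)
  have S: "S_mat N (Suc m) $$ (a, b) = (\<Sum>c<N. S_mat N m $$ (a, c) * F $$ (c, b))"
    using index_mult_mat_sum[OF S_mat_carrier F Suc.prems, of m] by (simp add: F_def del: index_mult_mat)
  have "h (S_mat N (Suc m) $$ (a, b)) = (\<Sum>c<N. h (S_mat N m $$ (a, c)) * h (F $$ (c, b)))"
    unfolding S by (subst hom_sum) (simp_all add: hom_mult)
  also have "\<dots> = (\<Sum>c<N. T a * (S_mat N m $$ (a, c) * F $$ (c, b)))"
    using Suc.IH Suc.prems hF by (intro sum.cong) (auto simp del: S_mat.simps)
  finally show ?case by (simp add: S sum_distrib_left del: S_mat.simps)
qed

lemma h_upper_right_minor_S: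
  assumes "q \<le> N"
  shows "h (upper_right_minor (S_mat N m) q) =
    (\<Prod>a<q. T a) * (if m = 0 then \<Prod>b<q. T (N - q + b) else 1) * upper_right_minor (S_mat N m) q"
proof -
  let ?M = "mat q q (\<lambda>(a, b). S_mat N m $$ (a, N - q + b))"
  have dim: "dim_col (S_mat N m) = N" using S_mat_carrier[of N m] by simp
  have "h (upper_right_minor (S_mat N m) q) = det (map_mat h ?M)"
    unfolding upper_right_minor_def dim by (subst hom_det[of _ q]) auto
  also have "map_mat h ?M = mat q q (\<lambda>(a, b). T a * S_mat N m $$ (a, N - q + b) * (if m = 0 then T (N - q + b) else 1))"
    using assms by (intro eq_matI) (auto simp: h_S_mat)
  also have "det \<dots> = (\<Prod>a<q. T a) * (\<Prod>b<q. if m = 0 then T (N - q + b) else 1) * upper_right_minor (S_mat N m) q"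
    unfolding det_scale upper_right_minor_def dim ..
  finally show ?thesis by auto
qed

lemma h_upper_left_minor_S:
  assumes "q \<le> N" "m \<noteq> 0"
  shows "h (upper_left_minor (S_mat N m) q) = (\<Prod>a<q. T a) * upper_left_minor (S_mat N m) q"
proof -
  let ?M = "mat q q (\<lambda>(a, b). S_mat N m $$ (a, b))"
  have "h (upper_left_minor (S_mat N m) q) = det (map_mat h ?M)"
    unfolding upper_left_minor_def by (subst hom_det[of _ q]) auto
  also have "map_mat h ?M = mat q q (\<lambda>(a, b). T a * S_mat N m $$ (a, b) * 1)"
    using assms by (intro eq_matI) (auto simp: h_S_mat)
  also have "det \<dots> = (\<Prod>a<q. T a) * (\<Prod>b<q. 1) * upper_left_minor (S_mat N m) q"
    unfolding det_scale upper_left_minor_def ..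
  finally show ?thesis by simp
qed

text \<open>The column factors come from \<open>C_1\<close> if \<open>j > 0\<close> and from
  \<open>S\<close> itself if \<open>j = 0\<close>, so one formula covers both cases.\<close>

lemma h_X_even:
  fixes N
  defines "\<omega> \<equiv> \<lambda>q. (\<Prod>a<q. T a) * (\<Prod>b<q. T (N - q + b))"
  assumes "even j" "p \<le> N"
  shows "h (X_even N j p) = \<omega> p / \<omega> (N - p) * X_even N j p"
proof -
  have "h (upper_right_minor (S_mat N j) q * (\<Prod>u=1..j. upper_right_minor (mat_C N u) q)) =
      \<omega> q * (upper_right_minor (S_mat N j) q * (\<Prod>u=1..j. upper_right_minor (mat_C N u) q))" if q: "q \<le> N" for q
  proof -
    have "h (\<Prod>u=1..j. upper_right_minor (mat_C N u) q) =
        (\<Prod>u=1..j. (if u = 1 then \<Prod>b<q. T (N - q + b) else 1) * upper_right_minor (mat_C N u) q)"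
      by (subst hom_prod) (simp_all add: h_upper_right_minor_C[OF q])
    also have "\<dots> = (if j = 0 then 1 else \<Prod>b<q. T (N - q + b)) * (\<Prod>u=1..j. upper_right_minor (mat_C N u) q)"
      unfolding prod.distrib by (auto simp: prod.delta)
    finally show ?thesis
      by (simp add: hom_mult h_upper_right_minor_S[OF q] \<omega>_def)
  qed
  then show ?thesis
    using assms(3) by (simp add: X_even_def h_divide)
qed

text \<open>The determinants of \<open>B_1\<close> and \<open>C_1\<close> together contribute the
  square of \<open>\<alpha> N\<close>, as does \<open>det A\<close>; the two cancel.\<close>

lemma h_X_odd:
  fixes N
  defines "\<alpha> \<equiv> \<lambda>q. \<Prod>a<q. T a" and "\<kappa> \<equiv> \<lambda>q. \<Prod>b<q. T (N - q + b)"
  assumes p: "p \<le> N"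
  shows "h (X_odd N r p) = \<alpha> p * \<alpha> (N - p) / (\<kappa> p * \<kappa> (N - p)) * X_odd N r p"
proof -
  define MC where "MC u = upper_right_minor (mat_C N u) p * upper_right_minor (mat_C N u) (N - p)" for u
  define d where "d u = det (mat_B N u) * det (mat_C N u)" for u
  have pN: "N - p \<le> N" by simp
  have t: "\<alpha> N \<noteq> 0" by (simp add: \<alpha>_def)
  have MC: "h (MC u) = (if u = 1 then \<kappa> p * \<kappa> (N - p) else 1) * MC u" for u
    using h_upper_right_minor_C[OF p, of u] h_upper_right_minor_C[OF pN, of u]
    by (simp add: MC_def hom_mult \<kappa>_def)
  have d: "h (d u) = (if u = 1 then \<alpha> N * \<alpha> N else 1) * d u" for u
    using h_det_BC[of B_site N u] h_det_BC[of C_site N u] by (simp add: d_def hom_mult \<alpha>_def)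
  have "h (\<Prod>u=1..2 * r + 1. if even u then MC u / d u else d u / MC u) =
      (\<Prod>u=1..2 * r + 1. (if u = 1 then \<alpha> N * \<alpha> N / (\<kappa> p * \<kappa> (N - p)) else 1) * (if even u then MC u / d u else d u / MC u))"
    by (subst hom_prod) (auto simp: h_divide MC d intro!: prod.cong)
  also have "\<dots> = \<alpha> N * \<alpha> N / (\<kappa> p * \<kappa> (N - p)) * (\<Prod>u=1..2 * r + 1. if even u then MC u / d u else d u / MC u)"
    unfolding prod.distrib by (simp add: prod.delta)
  finally have P: "h (\<Prod>u=1..2 * r + 1. if even u then MC u / d u else d u / MC u) =
      \<alpha> N * \<alpha> N / (\<kappa> p * \<kappa> (N - p)) * (\<Prod>u=1..2 * r + 1. if even u then MC u / d u else d u / MC u)" .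
  have S: "h (upper_left_minor (S_mat N (2 * r + 1)) q) = \<alpha> q * upper_left_minor (S_mat N (2 * r + 1)) q"
    if "q \<le> N" for q
    unfolding \<alpha>_def by (rule h_upper_left_minor_S[OF that]) simp
  have cancel: "\<alpha> p * x * (\<alpha> (N - p) * z) / (\<alpha> N * \<alpha> N * e) * (\<alpha> N * \<alpha> N / (\<kappa> p * \<kappa> (N - p)) * w) =
      \<alpha> p * \<alpha> (N - p) / (\<kappa> p * \<kappa> (N - p)) * (x * z / e * w)" for x z e w
    using t by (cases "e = 0"; cases "\<kappa> p * \<kappa> (N - p) = 0"; simp add: field_simps)
  have detA: "h (det (mat_A N)) = \<alpha> N * \<alpha> N * det (mat_A N)"
    unfolding \<alpha>_def by (rule h_det_A)
  show ?thesis
    unfolding X_odd_eq_prod MC_def[symmetric] d_def[symmetric] hom_mult[OF UNIV_I UNIV_I] h_divide P S[OF p] S[OF pN] detA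
    by (rule cancel)
qed

end

section \<open>Independence of all the functions\<close>

definition pick :: "nat \<Rightarrow> complex \<Rightarrow> nat \<Rightarrow> complex"
  where "pick i c a = (if a = i then c else 1)"

lemma prod_pick: "(\<Prod>a<q. rconst (pick i c a)) = (if i < q then rconst c else 1)"
proof -
  have "(\<Prod>a<q. rconst (pick i c a)) = (\<Prod>a<q. if a = i then rconst c else 1)"
    by (intro prod.cong) (auto simp: pick_def)
  then show ?thesis by simp
qed

lemma prod_pick_last:
  assumes "i < N" "q \<le> N"
  shows "(\<Prod>b<q. rconst (pick i c (N - q + b))) = (if i < N - q then 1 else rconst c)"
proof -
  have "(\<Prod>b<q. rconst (pick i c (N - q + b))) =
      (\<Prod>b<q. if b = i - (N - q) then if i < N - q then 1 else rconst c else 1)"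
    using assms by (intro prod.cong) (auto simp: pick_def)
  then show ?thesis using assms by auto
qed

text \<open>The 0-based index \<open>p\<close> lies neither among the first \<open>p\<close> indices
  nor among the last \<open>p\<close>, but both among the first and among the last
  \<open>N - p\<close>: this gives the factor \<open>c * c\<close> in the denominator. For
  \<open>p' > p\<close> it is counted once in the numerator and once in the denominator. Hence the
  functions are adjoined with descending \<open>p\<close>.\<close>

lemma torus_X_even:
  assumes j: "even j" and p: "2 * p < N" and c: "c \<noteq> 0"
  defines "act \<equiv> torus_action.h (pick p c)"
  shows "act (X_even N j p) = rconst (inverse (c * c)) * X_even N j p"
    and "p < p' \<Longrightarrow> 2 * p' < N \<Longrightarrow> act (X_even N j p') = X_even N j p'"
proof -
  interpret torus_action "pick p c" using c by unfold_locales (simp add: pick_def)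
  have \<omega>: "(\<Prod>a<q. T a) * (\<Prod>b<q. T (N - q + b)) =
      (if p < q then rconst c else 1) * (if p < N - q then 1 else rconst c)" if "q \<le> N" for q
    unfolding T_def prod_pick using prod_pick_last[of p N q c] p that by simp
  have X: "act (X_even N j p') = (if p < p' then rconst c else 1) * (if p < N - p' then 1 else rconst c) /
      ((if p < N - p' then rconst c else 1) * (if p < p' then 1 else rconst c)) * X_even N j p'"
    if "p' \<le> N" for p'
    unfolding act_def h_X_even[OF j that] \<omega>[OF that] \<omega>[OF diff_le_self] using that by simp
  show "act (X_even N j p) = rconst (inverse (c * c)) * X_even N j p"
    using p c by (subst X) (auto simp: rconst_inverse rconst_mult divide_inverse)
  show "act (X_even N j p') = X_even N j p'" if "p < p'" "2 * p' < N"
    using p c that by (subst X) auto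
qed

text \<open>The index \<open>p - 1\<close> is counted in both row products but in neither column
  product. For \<open>p' < p\<close> only the size \<open>N - p'\<close> sees it, once in the rows
  and once in the columns. Hence the functions are adjoined with ascending \<open>p\<close>.\<close>

lemma torus_X_odd:
  assumes p: "1 \<le> p" "2 * p \<le> N" and c: "c \<noteq> 0"
  defines "act \<equiv> torus_action.h (pick (p - 1) c)"
  shows "act (X_odd N r p) = rconst (c * c) * X_odd N r p"
    and "1 \<le> p' \<Longrightarrow> p' < p \<Longrightarrow> act (X_odd N r p') = X_odd N r p'"
proof -
  interpret torus_action "pick (p - 1) c" using c by unfold_locales (simp add: pick_def)
  have \<alpha>: "(\<Prod>a<q. T a) = (if p - 1 < q then rconst c else 1)" for q
    unfolding T_def prod_pick ..
  have \<kappa>: "(\<Prod>b<q. T (N - q + b)) = (if p - 1 < N - q then 1 else rconst c)" if "q \<le> N" for q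
    unfolding T_def using prod_pick_last[of "p - 1" N q c] p that by simp
  have "act (X_odd N r p') = (if p' = p then rconst (c * c) else 1) * X_odd N r p'" if "p' \<le> p" "1 \<le> p'" for p'
  proof -
    have "p' \<le> N" "N - p' \<le> N" "p - 1 < N - p'" "p - 1 < p' \<longleftrightarrow> p' = p" "N - (N - p') = p'"
      using p that by auto
    then show ?thesis
      unfolding act_def h_X_odd[OF \<open>p' \<le> N\<close>] \<alpha> \<kappa>[OF \<open>p' \<le> N\<close>] \<kappa>[OF diff_le_self]
      using c by (auto simp: rconst_mult)
  qed
  then show "act (X_odd N r p) = rconst (c * c) * X_odd N r p"
    "1 \<le> p' \<Longrightarrow> p' < p \<Longrightarrow> act (X_odd N r p') = X_odd N r p'"
    using p by simp_all
qed

text \<open>Applying the torus element to a relation keeps its constant coefficients and the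
  functions of \<open>J\<close>, and thus yields the relation with \<open>f i\<close>
  rescaled.\<close>

lemma independent_insert_by_torus:
  assumes ind: "algebraically_independent J f" and nz: "f i \<noteq> 0"
    and act: "\<And>d. d \<noteq> 0 \<Longrightarrow> \<exists>\<tau>. torus_action \<tau> \<and>
      torus_action.h \<tau> (f i) = rconst d * f i \<and> (\<forall>l\<in>J. torus_action.h \<tau> (f l) = f l)"
  shows "algebraically_independent (insert i J) f"
proof (rule algebraically_independent_insert[OF ind _ nz])
  show "infinite (UNIV - {0 :: complex})"
    using infinite_UNIV_char_0 by simp
  fix d :: complex and P
  assume "d \<in> UNIV - {0}" and P: "indets P \<subseteq> insert i J" "eval_cpoly f P = 0"
  then obtain \<tau> where act_\<tau>: "torus_action \<tau>" "torus_action.h \<tau> (f i) = rconst d * f i"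
    "\<And>l. l \<in> J \<Longrightarrow> torus_action.h \<tau> (f l) = f l"
    using act[of d] by auto
  interpret torus_action \<tau> by fact
  have "0 = h (eval_cpoly f P)" using P by simp
  also have "\<dots> = eval_cpoly (\<lambda>l. h (f l)) P"
    unfolding h_def by (rule subst_eval_cpoly) (simp add: regular)
  also have "\<dots> = eval_cpoly (f(i := rconst d * f i)) P"
    using P(1) act_\<tau>(2,3) by (intro eval_cpoly_cong) auto
  finally show "eval_cpoly (f(i := rconst d * f i)) P = 0" ..
qed

lemma independent_chain_casimir:
  assumes N: "N \<ge> 1"
  shows "algebraically_independent (casimir_labels N j) (chain_casimir N j)"
proof -
  let ?f = "chain_casimir N j"
  let ?YZ = "Y_label ` {1..N div 2} \<union> {Z_label k p | k p. k \<in> {1..j} \<and> p \<in> {1..N}}"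
  have YZ: "torus_action.h \<tau> (?f i) = ?f i" if "torus_action \<tau>" "i \<in> ?YZ" for \<tau> i
  proof -
    interpret torus_action \<tau> by fact
    have "p \<le> N" if "p \<le> N div 2" for p using that le_trans[OF _ div_le_dividend] by blast
    then show ?thesis using that(2) by (auto simp: h_Y_fun h_Z_fun)
  qed
  have pick: "torus_action (pick i c)" if "c \<noteq> 0" for i c
    using that by unfold_locales (simp add: pick_def)
  show ?thesis
  proof (cases "even j")
    case True
    let ?n = "(N + 1) div 2"
    have "algebraically_independent (?YZ \<union> X_label ` {?n - d..<?n}) ?f" if "d \<le> ?n" for d
      using that
    proof (induction d)
      case 0
      then show ?case using independent_Y_Z[OF N, of j] by simp
    next
      case (Suc d)
      define p where "p = ?n - Suc d"
      have p: "2 * p < N" "?n - d = Suc p" "p < ?n" using Suc.prems by (auto simp: p_def)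
      have small: "2 * p' < N" if "p' < ?n" for p' using that by auto
      have "algebraically_independent (insert (X_label p) (?YZ \<union> X_label ` {Suc p..<?n})) ?f"
      proof (rule independent_insert_by_torus)
        show "algebraically_independent (?YZ \<union> X_label ` {Suc p..<?n}) ?f"
          using Suc p by simp
        show "?f (X_label p) \<noteq> 0" using True p by (simp add: X_even_nonzero)
        fix d :: complex assume d: "d \<noteq> 0"
        \<comment> \<open>Since \<open>X_p\<close> is rescaled by the inverse square of
          \<open>c\<close>, a square root realises every prescribed factor \<open>d\<close>.\<close>
        define c where "c = inverse (csqrt d)"
        have "csqrt d * csqrt d = d" by (simp flip: power2_eq_square)
        then have c: "c \<noteq> 0" "inverse (c * c) = d" using d by (simp_all add: c_def)
        have "torus_action.h (pick p c) (?f l) = ?f l" if "l \<in> ?YZ \<union> X_label ` {Suc p..<?n}" for l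
          using that
        proof (elim UnE)
          assume "l \<in> X_label ` {Suc p..<?n}"
          then obtain p' where "l = X_label p'" "p < p'" "2 * p' < N" using small by auto
          then show ?thesis using torus_X_even(2)[OF True p(1) c(1)] True by simp
        qed (use YZ[OF pick[OF c(1)]] in blast)+
        then show "\<exists>\<tau>. torus_action \<tau> \<and> torus_action.h \<tau> (?f (X_label p)) = rconst d * ?f (X_label p) \<and>
            (\<forall>l\<in>?YZ \<union> X_label ` {Suc p..<?n}. torus_action.h \<tau> (?f l) = ?f l)"
          using torus_X_even(1)[OF True p(1) c(1)] True pick[OF c(1)] c(2) by (intro exI[of _ "pick p c"]) simp
      qed
      moreover have "{?n - Suc d..<?n} = insert p {Suc p..<?n}"
        using p(3) by (auto simp: p_def)
      ultimately show ?case by (simp only: image_insert Un_insert_right)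
    qed
    from this[of ?n] show ?thesis using True by (simp add: casimir_labels_def)
  next
    case False
    have "algebraically_independent (?YZ \<union> X_label ` {1..d}) ?f" if "d \<le> N div 2" for d
      using that
    proof (induction d)
      case 0
      then show ?case using independent_Y_Z[OF N, of j] by simp
    next
      case (Suc d)
      have p: "1 \<le> Suc d" "2 * Suc d \<le> N" using Suc.prems by auto
      have "algebraically_independent (insert (X_label (Suc d)) (?YZ \<union> X_label ` {1..d})) ?f"
      proof (rule independent_insert_by_torus)
        show "algebraically_independent (?YZ \<union> X_label ` {1..d}) ?f"
          using Suc by simp
        show "?f (X_label (Suc d)) \<noteq> 0" using False p by (simp add: X_odd_nonzero)
        fix e :: complex assume e: "e \<noteq> 0"
        define c where "c = csqrt e"
        have c: "c \<noteq> 0" "c * c = e" using e by (simp_all add: c_def power2_eq_square[symmetric])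
        have "torus_action.h (pick (Suc d - 1) c) (?f l) = ?f l" if "l \<in> ?YZ \<union> X_label ` {1..d}" for l
          using that
        proof (elim UnE)
          assume "l \<in> X_label ` {1..d}"
          then obtain p' where "l = X_label p'" "1 \<le> p'" "p' < Suc d" by auto
          then show ?thesis using torus_X_odd(2)[OF p c(1)] False by simp
        qed (use YZ[OF pick[OF c(1)]] in blast)+
        then show "\<exists>\<tau>. torus_action \<tau> \<and> torus_action.h \<tau> (?f (X_label (Suc d))) = rconst e * ?f (X_label (Suc d)) \<and>
            (\<forall>l\<in>?YZ \<union> X_label ` {1..d}. torus_action.h \<tau> (?f l) = ?f l)"
          using torus_X_odd(1)[OF p c(1)] False pick[OF c(1)] c(2) by (intro exI[of _ "pick (Suc d - 1) c"]) simp
      qed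
      moreover have "{1..Suc d} = insert (Suc d) {1..d}" by auto
      ultimately show ?case by (simp only: image_insert Un_insert_right)
    qed
    from this[of "N div 2"] show ?thesis using False by (simp add: casimir_labels_def)
  qed
qed

lemma card_casimir_labels:
  "card (casimir_labels N j) = N div 2 + N * j + (if even j then (N + 1) div 2 else N div 2)"
proof -
  let ?X = "if even j then {0..<(N + 1) div 2} else {1..N div 2}"
  have Z: "{Z_label k p | k p. k \<in> {1..j} \<and> p \<in> {1..N}} = (\<lambda>(k, p). Z_label k p) ` ({1..j} \<times> {1..N})"
    by auto
  have "card (Y_label ` {1..N div 2}) = N div 2"
    by (subst card_image) (auto simp: inj_on_def)
  moreover have "card ((\<lambda>(k, p). Z_label k p) ` ({1..j} \<times> {1..N})) = N * j"
    by (subst card_image) (auto simp: inj_on_def)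
  moreover have "card (X_label ` ?X) = (if even j then (N + 1) div 2 else N div 2)"
    by (subst card_image) (auto simp: inj_on_def)
  moreover have "card (casimir_labels N j) = card (Y_label ` {1..N div 2}) +
      card ((\<lambda>(k, p). Z_label k p) ` ({1..j} \<times> {1..N})) + card (X_label ` ?X)"
    unfolding casimir_labels_def Z by (subst card_Un_disjoint; (subst card_Un_disjoint)?) auto
  ultimately show ?thesis by simp
qed

theorem theorem6p10:
  fixes N j :: nat and br :: "ratfun \<Rightarrow> ratfun \<Rightarrow> ratfun"
  assumes "N \<ge> 1"
    and "poisson_bracket_on (chain_functions N j) br"
    and "type_ii_relations N j br"
  shows
    "pencil_A N = (fls_X_intpow (int N) + fls_X_intpow (- int N))
       + (\<Sum>p=1..N div 2.
           (fls_X_intpow (int N - 2 * int p) + fls_X_intpow (2 * int p - int N))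
             * fls_const (Y_fun N p))
     \<and> (\<forall>k\<in>{1..j}. pencil_BC N k = 1 + (\<Sum>p=1..N. Polynomial.monom (Z_fun N k p) p))
     \<and> (\<forall>i\<in>casimir_labels N j. casimir_function N j br (chain_casimir N j i))
     \<and> algebraically_independent (casimir_labels N j) (chain_casimir N j)
     \<and> (even j \<longrightarrow> card (chain_casimir N j ` casimir_labels N j) = N div 2 + (N + 1) div 2 + N * j
          \<and> card (chain_casimir N j ` casimir_labels N j) = N * (j + 1))
     \<and> (odd j \<longrightarrow> card (chain_casimir N j ` casimir_labels N j) = 2 * (N div 2) + N * j)"
proof -
  interpret type_ii_bracket N j br using assms by unfold_locales
  have "card (chain_casimir N j ` casimir_labels N j) =
      N div 2 + N * j + (if even j then (N + 1) div 2 else N div 2)"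
    using card_image[OF algebraically_independent_inj_on[OF independent_chain_casimir[OF assms(1)]]]
    by (simp add: card_casimir_labels)
  moreover have "N div 2 + (N + 1) div 2 = N" by presburger
  ultimately show ?thesis
    using pencil_A_expansion[OF assms(1)] pencil_BC_expansion casimir_chain_casimir[OF assms(1)]
      independent_chain_casimir[OF assms(1)]
    by auto
qed

end
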